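(* Let $M,\bar M$ be complete $n$-dimensional Riemannian manifolds, and let the cost $c:M\times\bar M\to\mathbb R$ be semiconcave in both variables and satisfy the conditions (twist), ($c$-exp), (domain convexity) and (convex DASM) defined in the context. Let $\phi$ be a $c$-convex function on $M$, and assume that for a fixed $\lambda>0$ one has $\lambda|\Omega|\le|\partial^c\phi(\Omega)|$ for all Borel sets $\Omega\subset M$. Fix $(x_0,\bar x_0)\in M\times\bar M$ with $\bar x_0\in\partial^c\phi(x_0)$, and for $h>0$ let $$Z_h:=\{x\in M:\ \phi(x)-\phi(x_0)\le-c(x,\bar x_0)+c(x_0,\bar x_0)+h\}.$$ Assume that $-c(\cdot,\bar x_0)$ is smooth on $Z_h$, so that $(\bar c\text{-Exp}_{\bar x_0})^{-1}$ is defined and smooth on $Z_h$; equivalently, $Z_h\subset M(\bar x_0)$. Then $$\lambda|Z_h|^2\le C(n)\left[\frac{\max_{x\in Z_h}|\det(-D_xD_{\bar x}c(x,\bar x_0))|}{\min_{x\in Z_h}|\det(-D_xD_{\bar x}c(x,\bar x_0))|}\right]^2\Big[\sup_{x\in Z_h}\ \sup_{p'\in M^*(x)}\big|\det\big(d\,c\text{-Exp}_x\big|_{p=p'}\big)\big|\Big]\,h^n,$$ with the constant $C(n)=(4n)^n|B_1|^2$, where $|B_1|$ is the volume of the unit ball in $\mathbb R^n$.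
   Context: Smooth means $C^\infty$; $|\cdot|$ of a set denotes Riemannian volume. Semiconcave means that in coordinate charts the function is a sum of a concave and a smooth function. Put $\bar c(\bar x,x):=c(x,\bar x)$. For $\bar x\in\bar M$, $c\text{-Cut}(\bar x)$ is the set of $x\in M$ such that $c$ is not smooth in a neighborhood of $(x,\bar x)$, and $M(\bar x):=M\setminus c\text{-Cut}(\bar x)$; for $x\in M$, $c\text{-Cut}(x)\subset\bar M$ and $\bar M(x):=\bar M\setminus c\text{-Cut}(x)$ are defined symmetrically. $D_x,D_{\bar x}$ are partial differentials, $D_xD_{\bar x}c$ is the mixed second derivative; determinants are taken with respect to orthonormal bases of the relevant (co)tangent spaces. $\langle\cdot,\cdot\rangle$ pairs covectors with vectors. (twist): for each $(x,\bar x)$ the maps $-D_xc(x,\cdot):\bar M(x)\to T_x^*M$ and $-D_{\bar x}c(\cdot,\bar x):M(\bar x)\to T^*_{\bar x}\bar M$ are smooth embeddings. Let $M^*(x):=-D_xc(x,\bar M(x))\subset T^*_xM$ and $\bar M^*(\bar x):=-D_{\bar x}c(M(\bar x),\bar x)\subset T^*_{\bar x}\bar M$. The maps $c\text{-Exp}_x:M^*(x)\to\bar M$ and $\bar c\text{-Exp}_{\bar x}:\bar M^*(\bar x)\to M$ are the inverses of $-D_xc(x,\cdot)$ and $-D_{\bar x}c(\cdot,\bar x)$. The subdifferential of a semiconvex function $\alpha$ at $x$ is $\partial\alpha(x)=\{p\in T_x^*M:\alpha(\exp_xv)-\alpha(x)\ge\langle p,v\rangle+o(|v|)\text{ as }v\to0\}$;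 $\partial_x,\partial_{\bar x}$ denote subdifferentials in the respective variable. ($c$-exp): for each $(x,\bar x)$, $c\text{-Exp}_x$ and $\bar c\text{-Exp}_{\bar x}$ extend to smooth maps (same notation) from the closures $\mathrm{cl}(M^*(x))$ onto $\bar M$ and $\mathrm{cl}(\bar M^*(\bar x))$ onto $M$, and $c\text{-Exp}_xp=c\text{-Exp}_x\big(\partial_x(-c(x,c\text{-Exp}_xp))\big)$ for all $p\in\mathrm{cl}(M^*(x))$, $\bar c\text{-Exp}_{\bar x}\bar p=\bar c\text{-Exp}_{\bar x}\big(\partial_{\bar x}(-c(\bar c\text{-Exp}_{\bar x}\bar p,\bar x))\big)$ for all $\bar p\in\mathrm{cl}(\bar M^*(\bar x))$ (i.e. every element of the subdifferential on the right is mapped to the point on the left). (domain convexity): $M^*(x)$ and $\bar M^*(\bar x)$ are convex for all $x,\bar x$. A $c$-segment with respect to $x$ is a curve $\bar x(t)=c\text{-Exp}_x((1-t)p_0+tp_1)$, $0\le t\le1$, with $p_0,p_1\in\mathrm{cl}(M^*(x))$; a $\bar c$-segment $x(t)$ with respect to $\bar x$ is defined symmetrically. (convex DASM): for every $(x,\bar x)$, every $c$-segment $\bar x(t)$ with respect to $x$ and every $\bar c$-segment $x(t)$ with respect to $\bar x$, the functions $m_t(\cdot)=-c(\cdot,\bar x(t))+c(x,\bar x(t))$ and $\bar m_t(\cdot)=-c(x(t),\cdot)+c(x(t),\bar x)$ satisfy $m_t\le(1-t)m_0+tm_1$ and $\bar m_t\le(1-t)\bar m_0+t\bar m_1$ for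 $0\le t\le1$. $c$-convexity. Functions $\phi:M\to\mathbb R$, $\bar\phi:\bar M\to\mathbb R$ are $c$-convex and dual to each other if $\phi(x)=\sup_{\bar x\in\bar M}\{-c(x,\bar x)-\bar\phi(\bar x)\}$ and $\bar\phi(\bar x)=\sup_{x\in M}\{-c(x,\bar x)-\phi(x)\}$; $\phi$ is $c$-convex if such $\bar\phi$ exists. $\partial^c\phi(x)=\{\bar x\in\bar M:\phi(y)-\phi(x)\ge-c(y,\bar x)+c(x,\bar x)\ \forall y\in M\}$, and $\partial^c\phi(\Omega)=\bigcup_{x\in\Omega}\partial^c\phi(x)$. *)

theory Defs
  imports "HOL-Analysis.Analysis"
begin

section \<open>Smooth maps between open subsets of normed spaces\<close>

text \<open>\<open>C\<^sup>k\<close> via iterated directional derivatives; for finite-dimensional domains and open \<open>S\<close>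
  this is the usual notion.\<close>

primrec Ck_on :: "nat \<Rightarrow> 'e::real_normed_vector set \<Rightarrow> ('e \<Rightarrow> 'f::real_normed_vector) \<Rightarrow> bool" where
  "Ck_on 0 S f \<longleftrightarrow> continuous_on S f"
| "Ck_on (Suc k) S f \<longleftrightarrow> (\<forall>x\<in>S. f differentiable (at x)) \<and>
     (\<forall>v. Ck_on k S (\<lambda>x. frechet_derivative f (at x) v))"

definition smooth_on :: "'e::real_normed_vector set \<Rightarrow> ('e \<Rightarrow> 'f::real_normed_vector) \<Rightarrow> bool" where
  "smooth_on S f \<longleftrightarrow> (\<forall>k. Ck_on k S f)"


section \<open>Smooth manifolds\<close>

text \<open>A manifold is a whole type carrying a smooth atlas, which need not be maximal.
  A chart \<open>(U, \<kappa>)\<close> is relevant on \<open>U\<close> only.\<close>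

type_synonym ('a, 'e) chart = "'a set \<times> ('a \<Rightarrow> 'e)"

definition chart_inv :: "('a, 'e) chart \<Rightarrow> 'e \<Rightarrow> 'a" where
  "chart_inv k = inv_into (fst k) (snd k)"

definition smooth_atlas ::
    "('a::topological_space, 'e::euclidean_space) chart set \<Rightarrow> bool" where
  "smooth_atlas A \<longleftrightarrow>
     (\<forall>k\<in>A. open (fst k) \<and> open (snd k ` fst k) \<and>
        homeomorphism (fst k) (snd k ` fst k) (snd k) (chart_inv k)) \<and>
     (\<Union>k\<in>A. fst k) = UNIV \<and>
     (\<forall>k\<in>A. \<forall>l\<in>A. smooth_on (snd k ` (fst k \<inter> fst l)) (snd l \<circ> chart_inv k))"

definition euclidean_atlas :: "('e, 'e) chart set" where
  "euclidean_atlas = {(UNIV, id)}"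

definition prod_atlas :: "('a, 'e) chart set \<Rightarrow> ('b, 'f) chart set \<Rightarrow> ('a \<times> 'b, 'e \<times> 'f) chart set" where
  "prod_atlas A B = {(fst k \<times> fst l, map_prod (snd k) (snd l)) | k l. k \<in> A \<and> l \<in> B}"

text \<open>Smoothness of a map on an open set \<open>S\<close>.\<close>

definition smooth_map :: "('a::topological_space, 'e::euclidean_space) chart set \<Rightarrow>
    ('b::topological_space, 'f::euclidean_space) chart set \<Rightarrow> 'a set \<Rightarrow> ('a \<Rightarrow> 'b) \<Rightarrow> bool" where
  "smooth_map A B S f \<longleftrightarrow> continuous_on S f \<and>
     (\<forall>k\<in>A. \<forall>l\<in>B. smooth_on (snd k ` (S \<inter> fst k \<inter> f -` fst l)) (snd l \<circ> f \<circ> chart_inv k))"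

text \<open>Smoothness on an arbitrary set: local existence of smooth extensions to open sets.\<close>

definition smooth_map_within :: "('a::topological_space, 'e::euclidean_space) chart set \<Rightarrow>
    ('b::topological_space, 'f::euclidean_space) chart set \<Rightarrow> 'a set \<Rightarrow> ('a \<Rightarrow> 'b) \<Rightarrow> bool" where
  "smooth_map_within A B S f \<longleftrightarrow>
     (\<forall>x\<in>S. \<exists>W F. open W \<and> x \<in> W \<and> smooth_map A B W F \<and> (\<forall>y\<in>S \<inter> W. F y = f y))"

text \<open>The tangent space at \<open>x\<close> is the model space \<open>'e\<close>, a vector being given by its coordinates
  in the chart \<open>chart_at A x\<close>, which is chosen once and for all. Covectors are also
  represented in \<open>'e\<close>, the pairing with vectors being \<open>p \<bullet> v\<close>.\<close>

definition chart_at :: "('a, 'e) chart set \<Rightarrow> 'a \<Rightarrow> ('a, 'e) chart" where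
  "chart_at A x = (SOME k. k \<in> A \<and> x \<in> fst k)"

definition tangent_map :: "('a, 'e::euclidean_space) chart set \<Rightarrow>
    ('b, 'f::euclidean_space) chart set \<Rightarrow> ('a \<Rightarrow> 'b) \<Rightarrow> 'a \<Rightarrow> 'e \<Rightarrow> 'f" where
  "tangent_map A B f x =
     frechet_derivative (snd (chart_at B (f x)) \<circ> f \<circ> chart_inv (chart_at A x))
       (at (snd (chart_at A x) x))"

definition differential :: "('a, 'e::euclidean_space) chart set \<Rightarrow> ('a \<Rightarrow> real) \<Rightarrow> 'a \<Rightarrow> 'e" where
  "differential A \<alpha> x = (\<Sum>b\<in>Basis. tangent_map A euclidean_atlas \<alpha> x b *\<^sub>R b)"

definition smooth_embedding :: "('a::topological_space, 'e::euclidean_space) chart set \<Rightarrow>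
    ('b::topological_space, 'f::euclidean_space) chart set \<Rightarrow> 'a set \<Rightarrow> ('a \<Rightarrow> 'b) \<Rightarrow> bool" where
  "smooth_embedding A B S f \<longleftrightarrow> smooth_map A B S f \<and>
     (\<forall>x\<in>S. inj (tangent_map A B f x)) \<and> (\<exists>g. homeomorphism S (f ` S) f g)"

definition semiconcave :: "('a, 'e::euclidean_space) chart set \<Rightarrow> ('a \<Rightarrow> real) \<Rightarrow> bool" where
  "semiconcave A \<alpha> \<longleftrightarrow> (\<forall>k\<in>A. \<forall>x\<in>fst k. \<exists>W f s.
     open W \<and> convex W \<and> snd k x \<in> W \<and> W \<subseteq> snd k ` fst k \<and>
     concave_on W f \<and> smooth_on W s \<and> (\<forall>y\<in>W. \<alpha> (chart_inv k y) = f y + s y))"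


section \<open>Riemannian manifolds\<close>

record ('a, 'n) riem =
  atlas :: "('a, real^'n) chart set"
  gmetric :: "'a \<Rightarrow> real^'n \<Rightarrow> real^'n \<Rightarrow> real"

text \<open>Passage from coordinates in the chart \<open>k\<close> to the preferred ones at \<open>x\<close>, and the
  resulting Gram matrix \<open>(g\<^sub>i\<^sub>j)\<close> of the metric in the chart \<open>k\<close>.\<close>

definition tangent_coord_change ::
    "('a, 'n::finite) riem \<Rightarrow> ('a, real^'n) chart \<Rightarrow> 'a \<Rightarrow> real^'n \<Rightarrow> real^'n" where
  "tangent_coord_change M k x =
     frechet_derivative (snd (chart_at (atlas M) x) \<circ> chart_inv k) (at (snd k x))"

definition gram :: "('a, 'n::finite) riem \<Rightarrow> ('a, real^'n) chart \<Rightarrow> real^'n \<Rightarrow> real^'n^'n" where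
  "gram M k y = (let x = chart_inv k y; T = tangent_coord_change M k x
     in (\<chi> i j. gmetric M x (T (axis i 1)) (T (axis j 1))))"

definition riemannian_manifold ::
    "('a::{t2_space, second_countable_topology}, 'n::finite) riem \<Rightarrow> bool" where
  "riemannian_manifold M \<longleftrightarrow> smooth_atlas (atlas M) \<and>
     (\<forall>x. bilinear (gmetric M x) \<and> (\<forall>u v. gmetric M x u v = gmetric M x v u) \<and>
          (\<forall>v. v \<noteq> 0 \<longrightarrow> gmetric M x v v > 0)) \<and>
     (\<forall>k\<in>atlas M. smooth_on (snd k ` fst k) (gram M k))"

definition christoffel ::
    "('a, 'n::finite) riem \<Rightarrow> ('a, real^'n) chart \<Rightarrow> real^'n \<Rightarrow> 'n \<Rightarrow> 'n \<Rightarrow> 'n \<Rightarrow> real" where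
  "christoffel M k y l i j =
     (let dg = (\<lambda>a b c. frechet_derivative (\<lambda>z. gram M k z $ b $ c) (at y) (axis a 1))
      in (1/2) * (\<Sum>m\<in>UNIV. matrix_inv (gram M k y) $ l $ m * (dg i m j + dg j m i - dg m i j)))"

definition geodesic :: "('a::topological_space, 'n::finite) riem \<Rightarrow> (real \<Rightarrow> 'a) \<Rightarrow> bool" where
  "geodesic M \<gamma> \<longleftrightarrow> continuous_on UNIV \<gamma> \<and>
     (\<forall>k\<in>atlas M. \<forall>t. \<gamma> t \<in> fst k \<longrightarrow>
        (let q = snd k \<circ> \<gamma>; q' = (\<lambda>s. vector_derivative q (at s))
         in q differentiable (at t) \<and>
            (q' has_vector_derivative
               (\<chi> l. - (\<Sum>i\<in>UNIV. \<Sum>j\<in>UNIV. christoffel M k (q t) l i j * (q' t $ i) * (q' t $ j))))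
              (at t)))"

definition geodesic_from ::
    "('a::topological_space, 'n::finite) riem \<Rightarrow> 'a \<Rightarrow> real^'n \<Rightarrow> (real \<Rightarrow> 'a) \<Rightarrow> bool" where
  "geodesic_from M x v \<gamma> \<longleftrightarrow> geodesic M \<gamma> \<and> \<gamma> 0 = x \<and>
     vector_derivative (snd (chart_at (atlas M) x) \<circ> \<gamma>) (at 0) = v"

text \<open>Completeness is geodesic completeness.\<close>

definition complete_riemannian_manifold ::
    "('a::{t2_space, second_countable_topology}, 'n::finite) riem \<Rightarrow> bool" where
  "complete_riemannian_manifold M \<longleftrightarrow> riemannian_manifold M \<and> (\<forall>x v. \<exists>\<gamma>. geodesic_from M x v \<gamma>)"

definition riem_exp :: "('a::topological_space, 'n::finite) riem \<Rightarrow> 'a \<Rightarrow> real^'n \<Rightarrow> 'a" where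
  "riem_exp M x v = (THE y. \<exists>\<gamma>. geodesic_from M x v \<gamma> \<and> y = \<gamma> 1)"

text \<open>The measure on Borel sets with density \<open>sqrt (det (g\<^sub>i\<^sub>j))\<close> in every chart. Volumes are taken
  in its completion, as images of Borel sets under \<open>\<partial>\<^sup>c\<phi>\<close> need not be Borel.\<close>

definition riem_measure :: "('a::topological_space, 'n::finite) riem \<Rightarrow> 'a measure" where
  "riem_measure M = (THE \<mu>. sets \<mu> = sets borel \<and>
     (\<forall>k\<in>atlas M. \<forall>S\<in>sets borel. S \<subseteq> fst k \<longrightarrow>
        emeasure \<mu> S = (\<integral>\<^sup>+y\<in>snd k ` S. ennreal (sqrt (det (gram M k y))) \<partial>lborel)))"

definition vol :: "('a::topological_space, 'n::finite) riem \<Rightarrow> 'a set \<Rightarrow> ennreal" where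
  "vol M S = emeasure (completion (riem_measure M)) S"

definition orthonormal_frame :: "('a, 'n::finite) riem \<Rightarrow> 'a \<Rightarrow> 'n \<Rightarrow> real^'n" where
  "orthonormal_frame M x =
     (SOME e. \<forall>i j. gmetric M x (e i) (e j) = (if i = j then 1 else 0))"

text \<open>The covectors \<open>g(e\<^sub>i, \<cdot>)\<close> form the dual frame, which is orthonormal in the cotangent space.\<close>

definition orthonormal_coframe :: "('a, 'n::finite) riem \<Rightarrow> 'a \<Rightarrow> 'n \<Rightarrow> real^'n" where
  "orthonormal_coframe M x i = (\<chi> k. gmetric M x (orthonormal_frame M x i) (axis k 1))"

definition subdifferential ::
    "('a::topological_space, 'n::finite) riem \<Rightarrow> ('a \<Rightarrow> real) \<Rightarrow> 'a \<Rightarrow> (real^'n) set" where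
  "subdifferential M \<alpha> x = {p. \<forall>\<epsilon>>0. \<exists>\<delta>>0. \<forall>v. sqrt (gmetric M x v v) < \<delta> \<longrightarrow>
     \<alpha> (riem_exp M x v) - \<alpha> x \<ge> p \<bullet> v - \<epsilon> * sqrt (gmetric M x v v)}"


section \<open>Costs\<close>

text \<open>Everything is defined for the first variable of a cost \<open>c\<close> on \<open>M \<times> N\<close>; the notions for the
  second variable result from exchanging \<open>M\<close> and \<open>N\<close> and passing to \<open>cbar c\<close>.\<close>

definition cbar :: "('a \<Rightarrow> 'b \<Rightarrow> real) \<Rightarrow> 'b \<Rightarrow> 'a \<Rightarrow> real" where
  "cbar c = (\<lambda>xb x. c x xb)"

definition c_cut :: "('a::topological_space, 'n::finite) riem \<Rightarrow> ('b::topological_space, 'n) riem \<Rightarrow>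
    ('a \<Rightarrow> 'b \<Rightarrow> real) \<Rightarrow> 'a \<Rightarrow> 'b set" where
  "c_cut M N c x = {xb. \<not> (\<exists>S. open S \<and> (x, xb) \<in> S \<and>
     smooth_map (prod_atlas (atlas M) (atlas N)) euclidean_atlas S (\<lambda>(y, yb). c y yb))}"

text \<open>\<open>neg_D M c x xb\<close> is \<open>-D\<^sub>x c(x, xb)\<close>, and \<open>dual_dom M N c x\<close> is \<open>M\<^sup>*(x)\<close>.\<close>

definition neg_D :: "('a, 'n::finite) riem \<Rightarrow> ('a \<Rightarrow> 'b \<Rightarrow> real) \<Rightarrow> 'a \<Rightarrow> 'b \<Rightarrow> real^'n" where
  "neg_D M c x xb = - differential (atlas M) (\<lambda>y. c y xb) x"

definition dual_dom :: "('a::topological_space, 'n::finite) riem \<Rightarrow>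
    ('b::topological_space, 'n) riem \<Rightarrow> ('a \<Rightarrow> 'b \<Rightarrow> real) \<Rightarrow> 'a \<Rightarrow> (real^'n) set" where
  "dual_dom M N c x = neg_D M c x ` (- c_cut M N c x)"

text \<open>The inverse of \<open>-D\<^sub>x c(x, \<cdot>)\<close>, extended by continuity to the closure of \<open>M\<^sup>*(x)\<close>.\<close>

definition c_Exp :: "('a::topological_space, 'n::finite) riem \<Rightarrow>
    ('b::t2_space, 'n) riem \<Rightarrow> ('a \<Rightarrow> 'b \<Rightarrow> real) \<Rightarrow> 'a \<Rightarrow> real^'n \<Rightarrow> 'b" where
  "c_Exp M N c x p = (let E = inv_into (- c_cut M N c x) (neg_D M c x)
     in if p \<in> dual_dom M N c x then E p else Lim (at p within dual_dom M N c x) E)"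

definition twist_half where
  "twist_half M N c \<longleftrightarrow>
     (\<forall>x. smooth_embedding (atlas N) euclidean_atlas (- c_cut M N c x) (neg_D M c x))"

definition c_exp_half where
  "c_exp_half M N c \<longleftrightarrow> (\<forall>x.
     smooth_map_within euclidean_atlas (atlas N) (closure (dual_dom M N c x)) (c_Exp M N c x) \<and>
     c_Exp M N c x ` closure (dual_dom M N c x) = UNIV \<and>
     (\<forall>p \<in> closure (dual_dom M N c x).
        \<forall>q \<in> subdifferential M (\<lambda>y. - c y (c_Exp M N c x p)) x.
          q \<in> closure (dual_dom M N c x) \<and> c_Exp M N c x q = c_Exp M N c x p))"

definition domain_convexity_half where
  "domain_convexity_half M N c \<longleftrightarrow> (\<forall>x. convex (dual_dom M N c x))"

definition c_segment :: "('a::topological_space, 'n::finite) riem \<Rightarrow>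
    ('b::t2_space, 'n) riem \<Rightarrow> ('a \<Rightarrow> 'b \<Rightarrow> real) \<Rightarrow> 'a \<Rightarrow> (real \<Rightarrow> 'b) \<Rightarrow> bool" where
  "c_segment M N c x \<sigma> \<longleftrightarrow> (\<exists>p0 \<in> closure (dual_dom M N c x). \<exists>p1 \<in> closure (dual_dom M N c x).
     \<forall>t\<in>{0..1}. \<sigma> t = c_Exp M N c x ((1 - t) *\<^sub>R p0 + t *\<^sub>R p1))"

definition convex_DASM_half where
  "convex_DASM_half M N c \<longleftrightarrow> (\<forall>x \<sigma>. c_segment M N c x \<sigma> \<longrightarrow>
     (\<forall>t\<in>{0..1}. \<forall>y. let m = (\<lambda>s. - c y (\<sigma> s) + c x (\<sigma> s)) in m t \<le> (1 - t) * m 0 + t * m 1))"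

definition twist where
  "twist M N c \<longleftrightarrow> twist_half M N c \<and> twist_half N M (cbar c)"

definition c_exp where
  "c_exp M N c \<longleftrightarrow> c_exp_half M N c \<and> c_exp_half N M (cbar c)"

definition domain_convexity where
  "domain_convexity M N c \<longleftrightarrow> domain_convexity_half M N c \<and> domain_convexity_half N M (cbar c)"

definition convex_DASM where
  "convex_DASM M N c \<longleftrightarrow> convex_DASM_half M N c \<and> convex_DASM_half N M (cbar c)"

text \<open>Semiconcavity in each of the two variables, the other one being fixed.\<close>

definition semiconcave_cost where
  "semiconcave_cost M N c \<longleftrightarrow>
     (\<forall>xb. semiconcave (atlas M) (\<lambda>x. c x xb)) \<and> (\<forall>x. semiconcave (atlas N) (\<lambda>xb. c x xb))"


section \<open>c-convex functions\<close>

text \<open>The suprema are taken in the extended reals, so that their finiteness is part of the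
  condition.\<close>

definition c_dual :: "('a \<Rightarrow> 'b \<Rightarrow> real) \<Rightarrow> ('a \<Rightarrow> real) \<Rightarrow> ('b \<Rightarrow> real) \<Rightarrow> bool" where
  "c_dual c \<phi> \<phi>b \<longleftrightarrow>
     (\<forall>x. ereal (\<phi> x) = (SUP xb. ereal (- c x xb - \<phi>b xb))) \<and>
     (\<forall>xb. ereal (\<phi>b xb) = (SUP x. ereal (- c x xb - \<phi> x)))"

definition c_convex :: "('a \<Rightarrow> 'b \<Rightarrow> real) \<Rightarrow> ('a \<Rightarrow> real) \<Rightarrow> bool" where
  "c_convex c \<phi> \<longleftrightarrow> (\<exists>\<phi>b. c_dual c \<phi> \<phi>b)"

definition c_subdiff :: "('a \<Rightarrow> 'b \<Rightarrow> real) \<Rightarrow> ('a \<Rightarrow> real) \<Rightarrow> 'a \<Rightarrow> 'b set" where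
  "c_subdiff c \<phi> x = {xb. \<forall>y. \<phi> y - \<phi> x \<ge> - c y xb + c x xb}"

definition section_set ::
    "('a \<Rightarrow> 'b \<Rightarrow> real) \<Rightarrow> ('a \<Rightarrow> real) \<Rightarrow> 'a \<Rightarrow> 'b \<Rightarrow> real \<Rightarrow> 'a set" where
  "section_set c \<phi> x0 xb0 h = {x. \<phi> x - \<phi> x0 \<le> - c x xb0 + c x0 xb0 + h}"


section \<open>Jacobian determinants\<close>

text \<open>Determinants with respect to orthonormal frames; the choice of frames affects only the sign.\<close>

definition mixed_deriv :: "('a, 'n::finite) riem \<Rightarrow> ('b, 'n) riem \<Rightarrow>
    ('a \<Rightarrow> 'b \<Rightarrow> real) \<Rightarrow> 'a \<Rightarrow> 'b \<Rightarrow> real^'n \<Rightarrow> real^'n \<Rightarrow> real" where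
  "mixed_deriv M N c x xb u v =
     tangent_map (atlas M) euclidean_atlas (\<lambda>y. differential (atlas N) (c y) xb) x u \<bullet> v"

definition det_mixed :: "('a, 'n::finite) riem \<Rightarrow> ('b, 'n) riem \<Rightarrow>
    ('a \<Rightarrow> 'b \<Rightarrow> real) \<Rightarrow> 'a \<Rightarrow> 'b \<Rightarrow> real" where
  "det_mixed M N c x xb =
     det (\<chi> i j. - mixed_deriv M N c x xb (orthonormal_frame M x i) (orthonormal_frame N xb j))"

definition det_d_c_Exp :: "('a::topological_space, 'n::finite) riem \<Rightarrow>
    ('b::t2_space, 'n) riem \<Rightarrow> ('a \<Rightarrow> 'b \<Rightarrow> real) \<Rightarrow> 'a \<Rightarrow> real^'n \<Rightarrow> real" where
  "det_d_c_Exp M N c x p = (let xb = c_Exp M N c x p in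
     det (\<chi> i j. gmetric N xb (orthonormal_frame N xb i)
       (tangent_map euclidean_atlas (atlas N) (c_Exp M N c x) p (orthonormal_coframe M x j))))"

end

theory Submission
  imports Defs
begin

text \<open>
  In the coordinates \<open>q = -D\<^bsub>xb\<^esub> c(x, xb0)\<close> the section \<open>Z\<close> becomes a convex set, because the
  functions \<open>-c(\<cdot>, xb) + c(\<cdot>, xb0)\<close> are convex there by (convex DASM). Let \<open>K\<close> be a compact convex
  subset of its image, \<open>g\<close> a point of \<open>K\<close> representing \<open>x\<^sub>c\<close>, and let \<open>x\<close> be represented by a point
  of the half-sized copy \<open>(g + K) / 2\<close>. If \<open>xb \<in> \<partial>\<^sup>c\<phi>(x)\<close>, the convex function
  \<open>m = -c(\<cdot>, xb) + c(\<cdot>, xb0)\<close> satisfies \<open>m \<le> m(x) + h\<close> on \<open>K\<close>, and \<open>m(x) \<le> m(g) + h\<close> since \<open>x\<close> is a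
  midpoint; hence its gradient at \<open>g\<close> lies in \<open>2h\<close> times the polar body of \<open>K - g\<close>. So up to the null
  set \<open>c-Cut(x\<^sub>c)\<close>, the \<open>c\<close>-subdifferential of the half-sized copy is the image under the single map
  \<open>c-Exp\<^bsub>x\<^sub>c\<^esub>\<close> of a linear image of that polar body. If \<open>g\<close> is the centroid of a simplex of maximal volume
  in \<open>K\<close>, then the product of the volumes of \<open>K\<close> and of the polar body is at most
  \<open>n\<^sup>n (n+1)\<^bsup>n+1\<^esup> / (n!)\<^sup>2 \<le> n\<^sup>n |B\<^sub>1|\<^sup>2\<close>. Exhausting the section by such \<open>K\<close> gives the estimate.
\<close>

section \<open>Change of variables\<close>

text \<open>Gradients at varying points live in varying covector spaces, and polar bodies about
  points close to the boundary of \<open>K\<close> blow up. Shrinking towards \<open>g\<close> moves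
  every comparison to the one point \<open>g\<close>, at the price of a factor \<open>2^n\<close> in
  volume and of \<open>2h\<close> in place of \<open>h\<close>; together these make up
  \<open>4^n\<close>. The square of the volume of the section arises because \<open>K\<close> enters
  twice, once in the product with its polar body and once as the source of the half-sized copy. The
  upper bound of the mixed determinant is likewise used twice, at \<open>xc\<close> to pass from the
  coordinates \<open>q\<close> to covectors and on the half-sized copy to bound its coordinate
  volume; the lower bound is used, squared, to return from \<open>K\<close> to the section. The
  Jacobian of \<open>c-Exp\<close> enters once, since only the map based at \<open>xc\<close>
  occurs, and all metric densities cancel. Working with compact \<open>K\<close> secures a simplex
  of maximal volume and finite volumes throughout the chain of inequalities, although the section
  may be noncompact and a priori of infinite volume.\<close>

text \<open>
  The library proves the change of variables formula only for index types of class \<open>wellorder\<close>,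
  so it is transported from \<open>real^('n ordered_copy)\<close> to \<open>real^'n\<close>.
\<close>

typedef 'a ordered_copy = "UNIV :: 'a set" by auto

lemma bij_Rep_ordered_copy: "bij (Rep_ordered_copy :: 'a ordered_copy \<Rightarrow> 'a)"
  by (rule bij_betw_byWitness[where f' = Abs_ordered_copy])
     (auto simp: Rep_ordered_copy_inverse Abs_ordered_copy_inverse)

lemma bij_Abs_ordered_copy: "bij (Abs_ordered_copy :: 'a \<Rightarrow> 'a ordered_copy)"
  by (rule bij_betw_byWitness[where f' = Rep_ordered_copy])
     (auto simp: Rep_ordered_copy_inverse Abs_ordered_copy_inverse)

instance ordered_copy :: (finite) finite
proof
  have "(UNIV :: 'a ordered_copy set) = Abs_ordered_copy ` UNIV"
    using bij_Abs_ordered_copy by (auto simp: bij_def)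
  then show "finite (UNIV :: 'a ordered_copy set)" by (metis finite finite_imageI)
qed

instantiation ordered_copy :: (finite) linorder
begin

definition less_eq_ordered_copy :: "'a ordered_copy \<Rightarrow> 'a ordered_copy \<Rightarrow> bool" where
  "x \<le> y \<longleftrightarrow> to_nat_on UNIV (Rep_ordered_copy x) \<le> to_nat_on UNIV (Rep_ordered_copy y)"

definition less_ordered_copy :: "'a ordered_copy \<Rightarrow> 'a ordered_copy \<Rightarrow> bool" where
  "x < y \<longleftrightarrow> to_nat_on UNIV (Rep_ordered_copy x) < to_nat_on UNIV (Rep_ordered_copy y)"

instance
proof
  fix x y :: "'a ordered_copy"
  have "inj (to_nat_on (UNIV :: 'a set))" by (simp add: inj_on_to_nat_on countable_finite)
  then show "x \<le> y \<Longrightarrow> y \<le> x \<Longrightarrow> x = y"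
    by (simp add: less_eq_ordered_copy_def Rep_ordered_copy_inject inj_eq)
qed (auto simp: less_eq_ordered_copy_def less_ordered_copy_def)

end

instance ordered_copy :: (finite) wellorder
proof
  fix P :: "'a ordered_copy \<Rightarrow> bool" and a
  assume *: "\<And>x. (\<And>y. y < x \<Longrightarrow> P y) \<Longrightarrow> P x"
  show "P a"
    by (induction "to_nat_on UNIV (Rep_ordered_copy a)" arbitrary: a rule: less_induct)
       (rule *, simp add: less_ordered_copy_def)
qed

section \<open>Relabelling of coordinates: determinants and Lebesgue measure\<close>

definition vec_copy :: "real^'n \<Rightarrow> real^('n ordered_copy)" where
  "vec_copy x = (\<chi> i. x $ Rep_ordered_copy i)"

definition vec_uncopy :: "real^('n ordered_copy) \<Rightarrow> real^'n" where
  "vec_uncopy x = (\<chi> i. x $ Abs_ordered_copy i)"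

lemma vec_uncopy_copy [simp]: "vec_uncopy (vec_copy x) = x"
  by (simp add: vec_uncopy_def vec_copy_def vec_eq_iff Abs_ordered_copy_inverse)

lemma vec_copy_uncopy [simp]: "vec_copy (vec_uncopy x) = x"
  by (simp add: vec_uncopy_def vec_copy_def vec_eq_iff Rep_ordered_copy_inverse)

lemma bounded_linear_vec_copy: "bounded_linear (vec_copy :: real^'n \<Rightarrow> _)"
  by (intro linear_conv_bounded_linear[THEN iffD1] linearI) (simp_all add: vec_copy_def vec_eq_iff)

lemma bounded_linear_vec_uncopy: "bounded_linear (vec_uncopy :: _ \<Rightarrow> real^'n)"
  by (intro linear_conv_bounded_linear[THEN iffD1] linearI) (simp_all add: vec_uncopy_def vec_eq_iff)

lemma measurable_vec_copy [measurable]: "vec_copy \<in> borel_measurable borel"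
  by (intro borel_measurable_continuous_onI linear_continuous_on bounded_linear_vec_copy)

lemma measurable_vec_uncopy [measurable]: "vec_uncopy \<in> borel_measurable borel"
  by (intro borel_measurable_continuous_onI linear_continuous_on bounded_linear_vec_uncopy)

lemma permutes_UNIV_iff: "f permutes UNIV \<longleftrightarrow> bij f"
  by (auto intro: permutes_bij bij_imp_permutes)

text \<open>Conjugation with the index bijection matches the permutations of the two index types; it
  preserves signs and only reorders each product in the permutation expansion.\<close>

lemma det_ordered_copy:
  fixes A :: "real^'n^'n"
  shows "det (\<chi> i j. A $ Rep_ordered_copy i $ Rep_ordered_copy j) = det A"
proof -
  let ?R = "Rep_ordered_copy :: 'n ordered_copy \<Rightarrow> 'n" and ?A = "Abs_ordered_copy :: 'n \<Rightarrow> _"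
  \<comment> \<open>Rewriting \<open>map_permutation\<close> as plain conjugation makes
    \<open>sign_map_permutation\<close> applicable to the reindexed sum.\<close>
  have perm: "map_permutation UNIV ?A p = ?A \<circ> p \<circ> ?R" for p
  proof -
    have "inv ?A = ?R" by (metis Abs_ordered_copy_inverse Rep_ordered_copy_inverse UNIV_I inv_equality)
    moreover have "range ?A = UNIV" using bij_Abs_ordered_copy by (auto simp: bij_def)
    ultimately show ?thesis by (simp add: map_permutation_def restrict_id_def fun_eq_iff)
  qed
  show ?thesis unfolding det_def
  proof (rule sum.reindex_bij_witness[where i = "\<lambda>p. ?A \<circ> p \<circ> ?R" and j = "\<lambda>q. ?R \<circ> q \<circ> ?A"], goal_cases)
    case (5 q)
    then have q: "q permutes UNIV" by simp
    let ?p = "?R \<circ> q \<circ> ?A"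
    have p: "?p permutes UNIV"
      using q bij_Rep_ordered_copy bij_Abs_ordered_copy
      unfolding permutes_UNIV_iff by (intro bij_comp) auto
    have "sign (map_permutation UNIV ?A ?p) = sign ?p"
      using p bij_Abs_ordered_copy by (intro sign_map_permutation) (auto simp: bij_def)
    moreover have "map_permutation UNIV ?A ?p = q"
      by (simp add: perm fun_eq_iff Rep_ordered_copy_inverse)
    moreover have "(\<Prod>i\<in>UNIV. A $ i $ ?p i)
        = (\<Prod>i\<in>UNIV. (\<chi> i j. A $ ?R i $ ?R j) $ i $ q i)"
      by (rule prod.reindex_bij_witness[where i = ?R and j = ?A])
         (auto simp: Rep_ordered_copy_inverse Abs_ordered_copy_inverse)
    ultimately show ?case by simp
  qed (use bij_Rep_ordered_copy bij_Abs_ordered_copy in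
       \<open>auto simp: fun_eq_iff Rep_ordered_copy_inverse Abs_ordered_copy_inverse permutes_UNIV_iff intro!: bij_comp\<close>)
qed

lemma det_matrix_ordered_copy:
  fixes f :: "real^'n \<Rightarrow> real^'n"
  shows "det (matrix (vec_copy \<circ> f \<circ> vec_uncopy)) = det (matrix f)"
proof -
  have "vec_uncopy (axis j 1) = (axis (Rep_ordered_copy j) 1 :: real^'n)" for j
    unfolding vec_uncopy_def axis_def
    by (auto simp: vec_eq_iff Abs_ordered_copy_inverse Rep_ordered_copy_inverse)
  then have "matrix (vec_copy \<circ> f \<circ> vec_uncopy)
      = (\<chi> i j. matrix f $ Rep_ordered_copy i $ Rep_ordered_copy j)"
    by (simp add: matrix_def vec_copy_def)
  then show ?thesis by (simp add: det_ordered_copy)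
qed

lemma prod_Basis_vec: "(\<Prod>b\<in>Basis. (w :: real^'n) \<bullet> b) = (\<Prod>i\<in>UNIV. w $ i)"
proof -
  have "Basis = range (\<lambda>i::'n. axis i (1::real))" by (auto simp: Basis_vec_def)
  moreover have "inj (\<lambda>i::'n. axis i (1::real))" by (simp add: inj_def axis_eq_axis)
  ultimately show ?thesis
    using prod.reindex[of "\<lambda>i::'n. axis i (1::real)" UNIV "\<lambda>b. w \<bullet> b"]
    by (simp add: cart_eq_inner_axis o_def)
qed

text \<open>Lebesgue measure is characterised by the volumes of boxes, and relabelling coordinates
  maps boxes to boxes with permuted side lengths.\<close>

lemma distr_lborel_vec_copy: "distr lborel borel (vec_copy :: real^'n \<Rightarrow> _) = lborel"
proof (rule lborel_eqI[symmetric])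
  fix l u :: "real^('n ordered_copy)"
  assume lu: "\<And>b. b \<in> Basis \<Longrightarrow> l \<bullet> b \<le> u \<bullet> b"
  then have le: "l $ i \<le> u $ i" for i
    by (metis axis_in_Basis_iff cart_eq_inner_axis Basis_real_def singletonI)
  have "vec_copy -` box l u = (box (vec_uncopy l) (vec_uncopy u) :: (real^'n) set)"
  proof -
    have "(\<forall>i. l $ i < x $ Rep_ordered_copy i \<and> x $ Rep_ordered_copy i < u $ i) \<longleftrightarrow>
      (\<forall>i. l $ Abs_ordered_copy i < x $ i \<and> x $ i < u $ Abs_ordered_copy i)" for x :: "real^'n"
      by (metis Abs_ordered_copy_inverse Rep_ordered_copy_inverse UNIV_I)
    then show ?thesis
      by (auto simp: mem_box_cart vec_copy_def vec_uncopy_def set_eq_iff)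
  qed
  then have "emeasure (distr lborel borel vec_copy) (box l u)
      = emeasure lborel (box (vec_uncopy l) (vec_uncopy u :: real^'n))"
    by (simp add: emeasure_distr)
  also have "\<dots> = (\<Prod>b\<in>Basis. (vec_uncopy u - vec_uncopy l :: real^'n) \<bullet> b)"
  proof (rule emeasure_lborel_box)
    fix b :: "real^'n" assume "b \<in> Basis"
    then show "vec_uncopy l \<bullet> b \<le> vec_uncopy u \<bullet> b"
      using le by (auto simp: Basis_vec_def cart_eq_inner_axis[symmetric] vec_uncopy_def)
  qed
  also have "\<dots> = (\<Prod>i\<in>UNIV. (vec_uncopy u - vec_uncopy l :: real^'n) $ i)" by (simp only: prod_Basis_vec)
  also have "\<dots> = (\<Prod>i\<in>UNIV. (u - l) $ i)"
    unfolding ennreal_inj[OF prod_nonneg prod_nonneg]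
    by (intro arg_cong[where f=ennreal] prod.reindex_bij_witness[where j = Abs_ordered_copy and i = Rep_ordered_copy])
       (auto simp: vec_uncopy_def Rep_ordered_copy_inverse Abs_ordered_copy_inverse)
  also have "\<dots> = (\<Prod>b\<in>Basis. (u - l) \<bullet> b)" by (simp only: prod_Basis_vec)
  finally show "emeasure (distr lborel borel (vec_copy :: real^'n \<Rightarrow> _)) (box l u)
      = (\<Prod>b\<in>Basis. (u - l) \<bullet> b)" .
qed simp

text \<open>The formula \<open>has_absolute_integral_change_of_variables\<close> is an equivalence:
  absolute integrability with a given integral on one side holds iff it holds on the other. For
  nonnegative functions this covers infinite integrals too, since failure of integrability then
  means the value infinity on both sides.\<close>

lemma nn_integral_change_of_variables_wellorder:
  fixes f :: "real^'n::{finite,wellorder} \<Rightarrow> real^'n::_" and F G :: "real^'n::_ \<Rightarrow> real"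
  assumes S: "S \<in> sets borel" and fS: "f ` S \<in> sets borel"
    and f': "\<And>x. x \<in> S \<Longrightarrow> (f has_derivative f' x) (at x within S)"
    and inj: "inj_on f S"
    and F: "set_borel_measurable borel S F"
    and G: "set_borel_measurable borel (f ` S) G"
    and G0: "\<And>x. x \<in> S \<Longrightarrow> 0 \<le> G (f x)"
    and FG: "\<And>x. x \<in> S \<Longrightarrow> F x = \<bar>det (matrix (f' x))\<bar> * G (f x)"
  shows "(\<integral>\<^sup>+x\<in>S. ennreal (F x) \<partial>lborel) = (\<integral>\<^sup>+y\<in>f ` S. ennreal (G y) \<partial>lborel)"
proof -
  have F0: "0 \<le> F x" if "x \<in> S" for x using FG G0 that by simp
  \<comment> \<open>Normal form of a nonnegative integral: the gauge integral if the function is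
    absolutely integrable, infinity otherwise. The passage between \<open>lborel\<close> and its
    completion is confined to this fact.\<close>
  have key: "(\<integral>\<^sup>+x\<in>A. ennreal (H x) \<partial>lborel) = (if H absolutely_integrable_on A then ennreal (integral A H) else \<infinity>)"
    if A: "A \<in> sets borel" and H: "set_borel_measurable borel A H" and H0: "\<And>x. x \<in> A \<Longrightarrow> 0 \<le> H x"
    for A and H :: "real^'n::_ \<Rightarrow> real"
  proof -
    let ?H = "\<lambda>x. indicat_real A x *\<^sub>R H x"
    have meas: "?H \<in> borel_measurable borel" using H by (simp add: set_borel_measurable_def)
    have nn: "(\<integral>\<^sup>+x\<in>A. ennreal (H x) \<partial>lborel) = (\<integral>\<^sup>+x. ennreal (?H x) \<partial>lborel)"
      by (intro nn_integral_cong) (auto simp: indicator_def)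
    have ae: "AE x in lborel. 0 \<le> ?H x" using H0 by (auto simp: indicator_def)
    have intg: "integrable lborel ?H \<longleftrightarrow> H absolutely_integrable_on A"
      using integrable_completion[of ?H lborel] meas by (simp add: set_integrable_def)
    show ?thesis
    proof (cases "integrable lborel ?H")
      case True
      then have "H absolutely_integrable_on A" using intg by simp
      then have "integral A H = set_lebesgue_integral lebesgue A H"
        by (simp add: set_lebesgue_integral_eq_integral(2))
      also have "\<dots> = integral\<^sup>L lborel ?H"
        using integral_completion[of ?H lborel] meas by (simp add: set_lebesgue_integral_def)
      finally show ?thesis using nn nn_integral_eq_integral[OF True ae] intg True by simp
    next
      case False
      have "(\<integral>\<^sup>+x. ennreal (?H x) \<partial>lborel) = \<infinity>"
      proof (rule ccontr)
        assume "\<not> ?thesis"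
        then have "(\<integral>\<^sup>+x. ennreal (?H x) \<partial>lborel) < \<infinity>" by (simp add: less_top)
        then have "integrable lborel ?H" using meas ae by (intro integrableI_nonneg) auto
        then show False using False by simp
      qed
      then show ?thesis using nn intg False by simp
    qed
  qed
  have cong: "F absolutely_integrable_on S \<longleftrightarrow> (\<lambda>x. \<bar>det (matrix (f' x))\<bar> * G (f x)) absolutely_integrable_on S"
    unfolding set_integrable_def
    by (intro Bochner_Integration.integrable_cong) (auto simp: indicator_def FG)
  have cong2: "integral S F = integral S (\<lambda>x. \<bar>det (matrix (f' x))\<bar> * G (f x))"
    using FG by (intro integral_cong) simp
  have S': "S \<in> sets lebesgue" using S by simp
  \<comment> \<open>The scalar functions are wrapped into \<open>real^1\<close> because the formula
    is stated for vector-valued integrands. Choosing \<open>b\<close> as either of the two integrals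
    transfers integrability in both directions.\<close>
  have 1: "F absolutely_integrable_on S \<and> integral S F = b
      \<longleftrightarrow> G absolutely_integrable_on f ` S \<and> integral (f ` S) G = b" for b
    using has_absolute_integral_change_of_variables[OF S' f' inj, of "\<lambda>x. vec (G x) :: real^1" "vec b"]
    by (simp add: cong cong2 absolutely_integrable_on_1_iff integral_on_1_eq)
  have G0': "0 \<le> G y" if "y \<in> f ` S" for y using G0 that by auto
  have "(\<integral>\<^sup>+x\<in>S. ennreal (F x) \<partial>lborel) = (if F absolutely_integrable_on S then ennreal (integral S F) else \<infinity>)"
    by (rule key[OF S F F0])
  also have "\<dots> = (if G absolutely_integrable_on f ` S then ennreal (integral (f ` S) G) else \<infinity>)"
    using 1[of "integral S F"] 1[of "integral (f ` S) G"] by auto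
  also have "\<dots> = (\<integral>\<^sup>+y\<in>f ` S. ennreal (G y) \<partial>lborel)"
    by (rule key[OF fS G G0', symmetric])
  finally show ?thesis .
qed

lemma vec_copy_image: "vec_copy ` A = vec_uncopy -` A"
  by (force simp: image_iff)

lemma set_nn_integral_vec_copy:
  fixes H :: "real^'n \<Rightarrow> real"
  assumes A: "A \<in> sets borel" and H: "set_borel_measurable borel A H"
  shows "set_borel_measurable borel (vec_copy ` A) (H \<circ> vec_uncopy)"
    and "(\<integral>\<^sup>+y\<in>vec_copy ` A. ennreal ((H \<circ> vec_uncopy) y) \<partial>lborel) = (\<integral>\<^sup>+x\<in>A. ennreal (H x) \<partial>lborel)"
proof -
  let ?H = "\<lambda>x. indicat_real A x *\<^sub>R H x"
  have H': "?H \<in> borel_measurable borel" using H by (simp add: set_borel_measurable_def)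
  have ind: "indicat_real (vec_copy ` A) y = indicat_real A (vec_uncopy y)" for y
    by (simp add: vec_copy_image indicator_def)
  show 1: "set_borel_measurable borel (vec_copy ` A) (H \<circ> vec_uncopy)"
    unfolding set_borel_measurable_def ind o_def
    using measurable_compose[OF measurable_vec_uncopy H'] by simp
  have "(\<integral>\<^sup>+y\<in>vec_copy ` A. ennreal ((H \<circ> vec_uncopy) y) \<partial>lborel)
      = (\<integral>\<^sup>+y. ennreal (?H (vec_uncopy y)) \<partial>distr lborel borel vec_copy)"
    unfolding distr_lborel_vec_copy by (intro nn_integral_cong) (auto simp: vec_copy_image indicator_def)
  also have "\<dots> = (\<integral>\<^sup>+x. ennreal (?H x) \<partial>lborel)"
    using measurable_compose[OF measurable_vec_uncopy H'] by (subst nn_integral_distr) auto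
  also have "\<dots> = (\<integral>\<^sup>+x\<in>A. ennreal (H x) \<partial>lborel)"
    by (intro nn_integral_cong) (auto simp: indicator_def)
  finally show "(\<integral>\<^sup>+y\<in>vec_copy ` A. ennreal ((H \<circ> vec_uncopy) y) \<partial>lborel) = (\<integral>\<^sup>+x\<in>A. ennreal (H x) \<partial>lborel)" .
qed

lemma nn_integral_change_of_variables:
  fixes f :: "real^'n \<Rightarrow> real^'n" and F G :: "real^'n \<Rightarrow> real"
  assumes S: "S \<in> sets borel" and fS: "f ` S \<in> sets borel"
    and f': "\<And>x. x \<in> S \<Longrightarrow> (f has_derivative f' x) (at x within S)"
    and inj: "inj_on f S"
    and F: "set_borel_measurable borel S F"
    and G: "set_borel_measurable borel (f ` S) G"
    and G0: "\<And>x. x \<in> S \<Longrightarrow> 0 \<le> G (f x)"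
    and FG: "\<And>x. x \<in> S \<Longrightarrow> F x = \<bar>det (matrix (f' x))\<bar> * G (f x)"
  shows "(\<integral>\<^sup>+x\<in>S. ennreal (F x) \<partial>lborel) = (\<integral>\<^sup>+y\<in>f ` S. ennreal (G y) \<partial>lborel)"
proof -
  let ?g = "vec_copy \<circ> f \<circ> vec_uncopy" and ?S = "vec_copy ` S"
  have im: "?g ` ?S = vec_copy ` f ` S" by (auto simp: image_image)
  have meas: "vec_copy ` A \<in> sets borel" if "A \<in> sets borel" for A :: "(real^'n) set"
    using measurable_sets_borel[OF measurable_vec_uncopy that] by (simp add: vec_copy_image)
  have "(\<integral>\<^sup>+x\<in>?S. ennreal ((F \<circ> vec_uncopy) x) \<partial>lborel)
      = (\<integral>\<^sup>+y\<in>?g ` ?S. ennreal ((G \<circ> vec_uncopy) y) \<partial>lborel)"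
  proof (rule nn_integral_change_of_variables_wellorder[where f' = "\<lambda>x. vec_copy \<circ> f' (vec_uncopy x) \<circ> vec_uncopy"])
    show "inj_on ?g ?S"
      using inj by (auto simp: inj_on_def) (metis vec_uncopy_copy)
    fix x assume "x \<in> ?S"
    then have x: "vec_uncopy x \<in> S" by auto
    have im': "vec_uncopy ` ?S = S" by (force simp: image_iff)
    have 1: "(f has_derivative f' (vec_uncopy x)) (at (vec_uncopy x) within vec_uncopy ` ?S)"
      unfolding im' by (rule f'[OF x])
    have 2: "(f \<circ> vec_uncopy has_derivative f' (vec_uncopy x) \<circ> vec_uncopy) (at x within ?S)"
      by (rule diff_chain_within[OF bounded_linear_imp_has_derivative[OF bounded_linear_vec_uncopy] 1])
    have "(vec_copy \<circ> (f \<circ> vec_uncopy) has_derivative vec_copy \<circ> (f' (vec_uncopy x) \<circ> vec_uncopy)) (at x within ?S)"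
      by (rule diff_chain_within[OF 2 bounded_linear_imp_has_derivative[OF bounded_linear_vec_copy]])
    then show "(?g has_derivative vec_copy \<circ> f' (vec_uncopy x) \<circ> vec_uncopy) (at x within ?S)"
      by (simp add: o_assoc)
    show "(F \<circ> vec_uncopy) x = \<bar>det (matrix (vec_copy \<circ> f' (vec_uncopy x) \<circ> vec_uncopy))\<bar> * (G \<circ> vec_uncopy) (?g x)"
      using FG[OF x] by (simp add: det_matrix_ordered_copy)
    show "0 \<le> (G \<circ> vec_uncopy) (?g x)" using G0[OF x] by simp
  qed (use meas S fS set_nn_integral_vec_copy(1)[OF S F] set_nn_integral_vec_copy(1)[OF fS G] im in \<open>auto simp: comp_def\<close>)
  then show ?thesis
    unfolding im set_nn_integral_vec_copy(2)[OF S F] set_nn_integral_vec_copy(2)[OF fS G] .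
qed

lemma emeasure_affine_image:
  fixes B :: "real^'n^'n"
  assumes B: "det B \<noteq> 0" and S: "S \<in> sets borel"
  shows "(\<lambda>x. b + B *v x) ` S \<in> sets borel"
    and "emeasure lborel ((\<lambda>x. b + B *v x) ` S) = ennreal \<bar>det B\<bar> * emeasure lborel S"
proof -
  let ?f = "\<lambda>x. b + B *v x"
  obtain B' where B': "B ** B' = mat 1" "B' ** B = mat 1"
    using B by (metis invertible_def invertible_det_nz)
  have inv: "B' *v (?f x - b) = x" "?f (B' *v (x - b)) = x" for x
    by (simp_all add: B' matrix_vector_mul_assoc)
  have "?f ` S = (\<lambda>x. B' *v (x - b)) -` S"
  proof (intro set_eqI iffI)
    fix x assume "x \<in> ?f ` S"
    then show "x \<in> (\<lambda>x. B' *v (x - b)) -` S" using inv(1) by auto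
  next
    fix x assume "x \<in> (\<lambda>x. B' *v (x - b)) -` S"
    then show "x \<in> ?f ` S" using inv(2)[of x] by (metis imageI vimage_eq)
  qed
  moreover have "(\<lambda>x. B' *v (x - b)) \<in> borel_measurable borel"
    by (intro borel_measurable_continuous_onI bounded_linear.continuous_on[OF matrix_vector_mul_bounded_linear]
        continuous_intros)
  ultimately show BS: "?f ` S \<in> sets borel" using S by (metis measurable_sets_borel)
  have "(\<integral>\<^sup>+x\<in>S. ennreal \<bar>det B\<bar> \<partial>lborel) = (\<integral>\<^sup>+y\<in>?f ` S. ennreal 1 \<partial>lborel)"
  proof (rule nn_integral_change_of_variables[where f' = "\<lambda>_. (*v) B"])
    show "inj_on ?f S" by (metis inj_onI inv(1))
    show "(?f has_derivative (*v) B) (at x within S)" for x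
      by (rule has_derivative_eq_rhs, rule has_derivative_add[OF has_derivative_const
            bounded_linear_imp_has_derivative]) simp_all
  qed (use S BS in \<open>auto simp: set_borel_measurable_def\<close>)
  then show "emeasure lborel (?f ` S) = ennreal \<bar>det B\<bar> * emeasure lborel S"
    using S BS by (simp add: nn_integral_cmult_indicator)
qed

section \<open>Volume of a convex body and of its polar\<close>

text \<open>Induction in steps of two keeps the ball volumes elementary, as they are multiplied by
  \<open>2 pi / (n + 2)\<close>. The left side is multiplied by \<open>r / (n + 2)^2\<close> with
  \<open>r = ((n + 3) / (n + 1))^(n + 3)\<close>, so the step amounts to \<open>r <= 4 pi^2\<close>.
  In dimension one both sides equal 4.\<close>

lemma fact_unit_ball_vol_ineq:
  assumes "n \<ge> 1"
  shows "real (n + 1) ^ (n + 1) / (fact n)\<^sup>2 \<le> (unit_ball_vol (real n))\<^sup>2"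
  using assms
proof (induction n rule: induct_nat_012)
  case (ge2 n)
  show ?case
  proof (cases "n = 0")
    \<comment> \<open>Dimension two is a separate base case: the premise \<open>n \<ge> 1\<close>
      makes the induction hypothesis for 0 vacuous.\<close>
    case True
    have "27 / 4 \<le> (3::real)\<^sup>2" by simp
    also have "\<dots> \<le> pi\<^sup>2" using pi_gt3 by (intro power_mono) auto
    finally show ?thesis using True by (simp add: unit_ball_vol_2 eval_nat_numeral)
  next
    case False
    define r where "r = ((real n + 3) / (real n + 1)) ^ (n + 3)"
    have "r \<le> 36"
    proof -
      \<comment> \<open>From \<open>n = 3\<close> on one has
        \<open>2 (n + 3) / (n + 1) <= 3\<close>, so \<open>r <= exp 3 <= 27\<close>; the two smaller
        values are computed. The target 36 is \<open>4 * 3^2\<close>, slightly below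
        \<open>4 pi^2\<close>.\<close>
      consider "n = 1" | "n = 2" | "n \<ge> 3" using False by linarith
      then show ?thesis
      proof cases
        case 3
        have "(real n + 3) / (real n + 1) = 1 + 2 / (real n + 1)" by (simp add: field_simps)
        also have "\<dots> \<le> exp (2 / (real n + 1))" by (rule exp_ge_add_one_self)
        finally have "r \<le> exp (2 / (real n + 1)) ^ (n + 3)"
          unfolding r_def by (intro power_mono) auto
        also have "\<dots> = exp (real (n + 3) * (2 / (real n + 1)))" by (rule exp_of_nat_mult[symmetric])
        also have "\<dots> \<le> exp (real 3 * 1)" using 3 by (simp add: field_simps)
        also have "\<dots> = exp 1 ^ 3" by (rule exp_of_nat_mult)
        also have "\<dots> \<le> (3::real) ^ 3" using exp_le by (intro power_mono) auto
        finally show ?thesis by simp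
      qed (auto simp: r_def eval_nat_numeral)
    qed
    also have "36 = 4 * (3::real)\<^sup>2" by simp
    also have "\<dots> \<le> 4 * pi\<^sup>2" using pi_gt3 by (intro mult_left_mono power_mono) auto
    finally have r: "r \<le> 4 * pi\<^sup>2" .
    have f: "fact (Suc (Suc n)) = real (n + 2) * real (n + 1) * fact n" by (simp add: algebra_simps)
    define A where "A = real n + 1"
    define B where "B = (real n + 3) ^ (n + 3)"
    have A0: "A \<noteq> 0" by (simp add: A_def)
    have "A ^ (n + 3) = A ^ ((n + 1) + 2)" by (rule arg_cong[of _ _ "\<lambda>k. A ^ k"]) simp
    also have "\<dots> = A ^ (n + 1) * A\<^sup>2" by (rule power_add)
    finally have A2: "A ^ (n + 3) = A ^ (n + 1) * A\<^sup>2" .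
    have r': "r = B / (A ^ (n + 1) * A\<^sup>2)" unfolding r_def B_def power_divide A2[symmetric] by (simp only: A_def)
    have "real (Suc (Suc n) + 1) ^ (Suc (Suc n) + 1) / (fact (Suc (Suc n)))\<^sup>2
        = B / (real (n + 2) * A * fact n)\<^sup>2"
      unfolding f B_def A_def by (simp add: add_ac numeral_3_eq_3)
    also have "\<dots> = A ^ (n + 1) / (fact n)\<^sup>2 * r / (real (n + 2))\<^sup>2"
      using A0 unfolding r' by (simp add: power_mult_distrib del: power_Suc of_nat_add)
    also have "A = real (n + 1)" by (simp add: A_def)
    finally have "real (Suc (Suc n) + 1) ^ (Suc (Suc n) + 1) / (fact (Suc (Suc n)))\<^sup>2
        = real (n + 1) ^ (n + 1) / (fact n)\<^sup>2 * r / (real (n + 2))\<^sup>2" .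
    also have "\<dots> \<le> (unit_ball_vol (real n))\<^sup>2 * (4 * pi\<^sup>2) / (real (n + 2))\<^sup>2"
      using ge2 False r by (intro divide_right_mono mult_mono) (auto simp: r_def)
    also have "\<dots> = (unit_ball_vol (real (Suc (Suc n))))\<^sup>2"
    proof -
      have "Gamma (real n / 2 + 1 + 1) = (real n / 2 + 1) * Gamma (real n / 2 + 1)"
        by (rule Gamma_plus1) (auto simp: nonpos_Ints_def)
      moreover have "real (Suc (Suc n)) / 2 = real n / 2 + 1" by simp
      ultimately have "unit_ball_vol (real (Suc (Suc n)))
          = pi powr (real n / 2) * pi / ((real n / 2 + 1) * Gamma (real n / 2 + 1))"
        unfolding unit_ball_vol_def by (simp only: powr_add) simp
      also have "\<dots> = pi / (real n / 2 + 1) * unit_ball_vol (real n)"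
        unfolding unit_ball_vol_def by simp
      also have "pi / (real n / 2 + 1) = 2 * pi / real (n + 2)"
        by (simp add: divide_simps)
      finally have "unit_ball_vol (real (Suc (Suc n))) = 2 * pi / real (n + 2) * unit_ball_vol (real n)" .
      then show ?thesis by (simp add: power_mult_distrib power_divide)
    qed
    finally show ?thesis .
  qed
qed simp_all

text \<open>The first claim is Cramer's rule, the second the rank-one formula for subtracting one
  vector from all rows. When the \<open>a j\<close> are the edges of a simplex issuing from a base
  vertex, they give its new volume after a vertex is replaced by a point: the first if another
  vertex is replaced, the second if the base vertex is.\<close>

lemma det_rows_minus_combination:
  fixes a :: "'n \<Rightarrow> real^'n" and \<mu> :: "'n \<Rightarrow> real"
  assumes x: "x = (\<Sum>j\<in>UNIV. \<mu> j *\<^sub>R a j)"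
  shows "det (\<chi> i. if i = k then x else a i) = \<mu> k * det (\<chi> i. a i)"
    and "det (\<chi> i. a i - x) = (1 - (\<Sum>j\<in>UNIV. \<mu> j)) * det (\<chi> i. a i)"
proof -
  show cramer: "det (\<chi> i. if i = k then x else a i) = \<mu> k * det (\<chi> i. a i)" for k
    using cramer_lemma_transpose[of k "\<chi> j. \<mu> j" "\<chi> i. a i"]
    by (simp add: row_def x scalar_mult_eq_scaleR cong: if_cong)
  \<comment> \<open>A row equal to \<open>x\<close> absorbs the subtraction of \<open>x\<close> from
    the other rows, which then consists of elementary row operations.\<close>
  have 1: "det (\<chi> i. if i = k then x else if i \<in> F then a i - x else a i) = \<mu> k * det (\<chi> i. a i)"
    if "finite F" "k \<notin> F" for F k
    using that
  proof (induction F)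
    case empty
    show ?case unfolding empty_iff if_False by (rule cramer)
  next
    case (insert j F)
    let ?A = "\<chi> i. if i = k then x else if i \<in> F then a i - x else a i"
    have "det (\<chi> i. if i = j then row j ?A + (-1) *s row k ?A else row i ?A) = det ?A"
      using insert by (intro det_row_operation) auto
    moreover have "(\<chi> i. if i = j then row j ?A + (-1) *s row k ?A else row i ?A)
        = (\<chi> i. if i = k then x else if i \<in> insert j F then a i - x else a i)"
      using insert by (auto simp: vec_eq_iff row_def)
    ultimately show ?case using insert by simp
  qed
  have "det (\<chi> i. if i \<in> F then a i - x else a i) = (1 - (\<Sum>j\<in>F. \<mu> j)) * det (\<chi> i. a i)"
    if "finite F" for F
    using that
  proof (induction F)
    case (insert k F)
    let ?c = "\<lambda>i. if i \<in> F then a i - x else a i"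
    have eq: "(\<chi> i. if i \<in> insert k F then a i - x else a i)
        = (\<chi> i. if i = k then a i + (-1) *s x else ?c i)"
      using insert by (auto simp: vec_eq_iff)
    have "det (\<chi> i. if i \<in> insert k F then a i - x else a i)
        = det (\<chi> i. if i = k then a i else ?c i) - det (\<chi> i. if i = k then x else ?c i)"
      unfolding eq det_row_add det_row_mul by simp
    also have "(\<chi> i. if i = k then a i else ?c i) = (\<chi> i. ?c i)"
      using insert by (auto simp: vec_eq_iff)
    finally show ?case using insert 1[of F k] by (simp add: algebra_simps)
  qed simp
  from this[of UNIV] show "det (\<chi> i. a i - x) = (1 - (\<Sum>j\<in>UNIV. \<mu> j)) * det (\<chi> i. a i)" by simp
qed

section \<open>Simplices in a convex body and its polar body\<close>

definition unit_simplex :: "(real^'n) set" where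
  "unit_simplex = {x. (\<forall>i. 0 \<le> x $ i) \<and> (\<Sum>i\<in>UNIV. x $ i) \<le> 1}"

lemma unit_simplex_borel: "unit_simplex \<in> sets borel"
proof -
  have "closed (unit_simplex :: (real^'n) set)"
    unfolding unit_simplex_def
    by (intro closed_Collect_conj closed_Collect_all closed_Collect_le continuous_intros)
  then show ?thesis by (rule borel_closed)
qed

lemma emeasure_unit_simplex: "emeasure lborel (unit_simplex :: (real^'n) set) = ennreal (1 / fact CARD('n))"
proof -
  have B: "(Basis :: (real^'n) set) = range (\<lambda>i::'n. axis i (1::real))" by (auto simp: Basis_vec_def)
  have "inj (\<lambda>i::'n. axis i (1::real))" by (simp add: inj_def axis_eq_axis)
  then have "(\<Sum>b\<in>Basis. x \<bullet> b) = (\<Sum>i\<in>UNIV. x $ i)" for x :: "real^'n"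
    using sum.reindex[of "\<lambda>i::'n. axis i (1::real)" UNIV "\<lambda>b. x \<bullet> b"]
    by (simp add: B cart_eq_inner_axis o_def)
  moreover have "(\<forall>b\<in>Basis. 0 \<le> x \<bullet> b) \<longleftrightarrow> (\<forall>i. 0 \<le> x $ i)" for x :: "real^'n"
    by (simp add: B cart_eq_inner_axis)
  ultimately have "unit_simplex = convex hull (insert 0 (Basis :: (real^'n) set))"
    unfolding std_simplex unit_simplex_def by simp
  then show ?thesis
    using emeasure_std_simplex[where 'a = "real^'n"]
    by simp
qed


lemma emeasure_le_affine_simplex:
  fixes B :: "real^'n^'n"
  assumes "S \<subseteq> (\<lambda>\<mu>. b + B *v \<mu>) ` unit_simplex" and "det B \<noteq> 0"
  shows "emeasure lborel S \<le> ennreal (\<bar>det B\<bar> / fact CARD('n))"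
proof -
  have "emeasure lborel S \<le> emeasure lborel ((\<lambda>\<mu>. b + B *v \<mu>) ` unit_simplex)"
    using assms emeasure_affine_image(1)[OF assms(2) unit_simplex_borel] by (intro emeasure_mono) auto
  also have "\<dots> = ennreal \<bar>det B\<bar> * ennreal (1 / fact CARD('n))"
    unfolding emeasure_affine_image(2)[OF assms(2) unit_simplex_borel] emeasure_unit_simplex ..
  finally show ?thesis by (simp add: ennreal_mult[symmetric])
qed

lemma compact_matrices_rows_in:
  assumes "compact (K :: (real^'n) set)"
  shows "compact {V :: real^'n^'m. \<forall>i. V $ i \<in> K}"
proof -
  obtain b where b: "\<And>x. x \<in> K \<Longrightarrow> norm x \<le> b"
    using compact_imp_bounded[OF assms] by (auto simp: bounded_iff)
  have "bounded {V :: real^'n^'m. \<forall>i. V $ i \<in> K}"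
  proof (rule boundedI)
    fix V :: "real^'n^'m" assume V: "V \<in> {V. \<forall>i. V $ i \<in> K}"
    have "norm V \<le> (\<Sum>i\<in>UNIV. norm (V $ i))"
      unfolding norm_vec_def by (rule L2_set_le_sum) simp
    also have "\<dots> \<le> (\<Sum>i\<in>(UNIV::'m set). b)" using V b by (intro sum_mono) auto
    finally show "norm V \<le> (\<Sum>i\<in>(UNIV::'m set). b)" .
  qed
  moreover have "closed {V :: real^'n^'m. \<forall>i. V $ i \<in> K}"
    using compact_imp_closed[OF assms] by (intro closed_Collect_all closed_vimage_vec_nth[unfolded vimage_def])
  ultimately show ?thesis by (simp add: compact_eq_bounded_closed)
qed

lemma continuous_on_det [continuous_intros]:
  assumes "continuous_on S A"
  shows "continuous_on S (\<lambda>x. det (A x :: real^'n^'n))"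
  unfolding det_def by (intro continuous_intros assms)

lemma exists_max_simplex:
  assumes K: "compact (K :: (real^'n) set)" "K \<noteq> {}"
  obtains v :: "real^'n" and V :: "'n \<Rightarrow> real^'n" where "v \<in> K" "\<And>i. V i \<in> K"
    "\<And>w W. w \<in> K \<Longrightarrow> (\<And>i. W i \<in> K) \<Longrightarrow>
       \<bar>det (\<chi> i. W i - w)\<bar> \<le> \<bar>det (\<chi> i. V i - v)\<bar>"
proof -
  let ?S = "K \<times> {V :: real^'n^'n. \<forall>i. V $ i \<in> K}"
  let ?f = "\<lambda>z :: (real^'n) \<times> (real^'n^'n). \<bar>det (\<chi> i. snd z $ i - fst z)\<bar>"
  obtain k where "k \<in> K" using K by blast
  then have ne: "?S \<noteq> {}" by (auto intro!: exI[of _ "\<chi> i. k"])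
  have "compact ?S" using K compact_matrices_rows_in by (intro compact_Times)
  moreover have "continuous_on ?S ?f"
    by (intro continuous_on_rabs continuous_on_det continuous_on_vec_lambda continuous_on_diff
          continuous_on_component continuous_on_fst continuous_on_snd continuous_on_id)
  ultimately obtain z where z: "z \<in> ?S" "\<And>y. y \<in> ?S \<Longrightarrow> ?f y \<le> ?f z"
    using continuous_attains_sup[OF _ ne] by blast
  show thesis
  proof (rule that[of "fst z" "\<lambda>i. snd z $ i"])
    fix w and W :: "'n \<Rightarrow> real^'n" assume "w \<in> K" "\<And>i. W i \<in> K"
    then show "\<bar>det (\<chi> i. W i - w)\<bar> \<le> \<bar>det (\<chi> i. snd z $ i - fst z)\<bar>"
      using z(2)[of "(w, \<chi> i. W i)"] by simp
  qed (use z in auto)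
qed

lemma det_scaleR: "det (c *\<^sub>R A :: real^'n^'n) = c ^ CARD('n) * det A"
  using det_rows_mul[of "\<lambda>_. c" "\<lambda>i. A $ i"]
  by (simp add: scalar_mult_eq_scaleR scaleR_vec_def)

text \<open>\<open>v, V i\<close> are the vertices of a simplex of maximal volume in \<open>K\<close>, and \<open>g\<close> is its centroid.
  By maximality \<open>K\<close> lies in the simplex \<open>g - n (S - g)\<close>, while the polar body lies in the polar
  simplex.\<close>

lemma volume_times_polar_volume_le:
  fixes K :: "(real^'n) set"
  assumes K: "compact K" "convex K" "K \<noteq> {}"
  obtains g where "g \<in> K"
    "emeasure lborel K * emeasure lborel {p. \<forall>v\<in>K. p \<bullet> (v - g) \<le> 1}
      \<le> ennreal (real CARD('n) ^ CARD('n) * (measure lborel (ball (0 :: real^'n) 1))\<^sup>2)"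
proof -
  let ?n = "real CARD('n)"
  obtain v :: "real^'n" and V :: "'n \<Rightarrow> real^'n" where v: "v \<in> K" and V: "\<And>i. V i \<in> K" and max: "\<And>w W. w \<in> K \<Longrightarrow> (\<And>i. W i \<in> K) \<Longrightarrow>
       \<bar>det (\<chi> i. W i - w)\<bar> \<le> \<bar>det (\<chi> i. V i - v)\<bar>"
    using exists_max_simplex[OF K(1,3)] by metis
  define a where "a i = V i - v" for i
  define A :: "real^'n^'n" where "A = (\<chi> i. a i)"
  define d where "d = det A"
  have max': "\<bar>det (\<chi> i. W i - w)\<bar> \<le> \<bar>d\<bar>" if "w \<in> K" "\<And>i. W i \<in> K" for w W
    using max[OF that] by (simp add: d_def A_def a_def)
  show thesis
  proof (cases "d = 0")
    \<comment> \<open>If even the largest simplex is flat, \<open>K\<close> contains no ball; being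
      convex it is then null. The product vanishes for any \<open>g\<close>, whatever the polar
      volume, as \<open>0 * \<infinity> = 0\<close> in \<open>ennreal\<close>.\<close>
    case True
    have "interior K = {}"
    proof (rule ccontr)
      assume "interior K \<noteq> {}"
      then obtain c where "c \<in> interior K" by blast
      then obtain e where e: "e > 0" "cball c e \<subseteq> K" by (auto simp: mem_interior_cball)
      have "c + e *\<^sub>R axis i 1 \<in> K" for i
        using e by (auto simp: dist_norm subset_iff norm_axis_1)
      moreover have "c \<in> K" using e by (auto simp: subset_iff)
      ultimately have "\<bar>det (\<chi> i. (c + e *\<^sub>R axis i 1) - c)\<bar> \<le> \<bar>d\<bar>" by (intro max')
      moreover have "(\<chi> i. (c + e *\<^sub>R axis i 1) - c) = e *\<^sub>R (mat 1 :: real^'n^'n)"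
        by (auto simp: vec_eq_iff mat_def axis_def)
      ultimately show False using True e by (simp add: det_scaleR)
    qed
    then have "K \<in> null_sets lebesgue"
      using negligible_convex_interior[OF K(2)] negligible_iff_null_sets by auto
    then have "emeasure lborel K = 0"
      using K(1) by (auto simp: null_sets_completion_iff compact_imp_closed)
    then show thesis using v by (intro that[of v]) auto
  next
    case False
    define g where "g = v + (\<Sum>j\<in>UNIV. (1 / (?n + 1)) *\<^sub>R a j)"
    have g: "g \<in> K"
    proof -
      \<comment> \<open>The type \<open>'n option\<close> has one element for each of the
        \<open>n + 1\<close> vertices, with \<open>None\<close> standing for \<open>v\<close>, so
        weights \<open>1 / (n + 1)\<close> sum to 1.\<close>
      let ?w = "\<lambda>i::'n option. case i of None \<Rightarrow> v | Some i \<Rightarrow> V i"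
      have "(\<Sum>i\<in>UNIV. (1 / (?n + 1)) *\<^sub>R ?w i) \<in> K"
        using K(2) by (rule convex_sum[rotated]) (use v V in \<open>auto split: option.split\<close>)
      also have "(\<Sum>i\<in>UNIV. (1 / (?n + 1)) *\<^sub>R ?w i)
          = (1 / (?n + 1)) *\<^sub>R v + (\<Sum>j\<in>UNIV. (1 / (?n + 1)) *\<^sub>R V j)"
        by (simp add: UNIV_option_conv sum.reindex)
      also have "\<dots> = g"
      proof -
        have "v = (1 / (?n + 1)) *\<^sub>R v + (?n / (?n + 1)) *\<^sub>R v"
        proof -
          have "1 / (?n + 1) + ?n / (?n + 1) = 1" by (simp add: divide_simps)
          then show ?thesis by (metis scaleR_add_left scaleR_one)
        qed
        then show ?thesis
          by (simp add: g_def a_def scaleR_diff_right sum_subtractf sum_constant_scaleR algebra_simps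
              del: sum_constant)
      qed
      finally show ?thesis .
    qed
    let ?\<Delta> = "unit_simplex :: (real^'n) set"
    let ?one = "(\<chi> i. 1) :: real^'n"
    define s where "s = (\<Sum>j\<in>UNIV. (1 / (?n + 1)) *\<^sub>R a j)"
    have gs: "g = v + s" by (simp add: g_def s_def)
    obtain Ai where Ai: "A ** Ai = mat 1" "Ai ** A = mat 1"
      using False by (metis d_def invertible_def invertible_det_nz)
    have that_abs: "\<bar>t\<bar> \<le> 1" if "\<bar>t * d\<bar> \<le> \<bar>d\<bar>" for t
      using that False by (simp add: abs_mult)
    \<comment> \<open>Let \<open>l\<close> be the coordinates of \<open>x - v\<close> in the edge
      basis. Replacing \<open>V k\<close> by \<open>x\<close> gives
      \<open>\<bar>l $ k\<bar> \<le> 1\<close>; replacing \<open>v\<close> by \<open>x\<close>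
      bounds \<open>1 - (\<Sum>j. l $ j)\<close> by 1 in absolute value, so the sum is nonnegative.
      These are exactly the conditions placing \<open>\<mu> = (1 - l) / n\<close> in the unit
      simplex.\<close>
    have "K \<subseteq> (\<lambda>\<mu>. (v + transpose A *v ?one) + ((- ?n) *\<^sub>R transpose A) *v \<mu>) ` ?\<Delta>"
    proof
      fix x assume x: "x \<in> K"
      define l where "l = transpose Ai *v (x - v)"
      have l: "transpose A *v l = x - v"
        unfolding l_def matrix_vector_mul_assoc matrix_transpose_mul[symmetric] Ai by (simp add: transpose_mat)
      have "column j (transpose A) = a j" for j
        unfolding column_transpose row_def A_def by (simp add: vec_eq_iff)
      then have "(\<Sum>j\<in>UNIV. l $ j *s column j (transpose A)) = (\<Sum>j\<in>UNIV. l $ j *\<^sub>R a j)"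
        by (intro sum.cong refl) (simp only: scalar_mult_eq_scaleR)
      moreover have "transpose A *v l = (\<Sum>j\<in>UNIV. l $ j *s column j (transpose A))"
        by (rule matrix_mult_sum)
      ultimately have xv: "x - v = (\<Sum>j\<in>UNIV. l $ j *\<^sub>R a j)" unfolding l by (rule trans[rotated])
      have "\<bar>l $ k * d\<bar> \<le> \<bar>d\<bar>" for k
      proof -
        have "l $ k * d = det (\<chi> i. if i = k then x - v else a i)"
          unfolding d_def A_def by (rule det_rows_minus_combination(1)[OF xv, symmetric])
        also have "(\<chi> i. if i = k then x - v else a i) = (\<chi> i. (if i = k then x else V i) - v)"
          by (simp add: vec_eq_iff a_def)
        finally show ?thesis using max'[of v "\<lambda>i. if i = k then x else V i"] x v V by simp
      qed
      then have "\<bar>l $ k\<bar> \<le> 1" for k by (rule that_abs)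
      then have l1: "l $ k \<le> 1" for k by (simp add: abs_le_iff)
      have "(1 - (\<Sum>j\<in>UNIV. l $ j)) * d = det (\<chi> i. a i - (x - v))"
        unfolding d_def A_def by (rule det_rows_minus_combination(2)[OF xv, symmetric])
      also have "(\<chi> i. a i - (x - v)) = (\<chi> i. V i - x)" by (simp add: vec_eq_iff a_def)
      finally have "\<bar>(1 - (\<Sum>j\<in>UNIV. l $ j)) * d\<bar> \<le> \<bar>d\<bar>" using max'[OF x V] by simp
      then have l2: "0 \<le> (\<Sum>j\<in>UNIV. l $ j)" using that_abs[of "1 - (\<Sum>j\<in>UNIV. l $ j)"] by linarith
      define \<mu> where "\<mu> = (1 / ?n) *\<^sub>R (?one - l)"
      have "\<mu> \<in> ?\<Delta>"
        using l1 l2 by (simp add: unit_simplex_def \<mu>_def sum_divide_distrib[symmetric] sum_subtractf)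
      moreover have "x = (v + transpose A *v ?one) + ((- ?n) *\<^sub>R transpose A) *v \<mu>"
      proof -
        have "((- ?n) *\<^sub>R transpose A) *v \<mu> = transpose A *v ((- ?n) *\<^sub>R \<mu>)"
          by (simp only: scaleR_matrix_vector_assoc[symmetric] matrix_vector_mult_scaleR)
        also have "(- ?n) *\<^sub>R \<mu> = l - ?one" by (simp add: \<mu>_def)
        finally show ?thesis using l by (simp only: matrix_vector_mult_diff_distrib) simp
      qed
      ultimately show "x \<in> (\<lambda>\<mu>. (v + transpose A *v ?one) + ((- ?n) *\<^sub>R transpose A) *v \<mu>) ` ?\<Delta>"
        by blast
    qed
    moreover have det1: "\<bar>det ((- ?n) *\<^sub>R transpose A)\<bar> = ?n ^ CARD('n) * \<bar>d\<bar>"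
      unfolding det_scaleR by (simp add: d_def abs_mult power_abs)
    moreover have "\<bar>det ((- ?n) *\<^sub>R transpose A)\<bar> \<noteq> 0" unfolding det1 using False by simp
    ultimately have 1: "emeasure lborel K \<le> ennreal (?n ^ CARD('n) * \<bar>d\<bar> / fact CARD('n))"
      using emeasure_le_affine_simplex[of K "v + transpose A *v ?one" "(- ?n) *\<^sub>R transpose A"] by (simp only: abs_eq_0 not_False_eq_True)
    let ?P = "{p. \<forall>v\<in>K. p \<bullet> (v - g) \<le> 1}"
    \<comment> \<open>The rows of \<open>B\<close> are the vectors \<open>V i - g\<close>. Since
      \<open>s\<close> has all coefficients \<open>1 / (n + 1)\<close> in the edges, subtracting it
      from every row scales the determinant by \<open>1 - n / (n + 1)\<close>.\<close>
    define B :: "real^'n^'n" where "B = (\<chi> i. a i - s)"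
    have "det B = (1 - (\<Sum>j\<in>(UNIV::'n set). 1 / (?n + 1))) * d"
      unfolding B_def d_def A_def by (rule det_rows_minus_combination(2)) (simp add: s_def)
    also have "1 - (\<Sum>j\<in>(UNIV::'n set). 1 / (?n + 1)) = 1 / (?n + 1)" by (simp add: divide_simps)
    finally have detB: "det B = d / (?n + 1)" by simp
    then have "det B \<noteq> 0" using False by simp
    then obtain Bi where Bi: "B ** Bi = mat 1" "Bi ** B = mat 1"
      by (metis invertible_def invertible_det_nz)
    then have "det B * det Bi = 1" by (metis det_I det_mul)
    then have "det Bi = (?n + 1) / d" using False unfolding detB by (simp add: field_simps)
    then have detBi: "\<bar>det Bi\<bar> = (?n + 1) / \<bar>d\<bar>" by simp
    \<comment> \<open>The polar conditions at the vertices suffice. Those at \<open>V i\<close>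
      bound the entries of \<open>B *v p\<close> from above; the vectors from the centroid to all
      vertices sum to zero, so the condition at \<open>v\<close> bounds the sum of the entries from
      below.\<close>
    have "?P \<subseteq> (\<lambda>\<mu>. Bi *v ?one + ((- (?n + 1)) *\<^sub>R Bi) *v \<mu>) ` ?\<Delta>"
    proof
      fix p assume p: "p \<in> ?P"
      have "(B *v p) $ i = p \<bullet> (V i - g)" for i
        unfolding B_def gs a_def matrix_vector_mul_component by (simp add: inner_commute algebra_simps)
      then have 1: "(B *v p) $ i \<le> 1" for i using p V by simp
      have "(\<Sum>i\<in>UNIV. (B *v p) $ i) = p \<bullet> (\<Sum>i\<in>UNIV. a i - s)"
        by (simp add: B_def matrix_vector_mul_component inner_sum_right inner_commute)
      also have "(\<Sum>i\<in>UNIV. a i - s) = - (v - g)"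
      proof -
        have "(\<Sum>i\<in>UNIV. a i) = (?n + 1) *\<^sub>R s" by (simp add: s_def scaleR_sum_right add_pos_nonneg)
        then show ?thesis by (simp add: sum_subtractf gs sum_constant_scaleR algebra_simps del: sum_constant)
      qed
      finally have "(\<Sum>i\<in>UNIV. (B *v p) $ i) = - (p \<bullet> (v - g))" by (simp only: inner_minus_right)
      moreover have "p \<bullet> (v - g) \<le> 1" using p v by blast
      ultimately have 2: "- 1 \<le> (\<Sum>i\<in>UNIV. (B *v p) $ i)" by linarith
      define \<mu> where "\<mu> = (1 / (?n + 1)) *\<^sub>R (?one - B *v p)"
      have "\<mu> \<in> ?\<Delta>"
        using 1 2 by (simp add: unit_simplex_def \<mu>_def sum_divide_distrib[symmetric] sum_subtractf)
      moreover have "p = Bi *v ?one + ((- (?n + 1)) *\<^sub>R Bi) *v \<mu>"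
      proof -
        have "((- (?n + 1)) *\<^sub>R Bi) *v \<mu> = Bi *v ((- (?n + 1)) *\<^sub>R \<mu>)"
          by (simp only: scaleR_matrix_vector_assoc[symmetric] matrix_vector_mult_scaleR)
        also have "(- (?n + 1)) *\<^sub>R \<mu> = ((- (?n + 1)) * (1 / (?n + 1))) *\<^sub>R (?one - B *v p)"
          by (simp only: \<mu>_def scaleR_scaleR)
        also have "(- (?n + 1)) * (1 / (?n + 1)) = - 1" by (simp add: divide_simps)
        also have "- 1 *\<^sub>R (?one - B *v p) = B *v p - ?one" by simp
        also have "Bi *v (B *v p - ?one) = p - Bi *v ?one"
          by (simp add: matrix_vector_mult_diff_distrib matrix_vector_mul_assoc Bi)
        finally show ?thesis by simp
      qed
      ultimately show "p \<in> (\<lambda>\<mu>. Bi *v ?one + ((- (?n + 1)) *\<^sub>R Bi) *v \<mu>) ` ?\<Delta>" by blast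
    qed
    moreover have det2: "\<bar>det ((- (?n + 1)) *\<^sub>R Bi)\<bar> = (?n + 1) ^ CARD('n) * ((?n + 1) / \<bar>d\<bar>)"
    proof -
      have "\<bar>- (?n + 1)\<bar> = ?n + 1" by simp
      then show ?thesis unfolding det_scaleR abs_mult detBi power_abs by (simp only:)
    qed
    moreover have "\<bar>det ((- (?n + 1)) *\<^sub>R Bi)\<bar> \<noteq> 0" unfolding det2 using False by simp
    ultimately have 2: "emeasure lborel ?P \<le> ennreal ((?n + 1) ^ CARD('n) * ((?n + 1) / \<bar>d\<bar>) / fact CARD('n))"
      using emeasure_le_affine_simplex[of ?P "Bi *v ?one" "(- (?n + 1)) *\<^sub>R Bi"] by (simp only: abs_eq_0 not_False_eq_True)
    have "emeasure lborel K * emeasure lborel ?P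
        \<le> ennreal (?n ^ CARD('n) * \<bar>d\<bar> / fact CARD('n)) * ennreal ((?n + 1) ^ CARD('n) * ((?n + 1) / \<bar>d\<bar>) / fact CARD('n))"
      by (intro mult_mono 1 2) auto
    \<comment> \<open>The size of \<open>K\<close> disappears here: one bound is proportional to
      \<open>\<bar>d\<bar>\<close>, the other to its reciprocal. The remaining quotient is the one
      in \<open>fact_unit_ball_vol_ineq\<close>.\<close>
    also have "\<dots> = ennreal (?n ^ CARD('n) * (real (CARD('n) + 1) ^ (CARD('n) + 1) / (fact CARD('n))\<^sup>2))"
    proof -
      have "real (CARD('n) + 1) = ?n + 1" by simp
      then have "real (CARD('n) + 1) ^ (CARD('n) + 1) = (?n + 1) ^ CARD('n) * (?n + 1)" by (simp only: power_add power_one_right)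
      then show ?thesis using False by (subst ennreal_mult[symmetric]) (simp_all add: power2_eq_square)
    qed
    also have "\<dots> \<le> ennreal (?n ^ CARD('n) * (measure lborel (ball (0 :: real^'n) 1))\<^sup>2)"
      using fact_unit_ball_vol_ineq[of "CARD('n)"]
      by (intro ennreal_leI mult_left_mono) (auto simp: content_ball Suc_le_eq)
    finally show thesis using g by (intro that[of g]) auto
  qed
qed

section \<open>Charts\<close>

lemma smooth_on_imp_differentiable:
  assumes "smooth_on S f" "x \<in> S"
  shows "f differentiable (at x)"
  using assms(1)[unfolded smooth_on_def, rule_format, of "Suc 0"] assms(2) by simp

lemma smooth_on_imp_has_derivative:
  assumes "smooth_on S f" "x \<in> S"
  shows "(f has_derivative frechet_derivative f (at x)) (at x)"
  using smooth_on_imp_differentiable[OF assms] frechet_derivative_works by blast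

lemma smooth_on_imp_continuous_on: "smooth_on S f \<Longrightarrow> continuous_on S f"
  by (metis Ck_on.simps(1) smooth_on_def)

lemma smooth_on_imp_continuous_on_frechet_derivative:
  assumes "smooth_on S f"
  shows "continuous_on S (\<lambda>x. frechet_derivative f (at x) v)"
  using assms[unfolded smooth_on_def, rule_format, of "Suc 0"] by simp

lemma homeomorphism_image_eq_vimage:
  assumes h: "homeomorphism U V f g" and S: "S \<subseteq> U"
  shows "f ` S = V \<inter> g -` S"
proof (intro set_eqI iffI)
  fix y assume "y \<in> f ` S"
  then obtain x where x: "x \<in> S" "y = f x" by blast
  then have "x \<in> U" using S by blast
  then show "y \<in> V \<inter> g -` S"
    using x homeomorphism_apply1[OF h, of x] homeomorphism_image1[OF h] by auto
next
  fix y assume "y \<in> V \<inter> g -` S"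
  then show "y \<in> f ` S" using homeomorphism_apply2[OF h, of y] by (metis IntE imageI vimageE)
qed

lemma homeomorphism_image_borel:
  fixes f :: "'a::topological_space \<Rightarrow> 'b::topological_space"
  assumes h: "homeomorphism U V f g" and V: "V \<in> sets borel" and S: "S \<in> sets borel" "S \<subseteq> U"
  shows "f ` S \<in> sets borel"
proof -
  have "g \<in> borel_measurable (restrict_space borel V)"
    using h by (intro borel_measurable_continuous_on_restrict) (simp add: homeomorphism_def)
  then have "g -` S \<inter> space (restrict_space borel V) \<in> sets (restrict_space borel V)"
    using S(1) by (rule measurable_sets)
  also have "g -` S \<inter> space (restrict_space borel V) = f ` S"
    unfolding homeomorphism_image_eq_vimage[OF h S(2)] space_restrict_space by auto
  finally show ?thesis using V by (simp add: sets_restrict_space_iff)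
qed

lemma homeomorphism_open_image:
  assumes h: "homeomorphism U V f g" and V: "open V" and S: "open S" "S \<subseteq> U"
  shows "open (f ` S)"
proof -
  have "open (V \<inter> g -` S)"
    using h V S(1) by (intro continuous_open_preimage) (simp_all add: homeomorphism_def)
  moreover have "V \<inter> g -` S = f ` S"
    unfolding homeomorphism_image_eq_vimage[OF h S(2)] ..
  ultimately show ?thesis by simp
qed

text \<open>The Jacobian of a transition map, indexed by the point of the manifold instead of its
  coordinates, so that compositions over three charts refer to one point. With \<open>l\<close> the
  preferred chart at \<open>x\<close> it is \<open>tangent_coord_change\<close>.\<close>

definition chart_trans :: "('a, 'e::euclidean_space) chart \<Rightarrow> ('a, 'e) chart \<Rightarrow> 'a \<Rightarrow> 'e \<Rightarrow> 'e" where
  "chart_trans k l x = frechet_derivative (snd l \<circ> chart_inv k) (at (snd k x))"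

context
  fixes A :: "('a::topological_space, 'e::euclidean_space) chart set"
  assumes A: "smooth_atlas A"
begin

lemma open_chart_domain: "k \<in> A \<Longrightarrow> open (fst k)"
  and open_chart_range: "k \<in> A \<Longrightarrow> open (snd k ` fst k)"
  and homeomorphism_chart: "k \<in> A \<Longrightarrow> homeomorphism (fst k) (snd k ` fst k) (snd k) (chart_inv k)"
  using A by (auto simp: smooth_atlas_def)

lemma chart_inv_chart: "k \<in> A \<Longrightarrow> x \<in> fst k \<Longrightarrow> chart_inv k (snd k x) = x"
  using homeomorphism_chart by (auto simp: homeomorphism_def)

lemma chart_at: "chart_at A x \<in> A" "x \<in> fst (chart_at A x)"
proof -
  have "x \<in> (\<Union>k\<in>A. fst k)" using A unfolding smooth_atlas_def by (metis UNIV_I)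
  then have "\<exists>k. k \<in> A \<and> x \<in> fst k" by blast
  then have "chart_at A x \<in> A \<and> x \<in> fst (chart_at A x)" unfolding chart_at_def by (rule someI_ex)
  then show "chart_at A x \<in> A" "x \<in> fst (chart_at A x)" by auto
qed

lemma open_chart_image:
  assumes "k \<in> A" "open U"
  shows "open (snd k ` (U \<inter> fst k))"
  by (rule homeomorphism_open_image[OF homeomorphism_chart[OF assms(1)] open_chart_range[OF assms(1)]
        open_Int[OF assms(2) open_chart_domain[OF assms(1)]]]) simp

lemma chart_image_borel:
  assumes "k \<in> A" "S \<in> sets borel" "S \<subseteq> fst k"
  shows "snd k ` S \<in> sets borel"
  by (rule homeomorphism_image_borel[OF homeomorphism_chart[OF assms(1)] _ assms(2,3)])
     (rule borel_open[OF open_chart_range[OF assms(1)]])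

lemma has_derivative_chart_trans:
  assumes "k \<in> A" "l \<in> A" "x \<in> fst k" "x \<in> fst l"
  shows "((snd l \<circ> chart_inv k) has_derivative chart_trans k l x) (at (snd k x))"
proof -
  have "smooth_on (snd k ` (fst k \<inter> fst l)) (snd l \<circ> chart_inv k)"
    using A assms(1,2) unfolding smooth_atlas_def by blast
  then show ?thesis
    unfolding chart_trans_def using assms(3,4) by (intro smooth_on_imp_has_derivative) auto
qed

text \<open>The chain rule through the transition map. The factorisation holds only over the overlap
  of the charts, whose coordinate image is an open neighbourhood.\<close>

lemma has_derivative_chart_change:
  fixes f :: "'a \<Rightarrow> 'f::real_normed_vector"
  assumes "k \<in> A" "l \<in> A" "x \<in> fst k" "x \<in> fst l"
    and f: "((f \<circ> chart_inv l) has_derivative f') (at (snd l x))"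
  shows "((f \<circ> chart_inv k) has_derivative f' \<circ> chart_trans k l x) (at (snd k x))"
proof -
  have x: "(snd l \<circ> chart_inv k) (snd k x) = snd l x" using assms by (simp add: chart_inv_chart)
  have "((f \<circ> chart_inv l) \<circ> (snd l \<circ> chart_inv k) has_derivative f' \<circ> chart_trans k l x) (at (snd k x))"
    by (rule diff_chain_at[OF has_derivative_chart_trans[OF assms(1-4)]]) (simp only: x f)
  then show ?thesis
  proof (rule has_derivative_transform_within_open)
    show "open (snd k ` (fst l \<inter> fst k))" using assms open_chart_domain by (intro open_chart_image) auto
    show "snd k x \<in> snd k ` (fst l \<inter> fst k)" using assms by auto
    show "((f \<circ> chart_inv l) \<circ> (snd l \<circ> chart_inv k)) y = (f \<circ> chart_inv k) y" if "y \<in> snd k ` (fst l \<inter> fst k)" for y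
      using that assms by (auto simp: chart_inv_chart)
  qed
qed

lemma chart_trans_comp:
  assumes "k \<in> A" "l \<in> A" "m \<in> A" "x \<in> fst k" "x \<in> fst l" "x \<in> fst m"
  shows "chart_trans l m x \<circ> chart_trans k l x = chart_trans k m x"
  using has_derivative_chart_change[OF assms(1,2,4,5) has_derivative_chart_trans[OF assms(2,3,5,6)]]
    has_derivative_chart_trans[OF assms(1,3,4,6)]
  by (rule has_derivative_unique)

lemma chart_trans_self:
  assumes "k \<in> A" "x \<in> fst k"
  shows "chart_trans k k x = id"
proof -
  have "(id has_derivative id) (at (snd k x))" by (rule has_derivative_id)
  then have "((snd k \<circ> chart_inv k) has_derivative id) (at (snd k x))"
  proof (rule has_derivative_transform_within_open[OF _ open_chart_range[OF assms(1)]])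
    show "snd k x \<in> snd k ` fst k" using assms by auto
    show "id y = (snd k \<circ> chart_inv k) y" if "y \<in> snd k ` fst k" for y
      using that assms by (auto simp: chart_inv_chart)
  qed
  then show ?thesis using has_derivative_chart_trans[OF assms(1,1,2,2)] by (metis has_derivative_unique)
qed

lemma linear_chart_trans:
  assumes "k \<in> A" "l \<in> A" "x \<in> fst k" "x \<in> fst l"
  shows "linear (chart_trans k l x)"
  using has_derivative_linear[OF has_derivative_chart_trans[OF assms]] .

end

section \<open>Transition determinants and partitions subordinate to charts\<close>

lemma det_chart_trans_comp:
  fixes A :: "('a::topological_space, real^'n) chart set"
  assumes A: "smooth_atlas A" and k: "k \<in> A" "l \<in> A" "m \<in> A" "x \<in> fst k" "x \<in> fst l" "x \<in> fst m"
  shows "det (matrix (chart_trans k m x)) = det (matrix (chart_trans l m x)) * det (matrix (chart_trans k l x))"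
  using matrix_compose[OF linear_chart_trans[OF A k(1,2,4,5)] linear_chart_trans[OF A k(2,3,5,6)]]
  by (simp add: chart_trans_comp[OF A k] det_mul)

lemma det_chart_trans_nonzero:
  fixes A :: "('a::topological_space, real^'n) chart set"
  assumes A: "smooth_atlas A" and k: "k \<in> A" "l \<in> A" "x \<in> fst k" "x \<in> fst l"
  shows "det (matrix (chart_trans k l x)) \<noteq> 0"
proof -
  have "det (matrix (chart_trans l k x)) * det (matrix (chart_trans k l x)) = 1"
    using det_chart_trans_comp[OF A, of k l k x] k by (simp add: chart_trans_self[OF A])
  then show ?thesis by auto
qed

text \<open>A Lindelof subcover made disjoint. Countability allows measures and integrals to be
  summed over pieces that each lie in a single chart.\<close>

lemma countable_chart_partition:
  fixes A :: "('a::second_countable_topology, 'e::euclidean_space) chart set"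
  assumes A: "smooth_atlas A"
  obtains \<kappa> :: "nat \<Rightarrow> ('a, 'e) chart" and B :: "nat \<Rightarrow> 'a set"
  where "\<And>i. \<kappa> i \<in> A" "\<And>i. B i \<in> sets borel" "\<And>i. B i \<subseteq> fst (\<kappa> i)" "disjoint_family B" "(\<Union>i. B i) = UNIV"
proof -
  obtain \<F> where F: "\<F> \<subseteq> fst ` A" "countable \<F>" "\<Union>\<F> = \<Union>(fst ` A)"
    by (rule Lindelof[of "fst ` A"]) (use open_chart_domain[OF A] in auto)
  then obtain \<C> where C: "\<C> \<subseteq> A" "countable \<C>" "\<F> = fst ` \<C>"
    using countable_subset_image[of \<F> fst A] by blast
  have cov: "(\<Union>k\<in>\<C>. fst k) = UNIV" using F(3) C(3) A by (simp add: smooth_atlas_def)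
  then have ne: "\<C> \<noteq> {}" by auto
  let ?k = "from_nat_into \<C>"
  have k: "?k i \<in> A" for i using from_nat_into[OF ne] C(1) by blast
  have "(\<Union>i. fst (?k i)) = (\<Union>k\<in>range ?k. fst k)" by blast
  then have "(\<Union>i. fst (?k i)) = UNIV" using cov by (simp only: range_from_nat_into[OF ne C(2)])
  then have "(\<Union>i. disjointed (\<lambda>i. fst (?k i)) i) = UNIV" by (simp add: UN_disjointed_eq)
  moreover have "disjointed (\<lambda>i. fst (?k i)) i \<in> sets borel" for i
  proof -
    have "range (\<lambda>i. fst (?k i)) \<subseteq> sets borel" using open_chart_domain[OF A k] by auto
    then show ?thesis by (meson range_subsetD sets.range_disjointed_sets)
  qed
  ultimately show thesis
    using k disjointed_subset[of "\<lambda>i. fst (?k i)"] disjoint_family_disjointed[of "\<lambda>i. fst (?k i)"]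
    by (intro that[of ?k "disjointed (\<lambda>i. fst (?k i))"]) auto
qed

section \<open>The metric in coordinates\<close>

text \<open>The Gram matrix in the preferred chart at \<open>x\<close>. That chart may jump from
  point to point, so this matrix and its density serve pointwise determinant identities, while
  integration uses \<open>gram\<close> in a fixed chart.\<close>

definition metric_matrix :: "('a, 'n::finite) riem \<Rightarrow> 'a \<Rightarrow> real^'n^'n" where
  "metric_matrix M x = (\<chi> i j. gmetric M x (axis i 1) (axis j 1))"

definition metric_density :: "('a, 'n::finite) riem \<Rightarrow> 'a \<Rightarrow> real" where
  "metric_density M x = sqrt (det (metric_matrix M x))"

lemma bilinear_matrix_form:
  fixes g :: "real^'n \<Rightarrow> real^'n \<Rightarrow> real"
  assumes "bilinear g"
  shows "g u v = u \<bullet> ((\<chi> i j. g (axis i 1) (axis j 1)) *v v)"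
proof -
  have exp: "(\<Sum>i\<in>UNIV. (u $ i) *\<^sub>R axis i 1) = u" for u :: "real^'n"
    using basis_expansion[of u] by (simp only: scalar_mult_eq_scaleR)
  have "g u v = g (\<Sum>i\<in>UNIV. (u $ i) *\<^sub>R axis i 1) (\<Sum>j\<in>UNIV. (v $ j) *\<^sub>R axis j 1)"
    by (simp only: exp)
  also have "\<dots> = (\<Sum>i\<in>UNIV. \<Sum>j\<in>UNIV. u $ i * (v $ j * g (axis i 1) (axis j 1)))"
    using assms by (simp add: bilinear_sum sum.cartesian_product bilinear_lmul bilinear_rmul)
  also have "\<dots> = u \<bullet> ((\<chi> i j. g (axis i 1) (axis j 1)) *v v)"
    by (simp add: inner_vec_def matrix_vector_mult_def sum_distrib_left mult_ac)
  finally show ?thesis .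
qed

lemma matrix_of_forms:
  fixes u w :: "'n \<Rightarrow> real^'n" and G :: "real^'n^'n"
  shows "(\<chi> i j. u i \<bullet> (G *v w j)) = transpose (\<chi> a i. u i $ a) ** G ** (\<chi> a i. w i $ a)"
proof -
  have "(transpose (\<chi> a i. u i $ a) ** G ** (\<chi> a i. w i $ a)) $ i $ j = u i \<bullet> (G *v w j)" for i j
    unfolding matrix_mul_assoc[symmetric]
    by (simp add: matrix_matrix_mult_def matrix_vector_mult_def transpose_def inner_vec_def)
  then show ?thesis by (simp add: vec_eq_iff)
qed

text \<open>Gram-Schmidt over subsets of the index type: a vector outside the span exists as long as
  fewer than \<open>n\<close> vectors have been chosen. It gives meaning to the choice in
  \<open>orthonormal_frame\<close>.\<close>

lemma exists_orthonormal_family: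
  fixes g :: "real^'n \<Rightarrow> real^'n \<Rightarrow> real"
  assumes g: "bilinear g" "\<And>u v. g u v = g v u" "\<And>v. v \<noteq> 0 \<Longrightarrow> g v v > 0"
  shows "\<exists>e. \<forall>i j. g (e i) (e j) = (if i = (j::'n) then 1 else 0)"
proof -
  have "\<exists>e. \<forall>i\<in>I. \<forall>j\<in>I. g (e i) (e j) = (if i = j then 1 else 0)" if "finite I" for I :: "'n set"
    using that
  proof (induction I)
    case (insert k I)
    then obtain e where e: "\<And>i j. i \<in> I \<Longrightarrow> j \<in> I \<Longrightarrow> g (e i) (e j) = (if i = j then 1 else 0)" by blast
    have "dim (e ` I) \<le> card I"
      using insert by (intro order.trans[OF dim_le_card'] card_image_le) auto
    also have "\<dots> < card (UNIV :: 'n set)" using insert by (intro psubset_card_mono) auto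
    finally have "span (e ` I) \<noteq> UNIV" by (metis dim_UNIV dim_span DIM_cart DIM_real less_irrefl mult.right_neutral)
    then obtain v where v: "v \<notin> span (e ` I)" by blast
    define w where "w = v - (\<Sum>i\<in>I. g v (e i) *\<^sub>R e i)"
    have "(\<Sum>i\<in>I. g v (e i) *\<^sub>R e i) \<in> span (e ` I)"
      by (intro span_sum span_scale span_base) auto
    then have "w \<noteq> 0" using v by (auto simp: w_def)
    then have w: "g w w > 0" by (rule g(3))
    have we: "g w (e j) = 0" if "j \<in> I" for j
    proof -
      have "linear (\<lambda>u. g u (e j))" using g(1) by (simp add: bilinear_def)
      then have "g w (e j) = g v (e j) - (\<Sum>i\<in>I. g v (e i) * g (e i) (e j))"
        using linear_sum[of "\<lambda>u. g u (e j)" "\<lambda>i. g v (e i) *\<^sub>R e i" I]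
        by (simp add: w_def bilinear_lsub[OF g(1)] bilinear_lmul[OF g(1)])
      also have "(\<Sum>i\<in>I. g v (e i) * g (e i) (e j)) = (\<Sum>i\<in>I. if i = j then g v (e i) else 0)"
        using that by (intro sum.cong) (auto simp: e)
      finally show ?thesis using that insert by simp
    qed
    define e' where "e' = e(k := (1 / sqrt (g w w)) *\<^sub>R w)"
    have "g (e' i) (e' j) = (if i = j then 1 else 0)" if "i \<in> insert k I" "j \<in> insert k I" for i j
      using that insert(2) e we w g(2)
      by (auto simp: e'_def bilinear_lmul[OF g(1)] bilinear_rmul[OF g(1)] field_simps)
    then show ?case by blast
  qed simp
  from this[of UNIV] show ?thesis by simp
qed

context
  fixes M :: "('a::{t2_space, second_countable_topology}, 'n::finite) riem"
  assumes M: "riemannian_manifold M"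
begin

lemma smooth_atlas_riem: "smooth_atlas (atlas M)"
  using M by (simp add: riemannian_manifold_def)

lemma bilinear_gmetric: "bilinear (gmetric M x)"
  using M by (simp add: riemannian_manifold_def)

lemma gmetric_matrix_form: "gmetric M x u v = u \<bullet> (metric_matrix M x *v v)"
  unfolding metric_matrix_def by (rule bilinear_matrix_form[OF bilinear_gmetric])

lemma orthonormal_frame:
  "gmetric M x (orthonormal_frame M x i) (orthonormal_frame M x j) = (if i = j then 1 else 0)"
proof -
  have "\<exists>e. \<forall>i j. gmetric M x (e i) (e j) = (if i = (j::'n) then 1 else 0)"
    using M by (intro exists_orthonormal_family bilinear_gmetric) (auto simp: riemannian_manifold_def)
  then have "\<forall>i j. gmetric M x (orthonormal_frame M x i) (orthonormal_frame M x j) = (if i = j then 1 else 0)"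
    unfolding orthonormal_frame_def by (rule someI_ex)
  then show ?thesis by blast
qed

definition frame_matrix :: "'a \<Rightarrow> real^'n^'n" where
  "frame_matrix x = (\<chi> a i. orthonormal_frame M x i $ a)"

lemma frame_matrix: "transpose (frame_matrix x) ** metric_matrix M x ** frame_matrix x = mat 1"
  unfolding frame_matrix_def matrix_of_forms[symmetric] gmetric_matrix_form[symmetric] orthonormal_frame
  by (simp add: mat_def)

text \<open>With \<open>E\<close> the frame matrix and \<open>G\<close> the metric matrix, taking
  determinants in \<open>frame_matrix\<close> gives \<open>(det E)^2 * det G = 1\<close>, which
  settles both the sign and the size.\<close>

lemma det_metric_matrix_pos: "det (metric_matrix M x) > 0"
  and det_frame_matrix: "\<bar>det (frame_matrix x)\<bar> = 1 / metric_density M x"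
proof -
  have 1: "(det (frame_matrix x))\<^sup>2 * det (metric_matrix M x) = 1"
    using arg_cong[OF frame_matrix, of det x] by (simp add: det_mul power2_eq_square mult_ac)
  then show pos: "det (metric_matrix M x) > 0"
    by (metis linorder_not_less mult_nonneg_nonpos zero_le_power2 zero_less_one not_one_le_zero)
  have "\<bar>det (frame_matrix x)\<bar> * metric_density M x = sqrt ((det (frame_matrix x))\<^sup>2 * det (metric_matrix M x))"
    by (simp add: metric_density_def real_sqrt_mult)
  then have "\<bar>det (frame_matrix x)\<bar> * metric_density M x = 1" using 1 by simp
  then show "\<bar>det (frame_matrix x)\<bar> = 1 / metric_density M x" using pos by (simp add: metric_density_def field_simps)
qed

lemma metric_density_pos: "metric_density M x > 0"
  using det_metric_matrix_pos by (simp add: metric_density_def)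

text \<open>Splits the volume density of a chart into the Jacobian of the passage to preferred
  coordinates and a factor that depends on the point only; comparisons inside one chart cancel the
  former.\<close>

lemma sqrt_det_gram:
  assumes k: "k \<in> atlas M" "x \<in> fst k"
  shows "sqrt (det (gram M k (snd k x)))
    = \<bar>det (matrix (chart_trans k (chart_at (atlas M) x) x))\<bar> * metric_density M x"
proof -
  let ?T = "chart_trans k (chart_at (atlas M) x) x"
  have x: "chart_inv k (snd k x) = x" using chart_inv_chart[OF smooth_atlas_riem] k by blast
  have "gram M k (snd k x) = transpose (matrix ?T) ** metric_matrix M x ** matrix ?T"
    unfolding gram_def Let_def x tangent_coord_change_def chart_trans_def[symmetric] gmetric_matrix_form
      matrix_of_forms by (simp add: matrix_def)
  then show ?thesis by (simp add: det_mul metric_density_def real_sqrt_mult mult_ac flip: power2_eq_square)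
qed

end

section \<open>The Riemannian measure\<close>

lemma set_borel_measurable_gram:
  assumes M: "riemannian_manifold M" and k: "k \<in> atlas M" and S: "S \<in> sets borel" "S \<subseteq> fst k"
  shows "set_borel_measurable borel (snd k ` S) (\<lambda>y. sqrt (det (gram M k y)))"
proof -
  have "continuous_on (snd k ` fst k) (gram M k)"
    using M k by (auto simp: riemannian_manifold_def intro: smooth_on_imp_continuous_on)
  then have "continuous_on (snd k ` S) (\<lambda>y. sqrt (det (gram M k y)))"
    by (intro continuous_intros continuous_on_det) (rule continuous_on_subset, use S in auto)
  then show ?thesis
    unfolding set_borel_measurable_def
    by (intro borel_measurable_continuous_on_indicator chart_image_borel[OF smooth_atlas_riem[OF M] k S])
qed

text \<open>By the cocycle identity \<open>det_chart_trans_comp\<close>, the Jacobian of the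
  transition is the quotient of the two densities, as the change of variables requires.\<close>

lemma chart_volume_cong:
  fixes M :: "('a::{t2_space, second_countable_topology}, 'n::finite) riem"
  assumes M: "riemannian_manifold M" and k: "k \<in> atlas M" "l \<in> atlas M"
    and S: "S \<in> sets borel" "S \<subseteq> fst k" "S \<subseteq> fst l"
  shows "(\<integral>\<^sup>+y\<in>snd k ` S. ennreal (sqrt (det (gram M k y))) \<partial>lborel)
       = (\<integral>\<^sup>+y\<in>snd l ` S. ennreal (sqrt (det (gram M l y))) \<partial>lborel)"
proof -
  note A = smooth_atlas_riem[OF M]
  let ?f = "snd l \<circ> chart_inv k"
  have inv: "chart_inv k (snd k x) = x" "chart_inv l (snd l x) = x" if "x \<in> S" for x
    by (rule chart_inv_chart[OF A k(1) subsetD[OF S(2) that]], rule chart_inv_chart[OF A k(2) subsetD[OF S(3) that]])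
  have im: "?f ` snd k ` S = snd l ` S"
    unfolding image_image o_def by (intro image_cong refl) (simp only: inv)
  have "(\<integral>\<^sup>+y\<in>snd k ` S. ennreal (sqrt (det (gram M k y))) \<partial>lborel)
       = (\<integral>\<^sup>+y\<in>?f ` snd k ` S. ennreal (sqrt (det (gram M l y))) \<partial>lborel)"
  proof (rule nn_integral_change_of_variables[where f' = "\<lambda>y. chart_trans k l (chart_inv k y)"])
    show "snd k ` S \<in> sets borel" "?f ` snd k ` S \<in> sets borel"
      unfolding im by (rule chart_image_borel[OF A k(1) S(1,2)], rule chart_image_borel[OF A k(2) S(1,3)])
    show "set_borel_measurable borel (snd k ` S) (\<lambda>y. sqrt (det (gram M k y)))"
      "set_borel_measurable borel (?f ` snd k ` S) (\<lambda>y. sqrt (det (gram M l y)))"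
      unfolding im by (rule set_borel_measurable_gram[OF M k(1) S(1,2)], rule set_borel_measurable_gram[OF M k(2) S(1,3)])
    show "inj_on ?f (snd k ` S)"
    proof (rule inj_on_inverseI[where g = "snd k \<circ> chart_inv l"])
      fix y assume "y \<in> snd k ` S"
      then obtain x where "x \<in> S" "y = snd k x" by blast
      then show "(snd k \<circ> chart_inv l) (?f y) = y" by (simp only: o_apply inv)
    qed
    fix y assume "y \<in> snd k ` S"
    then obtain x where x: "x \<in> S" "y = snd k x" by blast
    then have xk: "x \<in> fst k" "x \<in> fst l" using S by auto
    have y: "chart_inv k y = x" "?f y = snd l x" using x by (simp_all only: o_apply inv)
    show "(?f has_derivative chart_trans k l (chart_inv k y)) (at y within snd k ` S)"
      unfolding x(2) inv(1)[OF x(1)] by (rule has_derivative_at_withinI[OF has_derivative_chart_trans[OF A k xk]])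
    show "0 \<le> sqrt (det (gram M l (?f y)))"
      unfolding y sqrt_det_gram[OF M k(2) xk(2)] using metric_density_pos[OF M, of x] by simp
    show "sqrt (det (gram M k y)) = \<bar>det (matrix (chart_trans k l (chart_inv k y)))\<bar> * sqrt (det (gram M l (?f y)))"
    proof -
      have "det (matrix (chart_trans k (chart_at (atlas M) x) x))
          = det (matrix (chart_trans l (chart_at (atlas M) x) x)) * det (matrix (chart_trans k l x))"
        by (rule det_chart_trans_comp[OF A k chart_at(1)[OF A] xk chart_at(2)[OF A]])
      then show ?thesis
        unfolding y sqrt_det_gram[OF M k(2) xk(2)] unfolding x(2) sqrt_det_gram[OF M k(1) xk(1)]
        by (simp add: abs_mult)
    qed
  qed
  then show ?thesis by (simp only: im)
qed

lemma nn_integral_image_UN: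
  assumes A: "disjoint_family A" "\<And>n. f ` A n \<in> sets borel" "inj_on f (\<Union>n. A n)"
    and F: "\<And>n. set_borel_measurable borel (f ` A n) F"
  shows "(\<integral>\<^sup>+y\<in>f ` (\<Union>n. A n). ennreal (F y) \<partial>lborel) = (\<Sum>n::nat. \<integral>\<^sup>+y\<in>f ` A n. ennreal (F y) \<partial>lborel)"
proof -
  have disj: "disjoint_family (\<lambda>n. f ` A n)"
    using A(1) inj_on_image_Int[OF A(3)] unfolding disjoint_family_on_def by (metis UN_upper UNIV_I image_empty)
  have eq: "ennreal (F y) * indicator (f ` A n) y = ennreal (indicat_real (f ` A n) y *\<^sub>R F y)" for n y
    by (simp add: indicator_def)
  have "(\<integral>\<^sup>+y\<in>f ` (\<Union>n. A n). ennreal (F y) \<partial>lborel)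
      = (\<integral>\<^sup>+y. (\<Sum>n. ennreal (F y) * indicator (f ` A n) y) \<partial>lborel)"
    unfolding ennreal_suminf_cmult suminf_indicator[OF disj] image_UN ..
  also have "\<dots> = (\<Sum>n. \<integral>\<^sup>+y\<in>f ` A n. ennreal (F y) \<partial>lborel)"
    unfolding eq using F unfolding set_borel_measurable_def by (intro nn_integral_suminf) simp
  finally show ?thesis .
qed

lemma suminf_commute_ennreal: "(\<Sum>i. \<Sum>j. f i j) = (\<Sum>j. \<Sum>i. f i j :: ennreal)"
proof -
  have "(\<Sum>i. \<Sum>j. f i j) = (\<integral>\<^sup>+i. (\<Sum>j. f i j) \<partial>count_space UNIV)" by (simp add: nn_integral_count_space_nat)
  also have "\<dots> = (\<Sum>j. \<integral>\<^sup>+i. f i j \<partial>count_space UNIV)" by (intro nn_integral_suminf) simp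
  finally show ?thesis by (simp add: nn_integral_count_space_nat)
qed

text \<open>\<open>riem_measure\<close> is a definite description, so existence and uniqueness are
  both due. The measure is assembled over a countable partition subordinate to charts;
  \<open>chart_volume_cong\<close> gives it the prescribed value in every chart, and additivity over
  the same partition forces any competitor to agree.\<close>

lemma riem_measure:
  fixes M :: "('a::{t2_space, second_countable_topology}, 'n::finite) riem"
  assumes M: "riemannian_manifold M"
  shows sets_riem_measure: "sets (riem_measure M) = sets borel"
    and emeasure_riem_measure_chart: "k \<in> atlas M \<Longrightarrow> S \<in> sets borel \<Longrightarrow> S \<subseteq> fst k \<Longrightarrow>
        emeasure (riem_measure M) S = (\<integral>\<^sup>+y\<in>snd k ` S. ennreal (sqrt (det (gram M k y))) \<partial>lborel)"
proof -
  note A = smooth_atlas_riem[OF M]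
  let ?I = "\<lambda>k S. \<integral>\<^sup>+y\<in>snd k ` S. ennreal (sqrt (det (gram M k y))) \<partial>lborel"
  define P where "P \<mu> \<longleftrightarrow> sets \<mu> = sets borel \<and>
    (\<forall>k\<in>atlas M. \<forall>S\<in>sets borel. S \<subseteq> fst k \<longrightarrow> emeasure \<mu> S = ?I k S)" for \<mu> :: "'a measure"
  obtain \<kappa> :: "nat \<Rightarrow> ('a, real^'n) chart" and B where kB: "\<And>i. \<kappa> i \<in> atlas M" "\<And>i. B i \<in> sets borel" "\<And>i. B i \<subseteq> fst (\<kappa> i)"
    "disjoint_family B" "(\<Union>i. B i) = UNIV"
    using countable_chart_partition[OF A] by metis
  have inj: "inj_on (snd k) (fst k)" if "k \<in> atlas M" for k
    using chart_inv_chart[OF A that] by (metis inj_on_inverseI)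
  have I_UN: "?I k (\<Union>n. S n) = (\<Sum>n. ?I k (S n))"
    if k: "k \<in> atlas M" and S: "disjoint_family S" "\<And>n. S n \<in> sets borel" "\<And>n. S n \<subseteq> fst k" for k S
    using k S by (intro nn_integral_image_UN set_borel_measurable_gram[OF M] chart_image_borel[OF A]
        inj_on_subset[OF inj[OF k]]) auto
  define m where "m S = (\<Sum>i. ?I (\<kappa> i) (S \<inter> B i))" for S
  define \<mu> where "\<mu> = measure_of UNIV (sets borel) m"
  have sets_\<mu>: "sets \<mu> = sets borel"
    by (simp add: \<mu>_def sets.sigma_sets_eq[of borel, simplified])
  have "countably_additive (sets \<mu>) m"
  proof (rule countably_additiveI)
    fix S :: "nat \<Rightarrow> 'a set"
    assume S: "range S \<subseteq> sets \<mu>" "disjoint_family S" "\<Union>(range S) \<in> sets \<mu>"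
    have "?I (\<kappa> i) (\<Union>(range S) \<inter> B i) = (\<Sum>n. ?I (\<kappa> i) (S n \<inter> B i))" for i
    proof -
      have "?I (\<kappa> i) (\<Union>n. S n \<inter> B i) = (\<Sum>n. ?I (\<kappa> i) (S n \<inter> B i))"
      proof (rule I_UN[OF kB(1)])
        show "disjoint_family (\<lambda>n. S n \<inter> B i)" using S(2) by (auto simp: disjoint_family_on_def)
        show "S n \<inter> B i \<in> sets borel" for n using S(1) kB(2) by (auto simp: sets_\<mu>)
        show "S n \<inter> B i \<subseteq> fst (\<kappa> i)" for n using kB(3) by blast
      qed
      moreover have "(\<Union>n. S n \<inter> B i) = \<Union>(range S) \<inter> B i" by blast
      ultimately show ?thesis by simp
    qed
    then show "(\<Sum>n. m (S n)) = m (\<Union>(range S))"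
      unfolding m_def by (simp only: suminf_commute_ennreal[of "\<lambda>n i. ?I (\<kappa> i) (S n \<inter> B i)"])
  qed
  then have em: "emeasure \<mu> S = m S" if "S \<in> sets borel" for S
    using that unfolding \<mu>_def
    by (intro emeasure_measure_of[OF refl]) (auto simp: positive_def m_def sets_\<mu>[unfolded \<mu>_def] sets_\<mu>)
  have "P \<mu>"
    unfolding P_def
  proof (intro conjI ballI impI)
    fix k S assume k: "k \<in> atlas M" and S: "S \<in> sets borel" "S \<subseteq> fst k"
    have "m S = (\<Sum>i. ?I k (S \<inter> B i))"
      unfolding m_def
    proof (intro arg_cong[where f = suminf] ext chart_volume_cong[OF M kB(1) k])
      show "S \<inter> B i \<in> sets borel" "S \<inter> B i \<subseteq> fst (\<kappa> i)" "S \<inter> B i \<subseteq> fst k" for i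
        using S kB(2)[of i] kB(3)[of i] by auto
    qed
    also have "\<dots> = ?I k (\<Union>i. S \<inter> B i)"
    proof (intro I_UN[symmetric] k)
      show "disjoint_family (\<lambda>i. S \<inter> B i)" using kB(4) unfolding disjoint_family_on_def by blast
      show "S \<inter> B i \<in> sets borel" "S \<inter> B i \<subseteq> fst k" for i
        using S kB(2)[of i] by auto
    qed
    also have "(\<Union>i. S \<inter> B i) = S" using kB(5) by blast
    finally show "emeasure \<mu> S = ?I k S" using em S by simp
  qed (rule sets_\<mu>)
  moreover have "\<nu> = \<mu>" if \<nu>: "P \<nu>" for \<nu>
  proof (rule measure_eqI)
    show "sets \<nu> = sets \<mu>" using \<nu> sets_\<mu> by (simp add: P_def)
    have dec: "emeasure \<rho> S = (\<Sum>i. ?I (\<kappa> i) (S \<inter> B i))" if "P \<rho>" "S \<in> sets borel" for \<rho> S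
    proof -
      have sets: "sets \<rho> = sets borel" using that by (simp add: P_def)
      have "emeasure \<rho> (\<Union>i. S \<inter> B i) = (\<Sum>i. emeasure \<rho> (S \<inter> B i))"
      proof (rule suminf_emeasure[symmetric])
        show "disjoint_family (\<lambda>i. S \<inter> B i)" using kB(4) unfolding disjoint_family_on_def by blast
        show "range (\<lambda>i. S \<inter> B i) \<subseteq> sets \<rho>"
          unfolding sets using kB(2) that(2) by blast
      qed
      also have "\<dots> = (\<Sum>i. ?I (\<kappa> i) (S \<inter> B i))"
      proof (intro arg_cong[where f = suminf] ext)
        show "emeasure \<rho> (S \<inter> B i) = ?I (\<kappa> i) (S \<inter> B i)" for i
          using that(1) kB(1)[of i] kB(2)[of i] kB(3)[of i] that(2) unfolding P_def by blast
      qed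
      also have "(\<Union>i. S \<inter> B i) = S" using kB(5) by blast
      finally show ?thesis .
    qed
    fix S assume "S \<in> sets \<nu>"
    then have "S \<in> sets borel" using \<nu> by (simp add: P_def)
    then show "emeasure \<nu> S = emeasure \<mu> S" using dec[OF \<nu>] dec[OF \<open>P \<mu>\<close>] by simp
  qed
  ultimately have "P (riem_measure M)"
    unfolding riem_measure_def P_def[symmetric] by (metis (no_types, lifting) theI)
  then show "sets (riem_measure M) = sets borel"
    and "k \<in> atlas M \<Longrightarrow> S \<in> sets borel \<Longrightarrow> S \<subseteq> fst k \<Longrightarrow> emeasure (riem_measure M) S = ?I k S"
    by (simp_all add: P_def)
qed

section \<open>Maps from a manifold to Euclidean space\<close>

lemma chart_at_euclidean: "chart_at euclidean_atlas y = (UNIV, id)"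
  unfolding chart_at_def euclidean_atlas_def by (rule some_equality) auto

lemma chart_inv_id: "chart_inv (UNIV, id) = id"
  by (simp add: chart_inv_def)

lemma tangent_map_euclidean:
  "tangent_map A euclidean_atlas f x = frechet_derivative (f \<circ> chart_inv (chart_at A x)) (at (snd (chart_at A x) x))"
  by (simp add: tangent_map_def chart_at_euclidean)

lemma smooth_map_euclideanD:
  assumes "smooth_map A euclidean_atlas U f"
  shows "continuous_on U f" and "k \<in> A \<Longrightarrow> smooth_on (snd k ` (U \<inter> fst k)) (f \<circ> chart_inv k)"
  using assms by (auto simp: smooth_map_def euclidean_atlas_def)

lemma smooth_map_euclidean_has_derivative:
  assumes A: "smooth_atlas A" and f: "smooth_map A euclidean_atlas U f" and x: "x \<in> U"
    and k: "k \<in> A" "x \<in> fst k"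
  shows "((f \<circ> chart_inv k) has_derivative tangent_map A euclidean_atlas f x \<circ> chart_trans k (chart_at A x) x) (at (snd k x))"
proof -
  let ?l = "chart_at A x"
  have "((f \<circ> chart_inv ?l) has_derivative tangent_map A euclidean_atlas f x) (at (snd ?l x))"
    unfolding tangent_map_euclidean
    using x chart_at[OF A] by (intro smooth_on_imp_has_derivative[OF smooth_map_euclideanD(2)[OF f]]) auto
  from has_derivative_chart_change[OF A k(1) chart_at(1)[OF A] k(2) chart_at(2)[OF A] this] show ?thesis .
qed

lemma linear_tangent_map:
  assumes A: "smooth_atlas A" and f: "smooth_map A euclidean_atlas U f" and x: "x \<in> U"
  shows "linear (tangent_map A euclidean_atlas f x)"
proof -
  have "((f \<circ> chart_inv (chart_at A x)) has_derivative
      tangent_map A euclidean_atlas f x \<circ> chart_trans (chart_at A x) (chart_at A x) x) (at (snd (chart_at A x) x))"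
    by (rule smooth_map_euclidean_has_derivative[OF A f x chart_at[OF A]])
  then show ?thesis
    unfolding chart_trans_self[OF A chart_at[OF A]] comp_id by (rule has_derivative_linear)
qed

lemma riem_measure_pieces:
  fixes M :: "('a::{t2_space, second_countable_topology}, 'n::finite) riem"
  assumes M: "riemannian_manifold M"
  obtains \<kappa> :: "nat \<Rightarrow> ('a, real^'n) chart" and B :: "nat \<Rightarrow> 'a set"
  where "\<And>i. \<kappa> i \<in> atlas M" "\<And>i. B i \<in> sets borel" "\<And>i. B i \<subseteq> fst (\<kappa> i)"
    "disjoint_family B" "(\<Union>i. B i) = UNIV"
    "\<And>S. S \<in> sets borel \<Longrightarrow> emeasure (riem_measure M) S
       = (\<Sum>i. \<integral>\<^sup>+y\<in>snd (\<kappa> i) ` (S \<inter> B i). ennreal (sqrt (det (gram M (\<kappa> i) y))) \<partial>lborel)"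
proof -
  obtain \<kappa> :: "nat \<Rightarrow> ('a, real^'n) chart" and B where kB: "\<And>i. \<kappa> i \<in> atlas M" "\<And>i. B i \<in> sets borel" "\<And>i. B i \<subseteq> fst (\<kappa> i)"
    "disjoint_family B" "(\<Union>i. B i) = UNIV"
    using countable_chart_partition[OF smooth_atlas_riem[OF M]] by metis
  have "emeasure (riem_measure M) S
       = (\<Sum>i. \<integral>\<^sup>+y\<in>snd (\<kappa> i) ` (S \<inter> B i). ennreal (sqrt (det (gram M (\<kappa> i) y))) \<partial>lborel)"
    if S: "S \<in> sets borel" for S
  proof -
    have SB: "S \<inter> B i \<in> sets borel" "S \<inter> B i \<subseteq> fst (\<kappa> i)" for i
      using S kB(2)[of i] kB(3)[of i] by auto
    have "emeasure (riem_measure M) (\<Union>i. S \<inter> B i) = (\<Sum>i. emeasure (riem_measure M) (S \<inter> B i))"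
    proof (rule suminf_emeasure[symmetric])
      show "disjoint_family (\<lambda>i. S \<inter> B i)" using kB(4) unfolding disjoint_family_on_def by blast
      show "range (\<lambda>i. S \<inter> B i) \<subseteq> sets (riem_measure M)" unfolding sets_riem_measure[OF M] using SB by blast
    qed
    also have "(\<Union>i. S \<inter> B i) = S" using kB(5) by blast
    finally show ?thesis by (simp only: emeasure_riem_measure_chart[OF M kB(1) SB])
  qed
  then show thesis by (rule that[OF kB])
qed

lemma riem_measure_null:
  fixes M :: "('a::{t2_space, second_countable_topology}, 'n::finite) riem"
  assumes M: "riemannian_manifold M" and S: "S \<in> sets borel"
    and neg: "\<And>k. k \<in> atlas M \<Longrightarrow> negligible (snd k ` (S \<inter> fst k))"
  shows "emeasure (riem_measure M) S = 0"
proof -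
  obtain \<kappa> :: "nat \<Rightarrow> ('a, real^'n) chart" and B where kB: "\<And>i. \<kappa> i \<in> atlas M" "\<And>i. B i \<in> sets borel" "\<And>i. B i \<subseteq> fst (\<kappa> i)"
    "disjoint_family B" "(\<Union>i. B i) = UNIV"
    "\<And>S. S \<in> sets borel \<Longrightarrow> emeasure (riem_measure M) S
       = (\<Sum>i. \<integral>\<^sup>+y\<in>snd (\<kappa> i) ` (S \<inter> B i). ennreal (sqrt (det (gram M (\<kappa> i) y))) \<partial>lborel)"
    by (rule riem_measure_pieces[OF M]) (rule that; assumption)
  have "(\<integral>\<^sup>+y\<in>snd (\<kappa> i) ` (S \<inter> B i). ennreal (sqrt (det (gram M (\<kappa> i) y))) \<partial>lborel) = 0" for i
  proof (rule nn_integral_null_set)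
    have "negligible (snd (\<kappa> i) ` (S \<inter> B i))"
      by (rule negligible_subset[OF neg[OF kB(1)[of i]]]) (use kB(3) in blast)
    moreover have "snd (\<kappa> i) ` (S \<inter> B i) \<in> sets borel"
      using S kB(2)[of i] kB(3)[of i] by (intro chart_image_borel[OF smooth_atlas_riem[OF M] kB(1)]) auto
    ultimately show "snd (\<kappa> i) ` (S \<inter> B i) \<in> null_sets lborel"
      by (simp add: negligible_iff_null_sets null_sets_completion_iff)
  qed
  then show ?thesis by (simp add: kB(6)[OF S])
qed

section \<open>Volumes under embeddings into Euclidean space\<close>

context
  fixes M :: "('a::{t2_space, second_countable_topology}, 'n::finite) riem"
    and U :: "'a set" and f :: "'a \<Rightarrow> real^'n"
  assumes M: "riemannian_manifold M" and U: "open U"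
    and f: "smooth_embedding (atlas M) euclidean_atlas U f"
begin

lemma embedding_smooth: "smooth_map (atlas M) euclidean_atlas U f"
  using f by (simp add: smooth_embedding_def)

lemma embedding_inj_on: "inj_on f U"
  using f by (auto simp: smooth_embedding_def homeomorphism_def intro: inj_on_inverseI)

text \<open>Source and target have equal dimension, so invariance of domain applies in each
  chart.\<close>

lemma embedding_open_image:
  assumes V: "open V" "V \<subseteq> U"
  shows "open (f ` V)"
proof -
  note A = smooth_atlas_riem[OF M]
  have "open ((f \<circ> chart_inv k) ` snd k ` (V \<inter> fst k))" if k: "k \<in> atlas M" for k
  proof (rule invariance_of_domain)
    have "continuous_on (snd k ` (U \<inter> fst k)) (f \<circ> chart_inv k)"
      by (rule smooth_on_imp_continuous_on[OF smooth_map_euclideanD(2)[OF embedding_smooth k]])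
    then show "continuous_on (snd k ` (V \<inter> fst k)) (f \<circ> chart_inv k)"
      by (rule continuous_on_subset) (use V in blast)
    show "open (snd k ` (V \<inter> fst k))" by (rule open_chart_image[OF A k V(1)])
    show "inj_on (f \<circ> chart_inv k) (snd k ` (V \<inter> fst k))"
    proof (rule inj_onI)
      fix y z assume "y \<in> snd k ` (V \<inter> fst k)" "z \<in> snd k ` (V \<inter> fst k)"
        and eq: "(f \<circ> chart_inv k) y = (f \<circ> chart_inv k) z"
      then obtain v w where "v \<in> V \<inter> fst k" "y = snd k v" "w \<in> V \<inter> fst k" "z = snd k w" by blast
      then show "y = z"
        using eq V(2) chart_inv_chart[OF A k, of v] chart_inv_chart[OF A k, of w] inj_onD[OF embedding_inj_on, of v w]
        by auto
    qed
  qed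
  then have "open (\<Union>k\<in>atlas M. (f \<circ> chart_inv k) ` snd k ` (V \<inter> fst k))" by blast
  also have "(\<Union>k\<in>atlas M. (f \<circ> chart_inv k) ` snd k ` (V \<inter> fst k)) = f ` V"
  proof -
    have "(f \<circ> chart_inv k) ` snd k ` (V \<inter> fst k) = f ` (V \<inter> fst k)" if "k \<in> atlas M" for k
      unfolding image_image o_def by (intro image_cong refl) (simp add: chart_inv_chart[OF A that])
    moreover have "(\<Union>k\<in>atlas M. f ` (V \<inter> fst k)) = f ` V"
      using chart_at[OF A] by blast
    ultimately show ?thesis by simp
  qed
  finally show ?thesis .
qed

lemma embedding_image_borel:
  assumes "S \<in> sets borel" "S \<subseteq> U"
  shows "f ` S \<in> sets borel"
proof -
  obtain g where g: "homeomorphism U (f ` U) f g" using f by (auto simp: smooth_embedding_def)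
  show ?thesis
    by (rule homeomorphism_image_borel[OF g borel_open[OF embedding_open_image[OF U order_refl]] assms])
qed

text \<open>The area formula in one chart. The third claim exhibits the same chart-dependent factor
  as \<open>sqrt_det_gram\<close>, so that pointwise bounds in preferred coordinates become bounds
  between integrands.\<close>

lemma emeasure_embedding_chart:
  assumes S: "S \<in> sets borel" "S \<subseteq> U" "S \<subseteq> fst k" and k: "k \<in> atlas M"
  defines "F \<equiv> \<lambda>y. \<bar>det (matrix (frechet_derivative (f \<circ> chart_inv k) (at y)))\<bar>"
  shows "set_borel_measurable borel (snd k ` S) F"
    and "emeasure lborel (f ` S) = (\<integral>\<^sup>+y\<in>snd k ` S. ennreal (F y) \<partial>lborel)"
    and "\<And>x. x \<in> S \<Longrightarrow> F (snd k x) = \<bar>det (matrix (tangent_map (atlas M) euclidean_atlas f x))\<bar>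
            * \<bar>det (matrix (chart_trans k (chart_at (atlas M) x) x))\<bar>"
proof -
  note A = smooth_atlas_riem[OF M]
  have sm: "smooth_on (snd k ` (U \<inter> fst k)) (f \<circ> chart_inv k)"
    by (rule smooth_map_euclideanD(2)[OF embedding_smooth k])
  have kS: "snd k ` S \<in> sets borel" by (rule chart_image_borel[OF A k S(1,3)])
  have sub: "snd k ` S \<subseteq> snd k ` (U \<inter> fst k)" using S by blast
  have "continuous_on (snd k ` (U \<inter> fst k)) F"
    unfolding F_def matrix_def
    by (intro continuous_on_rabs continuous_on_det continuous_on_vec_lambda continuous_on_component
        smooth_on_imp_continuous_on_frechet_derivative[OF sm])
  then show meas: "set_borel_measurable borel (snd k ` S) F"
    unfolding set_borel_measurable_def
    by (intro borel_measurable_continuous_on_indicator kS) (rule continuous_on_subset[OF _ sub])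
  have im: "(f \<circ> chart_inv k) ` snd k ` S = f ` S"
    unfolding image_image o_def
    by (intro image_cong refl) (use S(3) in \<open>simp add: chart_inv_chart[OF A k] subset_iff\<close>)
  have fS: "f ` S \<in> sets borel" by (rule embedding_image_borel[OF S(1,2)])
  have "(\<integral>\<^sup>+y\<in>snd k ` S. ennreal (F y) \<partial>lborel) = (\<integral>\<^sup>+y\<in>(f \<circ> chart_inv k) ` snd k ` S. ennreal 1 \<partial>lborel)"
  proof (rule nn_integral_change_of_variables[where f' = "\<lambda>y. frechet_derivative (f \<circ> chart_inv k) (at y)"])
    show "inj_on (f \<circ> chart_inv k) (snd k ` S)"
    proof (rule inj_onI)
      fix y z assume "y \<in> snd k ` S" "z \<in> snd k ` S"
        and eq: "(f \<circ> chart_inv k) y = (f \<circ> chart_inv k) z"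
      then obtain v w where vw: "v \<in> S" "y = snd k v" "w \<in> S" "z = snd k w" by blast
      then have "v \<in> U" "w \<in> U" "chart_inv k y = v" "chart_inv k z = w"
        using S chart_inv_chart[OF A k] by auto
      then show "y = z"
        using eq vw inj_onD[OF embedding_inj_on, of v w] by simp
    qed
    show "(f \<circ> chart_inv k has_derivative frechet_derivative (f \<circ> chart_inv k) (at y)) (at y within snd k ` S)"
      if "y \<in> snd k ` S" for y
      using sub that by (intro has_derivative_at_withinI[OF smooth_on_imp_has_derivative[OF sm]]) auto
    show "set_borel_measurable borel ((f \<circ> chart_inv k) ` snd k ` S) (\<lambda>x. 1 :: real)"
      unfolding im using fS by (simp add: set_borel_measurable_def)
  qed (simp_all only: im fS kS meas, simp_all add: F_def)
  also have "\<dots> = emeasure lborel (f ` S)" unfolding im using fS by simp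
  finally show "emeasure lborel (f ` S) = (\<integral>\<^sup>+y\<in>snd k ` S. ennreal (F y) \<partial>lborel)" ..
  fix x assume x: "x \<in> S"
  then have xU: "x \<in> U" and xk: "x \<in> fst k" using S by auto
  have "frechet_derivative (f \<circ> chart_inv k) (at (snd k x))
      = tangent_map (atlas M) euclidean_atlas f x \<circ> chart_trans k (chart_at (atlas M) x) x"
    by (rule frechet_derivative_at[OF smooth_map_euclidean_has_derivative[OF A embedding_smooth xU k xk], symmetric])
  then show "F (snd k x) = \<bar>det (matrix (tangent_map (atlas M) euclidean_atlas f x))\<bar>
            * \<bar>det (matrix (chart_trans k (chart_at (atlas M) x) x))\<bar>"
    unfolding F_def
    by (simp add: matrix_compose[OF linear_chart_trans[OF A k chart_at(1)[OF A] xk chart_at(2)[OF A]]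
          linear_tangent_map[OF A embedding_smooth xU]] det_mul abs_mult)
qed

lemma emeasure_embedding_pieces:
  assumes S: "S \<in> sets borel" "S \<subseteq> U" and B: "\<And>i::nat. B i \<in> sets borel" "disjoint_family B" "(\<Union>i. B i) = UNIV"
  shows "emeasure lborel (f ` S) = (\<Sum>i. emeasure lborel (f ` (S \<inter> B i)))"
proof -
  have "(\<Sum>i. emeasure lborel (f ` (S \<inter> B i))) = emeasure lborel (\<Union>i. f ` (S \<inter> B i))"
  proof (rule suminf_emeasure)
    show "range (\<lambda>i. f ` (S \<inter> B i)) \<subseteq> sets lborel"
      using S B(1) by (auto intro!: embedding_image_borel)
    show "disjoint_family (\<lambda>i. f ` (S \<inter> B i))"
      unfolding disjoint_family_on_def
    proof (intro ballI impI)
      fix i j :: nat assume "i \<noteq> j"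
      then have "B i \<inter> B j = {}" using B(2) unfolding disjoint_family_on_def by blast
      then have "f ` (S \<inter> B i \<inter> (S \<inter> B j)) = {}" by blast
      moreover have "f ` (S \<inter> B i \<inter> (S \<inter> B j)) = f ` (S \<inter> B i) \<inter> f ` (S \<inter> B j)"
        by (rule inj_on_image_Int[OF embedding_inj_on]) (use S in blast)+
      ultimately show "f ` (S \<inter> B i) \<inter> f ` (S \<inter> B j) = {}" by simp
    qed
  qed
  also have "(\<Union>i. f ` (S \<inter> B i)) = f ` S" using B(3) by blast
  finally show ?thesis ..
qed

text \<open>Relative to \<open>metric_density\<close> the Jacobian no longer depends on the chart at
  \<open>x\<close>. A single constant therefore compares the integrands on all chart pieces, which
  are then summed.\<close>

lemma emeasure_embedding_le:
  assumes S: "S \<in> sets borel" "S \<subseteq> U" and C: "C \<ge> 0"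
    and le: "\<And>x. x \<in> S \<Longrightarrow> \<bar>det (matrix (tangent_map (atlas M) euclidean_atlas f x))\<bar> \<le> C * metric_density M x"
  shows "emeasure lborel (f ` S) \<le> ennreal C * emeasure (riem_measure M) S"
proof -
  obtain \<kappa> :: "nat \<Rightarrow> ('a, real^'n) chart" and B where kB: "\<And>i. \<kappa> i \<in> atlas M" "\<And>i. B i \<in> sets borel" "\<And>i. B i \<subseteq> fst (\<kappa> i)"
    "disjoint_family B" "(\<Union>i. B i) = UNIV"
    "\<And>S. S \<in> sets borel \<Longrightarrow> emeasure (riem_measure M) S
       = (\<Sum>i. \<integral>\<^sup>+y\<in>snd (\<kappa> i) ` (S \<inter> B i). ennreal (sqrt (det (gram M (\<kappa> i) y))) \<partial>lborel)"
    by (rule riem_measure_pieces[OF M]) (rule that; assumption)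
  have "emeasure lborel (f ` (S \<inter> B i))
      \<le> ennreal C * (\<integral>\<^sup>+y\<in>snd (\<kappa> i) ` (S \<inter> B i). ennreal (sqrt (det (gram M (\<kappa> i) y))) \<partial>lborel)" for i
  proof -
    have SB: "S \<inter> B i \<in> sets borel" "S \<inter> B i \<subseteq> U" "S \<inter> B i \<subseteq> fst (\<kappa> i)"
      using S kB(2)[of i] kB(3)[of i] by auto
    let ?S = "snd (\<kappa> i) ` (S \<inter> B i)"
    let ?F = "\<lambda>y. \<bar>det (matrix (frechet_derivative (f \<circ> chart_inv (\<kappa> i)) (at y)))\<bar>"
    let ?g = "\<lambda>y. sqrt (det (gram M (\<kappa> i) y))"
    have "?F y \<le> C * ?g y" if y: "y \<in> ?S" for y
    proof -
      obtain x where x: "x \<in> S \<inter> B i" "y = snd (\<kappa> i) x" using y by blast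
      then have xk: "x \<in> fst (\<kappa> i)" using SB by blast
      show ?thesis
        unfolding x(2) emeasure_embedding_chart(3)[OF SB kB(1) x(1)] sqrt_det_gram[OF M kB(1) xk]
        using mult_left_mono[OF le[of x], of "\<bar>det (matrix (chart_trans (\<kappa> i) (chart_at (atlas M) x) x))\<bar>"] x(1)
        by (simp add: mult_ac)
    qed
    then have "ennreal (?F y) * indicator ?S y \<le> ennreal C * ennreal (indicat_real ?S y *\<^sub>R ?g y)" for y
      using C by (auto simp: indicator_def ennreal_mult'[symmetric] intro!: ennreal_leI)
    then have "emeasure lborel (f ` (S \<inter> B i)) \<le> (\<integral>\<^sup>+y. ennreal C * ennreal (indicat_real ?S y *\<^sub>R ?g y) \<partial>lborel)"
      unfolding emeasure_embedding_chart(2)[OF SB kB(1)] by (intro nn_integral_mono) simp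
    also have "\<dots> = ennreal C * (\<integral>\<^sup>+y. ennreal (indicat_real ?S y *\<^sub>R ?g y) \<partial>lborel)"
      using set_borel_measurable_gram[OF M kB(1) SB(1,3)]
      by (intro nn_integral_cmult) (simp add: set_borel_measurable_def)
    also have "(\<integral>\<^sup>+y. ennreal (indicat_real ?S y *\<^sub>R ?g y) \<partial>lborel) = (\<integral>\<^sup>+y\<in>?S. ennreal (?g y) \<partial>lborel)"
      by (intro nn_integral_cong) (simp add: indicator_def)
    finally show ?thesis .
  qed
  then have "(\<Sum>i. emeasure lborel (f ` (S \<inter> B i)))
      \<le> (\<Sum>i. ennreal C * (\<integral>\<^sup>+y\<in>snd (\<kappa> i) ` (S \<inter> B i). ennreal (sqrt (det (gram M (\<kappa> i) y))) \<partial>lborel))"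
    by (intro suminf_le) auto
  then show ?thesis
    by (simp only: emeasure_embedding_pieces[OF S kB(2,4,5)] kB(6)[OF S(1)] ennreal_suminf_cmult)
qed

lemma emeasure_embedding_ge:
  assumes S: "S \<in> sets borel" "S \<subseteq> U" and C: "C \<ge> 0"
    and ge: "\<And>x. x \<in> S \<Longrightarrow> C * metric_density M x \<le> \<bar>det (matrix (tangent_map (atlas M) euclidean_atlas f x))\<bar>"
  shows "ennreal C * emeasure (riem_measure M) S \<le> emeasure lborel (f ` S)"
proof -
  obtain \<kappa> :: "nat \<Rightarrow> ('a, real^'n) chart" and B where kB: "\<And>i. \<kappa> i \<in> atlas M" "\<And>i. B i \<in> sets borel" "\<And>i. B i \<subseteq> fst (\<kappa> i)"
    "disjoint_family B" "(\<Union>i. B i) = UNIV"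
    "\<And>S. S \<in> sets borel \<Longrightarrow> emeasure (riem_measure M) S
       = (\<Sum>i. \<integral>\<^sup>+y\<in>snd (\<kappa> i) ` (S \<inter> B i). ennreal (sqrt (det (gram M (\<kappa> i) y))) \<partial>lborel)"
    by (rule riem_measure_pieces[OF M]) (rule that; assumption)
  have "ennreal C * (\<integral>\<^sup>+y\<in>snd (\<kappa> i) ` (S \<inter> B i). ennreal (sqrt (det (gram M (\<kappa> i) y))) \<partial>lborel)
      \<le> emeasure lborel (f ` (S \<inter> B i))" for i
  proof -
    have SB: "S \<inter> B i \<in> sets borel" "S \<inter> B i \<subseteq> U" "S \<inter> B i \<subseteq> fst (\<kappa> i)"
      using S kB(2)[of i] kB(3)[of i] by auto
    let ?S = "snd (\<kappa> i) ` (S \<inter> B i)"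
    let ?F = "\<lambda>y. \<bar>det (matrix (frechet_derivative (f \<circ> chart_inv (\<kappa> i)) (at y)))\<bar>"
    let ?g = "\<lambda>y. sqrt (det (gram M (\<kappa> i) y))"
    have "C * ?g y \<le> ?F y" if y: "y \<in> ?S" for y
    proof -
      obtain x where x: "x \<in> S \<inter> B i" "y = snd (\<kappa> i) x" using y by blast
      then have xk: "x \<in> fst (\<kappa> i)" using SB by blast
      show ?thesis
        unfolding x(2) emeasure_embedding_chart(3)[OF SB kB(1) x(1)] sqrt_det_gram[OF M kB(1) xk]
        using mult_left_mono[OF ge[of x], of "\<bar>det (matrix (chart_trans (\<kappa> i) (chart_at (atlas M) x) x))\<bar>"] x(1)
        by (simp add: mult_ac)
    qed
    then have *: "ennreal C * ennreal (indicat_real ?S y *\<^sub>R ?g y) \<le> ennreal (?F y) * indicator ?S y" for y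
      using C by (auto simp: indicator_def ennreal_mult'[symmetric] intro!: ennreal_leI)
    have "(\<integral>\<^sup>+y\<in>?S. ennreal (?g y) \<partial>lborel) = (\<integral>\<^sup>+y. ennreal (indicat_real ?S y *\<^sub>R ?g y) \<partial>lborel)"
      by (intro nn_integral_cong) (simp add: indicator_def)
    then have "ennreal C * (\<integral>\<^sup>+y\<in>?S. ennreal (?g y) \<partial>lborel) = (\<integral>\<^sup>+y. ennreal C * ennreal (indicat_real ?S y *\<^sub>R ?g y) \<partial>lborel)"
      using set_borel_measurable_gram[OF M kB(1) SB(1,3)]
      by (subst nn_integral_cmult) (simp_all add: set_borel_measurable_def)
    also have "\<dots> \<le> emeasure lborel (f ` (S \<inter> B i))"
      unfolding emeasure_embedding_chart(2)[OF SB kB(1)] using * by (intro nn_integral_mono) simp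
    finally show ?thesis .
  qed
  then have "(\<Sum>i. ennreal C * (\<integral>\<^sup>+y\<in>snd (\<kappa> i) ` (S \<inter> B i). ennreal (sqrt (det (gram M (\<kappa> i) y))) \<partial>lborel))
      \<le> (\<Sum>i. emeasure lborel (f ` (S \<inter> B i)))"
    by (intro suminf_le) auto
  then show ?thesis
    by (simp only: emeasure_embedding_pieces[OF S kB(2,4,5)] kB(6)[OF S(1)] ennreal_suminf_cmult)
qed

lemma det_embedding_nonzero: "x \<in> U \<Longrightarrow> det (matrix (tangent_map (atlas M) euclidean_atlas f x)) \<noteq> 0"
  using f det_nz_iff_inj[OF linear_tangent_map[OF smooth_atlas_riem[OF M] embedding_smooth]]
  by (auto simp: smooth_embedding_def)

text \<open>The Jacobian has no uniform positive lower bound here, as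
  \<open>emeasure_embedding_ge\<close> would require. Instead its integral over the set vanishes in
  each chart, and since it is positive at every point of the set, the set is null.\<close>

lemma emeasure_embedding_null:
  assumes S: "S \<in> sets borel" "S \<subseteq> U" and null: "negligible (f ` S)"
  shows "emeasure (riem_measure M) S = 0"
proof (rule riem_measure_null[OF M S(1)])
  fix k assume k: "k \<in> atlas M"
  note A = smooth_atlas_riem[OF M]
  let ?S = "S \<inter> fst k"
  have Sk: "?S \<in> sets borel" "?S \<subseteq> U" "?S \<subseteq> fst k"
    using S borel_open[OF open_chart_domain[OF A k]] by auto
  let ?F = "\<lambda>y. \<bar>det (matrix (frechet_derivative (f \<circ> chart_inv k) (at y)))\<bar>"
  have "negligible (f ` ?S)" by (rule negligible_subset[OF null]) blast
  then have "f ` ?S \<in> null_sets lborel"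
    using embedding_image_borel[OF Sk(1,2)] by (simp add: negligible_iff_null_sets null_sets_completion_iff)
  then have "emeasure lborel (f ` ?S) = 0" by (rule null_setsD1)
  moreover have "emeasure lborel (f ` ?S) = (\<integral>\<^sup>+y. ennreal (indicat_real (snd k ` ?S) y *\<^sub>R ?F y) \<partial>lborel)"
    unfolding emeasure_embedding_chart(2)[OF Sk k] by (intro nn_integral_cong) (simp add: indicator_def)
  ultimately have "(\<integral>\<^sup>+y. ennreal (indicat_real (snd k ` ?S) y *\<^sub>R ?F y) \<partial>lborel) = 0" by simp
  then have "AE y in lborel. ennreal (indicat_real (snd k ` ?S) y *\<^sub>R ?F y) = 0"
    using emeasure_embedding_chart(1)[OF Sk k]
    by (subst (asm) nn_integral_0_iff_AE) (simp_all add: set_borel_measurable_def)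
  moreover have "?F (snd k x) > 0" if x: "x \<in> ?S" for x
    unfolding emeasure_embedding_chart(3)[OF Sk k x]
  proof (intro mult_pos_pos)
    have "x \<in> U" "x \<in> fst k" using x Sk by auto
    then show "0 < \<bar>det (matrix (tangent_map (atlas M) euclidean_atlas f x))\<bar>"
      "0 < \<bar>det (matrix (chart_trans k (chart_at (atlas M) x) x))\<bar>"
      using det_embedding_nonzero[of x] det_chart_trans_nonzero[OF A k chart_at(1)[OF A] _ chart_at(2)[OF A], of x]
      by simp_all
  qed
  ultimately have "AE y in lborel. y \<notin> snd k ` ?S"
    by (elim AE_mp) (auto intro!: AE_I2 simp: indicator_def)
  then have "snd k ` ?S \<in> null_sets lborel"
    using chart_image_borel[OF A k Sk(1,3)] by (simp add: AE_iff_null_sets)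
  then show "negligible (snd k ` (S \<inter> fst k))"
    by (simp add: negligible_iff_null_sets null_sets_completionI)
qed

end

section \<open>Twisted costs\<close>

text \<open>\<open>smooth_embedding\<close> yields some continuous inverse, whereas
  \<open>c_Exp\<close> is built from \<open>inv_into\<close>; the two agree on the image.\<close>

lemma embedding_inv_into_homeomorphism:
  assumes f: "smooth_embedding A euclidean_atlas U f"
  shows "homeomorphism U (f ` U) f (inv_into U f)"
proof -
  obtain g where g: "homeomorphism U (f ` U) f g" using f unfolding smooth_embedding_def by blast
  have inj: "inj_on f U" using homeomorphism_apply1[OF g] by (rule inj_on_inverseI)
  have "g y = inv_into U f y" if y: "y \<in> f ` U" for y
  proof -
    obtain u where "u \<in> U" "y = f u" using y by blast
    then show ?thesis using inv_into_f_f[OF inj] homeomorphism_apply1[OF g] by simp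
  qed
  then show ?thesis by (intro homeomorphism_cong[OF g]) auto
qed

text \<open>The inverse is continuous by the definition of an embedding, and the tangent map is
  bijective by equality of dimensions. Differentiability of the inverse follows from these two facts
  by inverting the linear approximation.\<close>

lemma embedding_inverse_derivative:
  fixes M :: "('a::{t2_space, second_countable_topology}, 'n::finite) riem"
    and f :: "'a \<Rightarrow> real^'n"
  assumes M: "riemannian_manifold M" and U: "open U"
    and f: "smooth_embedding (atlas M) euclidean_atlas U f" and x: "x \<in> U"
  obtains L where "linear L" "L \<circ> tangent_map (atlas M) euclidean_atlas f x = id"
    "tangent_map (atlas M) euclidean_atlas f x \<circ> L = id"
    "((snd (chart_at (atlas M) x) \<circ> inv_into U f) has_derivative L) (at (f x))"
proof -
  note A = smooth_atlas_riem[OF M]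
  note sm = embedding_smooth[OF M U f]
  let ?T = "tangent_map (atlas M) euclidean_atlas f x" and ?k = "chart_at (atlas M) x"
  note k = chart_at[OF A, of x]
  have "inj ?T" using f x unfolding smooth_embedding_def by blast
  then obtain L where L: "linear L" "\<forall>v. L (?T v) = v" "\<forall>v. ?T (L v) = v"
    using linear_injective_isomorphism[OF linear_tangent_map[OF A sm x]] by blast
  have LT: "L \<circ> ?T = id" "?T \<circ> L = id" using L by (simp_all add: fun_eq_iff)
  have inv: "inv_into U f (f y) = y" if "y \<in> U" for y
    by (rule inv_into_f_f[OF embedding_inj_on[OF M U f] that])
  have cont: "continuous_on (f ` U) (inv_into U f)"
    by (rule homeomorphism_cont2[OF embedding_inv_into_homeomorphism[OF f]])
  have fU: "open (f ` U)" by (rule embedding_open_image[OF M U f U order_refl])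
  have Uk: "open (U \<inter> fst ?k)" by (rule open_Int[OF U open_chart_domain[OF A k(1)]])
  have "((f \<circ> chart_inv ?k) has_derivative ?T) (at (snd ?k x))"
    using smooth_map_euclidean_has_derivative[OF A sm x k] by (simp only: chart_trans_self[OF A k] comp_id)
  then have "((snd ?k \<circ> inv_into U f) has_derivative L) (at ((f \<circ> chart_inv ?k) (snd ?k x)))"
  proof (rule has_derivative_inverse_basic_x[where T = "f ` (U \<inter> fst ?k)"])
    have fx: "(f \<circ> chart_inv ?k) (snd ?k x) = f x" by (simp add: chart_inv_chart[OF A k])
    show "bounded_linear L" using L(1) by (rule linear_conv_bounded_linear[THEN iffD1])
    show "continuous (at ((f \<circ> chart_inv ?k) (snd ?k x))) (snd ?k \<circ> inv_into U f)"
      unfolding fx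
    proof (rule continuous_within_compose)
      show "continuous (at (f x)) (inv_into U f)"
        using cont fU x by (simp add: continuous_on_eq_continuous_at)
      have "continuous (at x) (snd ?k)"
        using homeomorphism_cont1[OF homeomorphism_chart[OF A k(1)]] open_chart_domain[OF A k(1)] k(2)
        by (simp add: continuous_on_eq_continuous_at)
      then show "continuous (at (inv_into U f (f x)) within range (inv_into U f)) (snd ?k)"
        unfolding inv[OF x] by (rule continuous_at_imp_continuous_at_within)
    qed
    show "(snd ?k \<circ> inv_into U f) ((f \<circ> chart_inv ?k) (snd ?k x)) = snd ?k x"
      unfolding fx by (simp add: inv[OF x])
    show "open (f ` (U \<inter> fst ?k))" by (rule embedding_open_image[OF M U f Uk]) blast
    show "(f \<circ> chart_inv ?k) (snd ?k x) \<in> f ` (U \<inter> fst ?k)" unfolding fx using x k(2) by blast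
    fix y assume "y \<in> f ` (U \<inter> fst ?k)"
    then obtain u where u: "u \<in> U" "u \<in> fst ?k" "y = f u" by blast
    show "(f \<circ> chart_inv ?k) ((snd ?k \<circ> inv_into U f) y) = y"
      unfolding u(3) o_apply inv[OF u(1)] chart_inv_chart[OF A k(1) u(2)] ..
  qed (rule LT(1))
  then have "((snd ?k \<circ> inv_into U f) has_derivative L) (at (f x))"
    by (simp add: chart_inv_chart[OF A k])
  then show thesis using L(1) LT by (intro that)
qed

lemma open_compl_c_cut: "open (- c_cut M N c x)"
proof (rule open_subopen[THEN iffD2], rule ballI)
  fix xb assume "xb \<in> - c_cut M N c x"
  then obtain S where S: "open S" "(x, xb) \<in> S"
      "smooth_map (prod_atlas (atlas M) (atlas N)) euclidean_atlas S (\<lambda>(y, yb). c y yb)"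
    unfolding c_cut_def by blast
  show "\<exists>T. open T \<and> xb \<in> T \<and> T \<subseteq> - c_cut M N c x"
  proof (intro exI conjI)
    show "open (Pair x -` S)" using S(1) by (intro open_vimage continuous_intros)
    show "xb \<in> Pair x -` S" using S(2) by simp
    show "Pair x -` S \<subseteq> - c_cut M N c x" unfolding c_cut_def using S by blast
  qed
qed

lemma chart_inv_prod:
  assumes "k \<in> A" "l \<in> B" "smooth_atlas A" "smooth_atlas B" "a \<in> fst k" "b \<in> fst l"
  shows "chart_inv (fst k \<times> fst l, map_prod (snd k) (snd l)) (snd k a, snd l b) = (a, b)"
proof -
  have inj: "inj_on (snd k) (fst k)" "inj_on (snd l) (fst l)"
    using chart_inv_chart[OF assms(3,1)] chart_inv_chart[OF assms(4,2)] by (metis inj_on_inverseI)+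
  have "inv_into (fst k \<times> fst l) (map_prod (snd k) (snd l)) (map_prod (snd k) (snd l) (a, b)) = (a, b)"
    by (rule inv_into_f_f[OF map_prod_inj_on[OF inj]]) (use assms(5,6) in simp)
  then show ?thesis by (simp add: chart_inv_def)
qed

text \<open>The cut locus refers to joint smoothness in product charts; composing with the two slice
  maps extracts the partial derivatives.\<close>

lemma smooth_map_prod_slices_differentiable:
  fixes A :: "('a::topological_space, 'e::euclidean_space) chart set"
    and B :: "('b::topological_space, 'f::euclidean_space) chart set"
  assumes A: "smooth_atlas A" and B: "smooth_atlas B"
    and S: "open S" "(a, b) \<in> S" and F: "smooth_map (prod_atlas A B) euclidean_atlas S F"
    and k: "k \<in> A" "a \<in> fst k" and l: "l \<in> B" "b \<in> fst l"
  shows "((\<lambda>y. F (y, b) :: real) \<circ> chart_inv k) differentiable (at (snd k a))"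
    and "((\<lambda>z. F (a, z)) \<circ> chart_inv l) differentiable (at (snd l b))"
proof -
  let ?m = "(fst k \<times> fst l, map_prod (snd k) (snd l))"
  have m: "?m \<in> prod_atlas A B" using k l unfolding prod_atlas_def by blast
  have D: "(F \<circ> chart_inv ?m) differentiable (at (snd k a, snd l b))"
  proof (rule smooth_on_imp_differentiable[OF smooth_map_euclideanD(2)[OF F m]])
    have "(a, b) \<in> S \<inter> fst ?m" using S k l by simp
    then have "snd ?m (a, b) \<in> snd ?m ` (S \<inter> fst ?m)" by (rule imageI)
    then show "(snd k a, snd l b) \<in> snd ?m ` (S \<inter> fst ?m)" by simp
  qed
  have 1: "(\<lambda>y. (y, snd l b)) differentiable (at (snd k a))"
    by (rule differentiableI[OF has_derivative_Pair[OF has_derivative_ident has_derivative_const]])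
  have "((F \<circ> chart_inv ?m) \<circ> (\<lambda>y. (y, snd l b))) differentiable (at (snd k a))"
    by (rule differentiable_chain_at[OF 1 D])
  then obtain D where "((F \<circ> chart_inv ?m) \<circ> (\<lambda>y. (y, snd l b)) has_derivative D) (at (snd k a))"
    unfolding differentiable_def by blast
  then show "((\<lambda>y. F (y, b)) \<circ> chart_inv k) differentiable (at (snd k a))"
  proof (rule differentiableI[OF has_derivative_transform_within_open])
    show "open (snd k ` fst k)" by (rule open_chart_range[OF A k(1)])
    show "snd k a \<in> snd k ` fst k" using k by blast
    fix y assume "y \<in> snd k ` fst k"
    then obtain u where u: "u \<in> fst k" "y = snd k u" by blast
    show "((F \<circ> chart_inv ?m) \<circ> (\<lambda>y. (y, snd l b))) y = ((\<lambda>y. F (y, b)) \<circ> chart_inv k) y"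
      unfolding u(2) o_apply chart_inv_prod[OF k(1) l(1) A B u(1) l(2)] chart_inv_chart[OF A k(1) u(1)] ..
  qed
  have 2: "Pair (snd k a) differentiable (at (snd l b))"
    by (rule differentiableI[OF has_derivative_Pair[OF has_derivative_const has_derivative_ident]])
  have "((F \<circ> chart_inv ?m) \<circ> Pair (snd k a)) differentiable (at (snd l b))"
    by (rule differentiable_chain_at[OF 2 D])
  then obtain D where "((F \<circ> chart_inv ?m) \<circ> Pair (snd k a) has_derivative D) (at (snd l b))"
    unfolding differentiable_def by blast
  then show "((\<lambda>z. F (a, z)) \<circ> chart_inv l) differentiable (at (snd l b))"
  proof (rule differentiableI[OF has_derivative_transform_within_open])
    show "open (snd l ` fst l)" by (rule open_chart_range[OF B l(1)])
    show "snd l b \<in> snd l ` fst l" using l by blast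
    fix y assume "y \<in> snd l ` fst l"
    then obtain u where u: "u \<in> fst l" "y = snd l u" by blast
    show "((F \<circ> chart_inv ?m) \<circ> Pair (snd k a)) y = ((\<lambda>z. F (a, z)) \<circ> chart_inv l) y"
      unfolding u(2) o_apply chart_inv_prod[OF k(1) l(1) A B k(2) u(1)] chart_inv_chart[OF B l(1) u(1)] ..
  qed
qed

lemma cost_differentiable:
  assumes A: "smooth_atlas (atlas M)" and B: "smooth_atlas (atlas N)"
    and ncut: "xb \<notin> c_cut M N c x"
  shows "((\<lambda>y. c y xb) \<circ> chart_inv (chart_at (atlas M) x)) differentiable (at (snd (chart_at (atlas M) x) x))"
    and "(c x \<circ> chart_inv (chart_at (atlas N) xb)) differentiable (at (snd (chart_at (atlas N) xb) xb))"
proof -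
  obtain S where S: "open S" "(x, xb) \<in> S"
      "smooth_map (prod_atlas (atlas M) (atlas N)) euclidean_atlas S (\<lambda>(y, yb). c y yb)"
    using ncut unfolding c_cut_def by blast
  note D = smooth_map_prod_slices_differentiable[OF A B S chart_at[OF A] chart_at[OF B]]
  show "((\<lambda>y. c y xb) \<circ> chart_inv (chart_at (atlas M) x)) differentiable (at (snd (chart_at (atlas M) x) x))"
    using D(1) by simp
  show "(c x \<circ> chart_inv (chart_at (atlas N) xb)) differentiable (at (snd (chart_at (atlas N) xb) xb))"
    using D(2) by simp
qed

lemma has_derivative_differential:
  assumes "(\<alpha> \<circ> chart_inv (chart_at A x)) differentiable (at (snd (chart_at A x) x))"
  shows "((\<alpha> \<circ> chart_inv (chart_at A x)) has_derivative (\<lambda>v. differential A \<alpha> x \<bullet> v)) (at (snd (chart_at A x) x))"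
proof -
  let ?T = "tangent_map A euclidean_atlas \<alpha> x"
  have T: "((\<alpha> \<circ> chart_inv (chart_at A x)) has_derivative ?T) (at (snd (chart_at A x) x))"
    unfolding tangent_map_euclidean using assms frechet_derivative_works by blast
  then have lin: "linear ?T" by (rule has_derivative_linear)
  have "?T v = differential A \<alpha> x \<bullet> v" for v
  proof -
    have "?T v = ?T (\<Sum>b\<in>Basis. (v \<bullet> b) *\<^sub>R b)" by (simp add: euclidean_representation)
    also have "\<dots> = (\<Sum>b\<in>Basis. (v \<bullet> b) * ?T b)" by (simp add: linear_sum[OF lin] linear_scale[OF lin])
    also have "\<dots> = differential A \<alpha> x \<bullet> v"
      unfolding differential_def inner_sum_left by (intro sum.cong refl) (simp add: inner_commute)
    finally show ?thesis .
  qed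
  then have "?T = (\<lambda>v. differential A \<alpha> x \<bullet> v)" by (rule ext)
  then show ?thesis using T by (simp only:)
qed

lemma matrix_of_linear_works:
  fixes f :: "real^'n \<Rightarrow> real^'m"
  assumes "linear f"
  shows "matrix f *v x = f x"
  using matrix_works[of f x] assms by (simp add: linear_matrix_vector_mul_eq)

lemma transpose_of_forms: "(\<chi> i j. w j \<bullet> (G *v u i)) = transpose (\<chi> i j. w i \<bullet> (G *v u j))"
  by (simp add: transpose_def)

section \<open>Jacobians of the cost in orthonormal frames, and the cut locus\<close>

lemma twist_half_embedding:
  "twist_half M N c \<Longrightarrow> smooth_embedding (atlas N) euclidean_atlas (- c_cut M N c x) (neg_D M c x)"
  by (simp add: twist_half_def)

text \<open>In preferred coordinates the tangent map of \<open>neg_D N (cbar c) xb\<close> is the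
  negated mixed second derivative. Expressing both arguments in orthonormal frames multiplies the
  determinant by those of the frame matrices, which are the reciprocal densities.\<close>

lemma abs_det_mixed:
  fixes M :: "('a::{t2_space, second_countable_topology}, 'n::finite) riem"
    and N :: "('b::{t2_space, second_countable_topology}, 'n) riem"
  assumes M: "riemannian_manifold M" and N: "riemannian_manifold N"
    and tw: "twist_half N M (cbar c)" and x: "x \<notin> c_cut N M (cbar c) xb"
  shows "\<bar>det (matrix (tangent_map (atlas M) euclidean_atlas (neg_D N (cbar c) xb) x))\<bar>
    = \<bar>det_mixed M N c x xb\<bar> * metric_density M x * metric_density N xb"
proof -
  note A = smooth_atlas_riem[OF M]
  let ?U = "- c_cut N M (cbar c) xb" and ?Q = "neg_D N (cbar c) xb" and ?k = "chart_at (atlas M) x"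
  let ?T = "tangent_map (atlas M) euclidean_atlas ?Q x"
  note emb = twist_half_embedding[OF tw, of xb]
  note sm = embedding_smooth[OF M open_compl_c_cut emb]
  have xU: "x \<in> ?U" using x by simp
  have lin: "linear ?T" by (rule linear_tangent_map[OF A sm xU])
  have "((?Q \<circ> chart_inv ?k) has_derivative ?T) (at (snd ?k x))"
    using smooth_map_euclidean_has_derivative[OF A sm xU chart_at[OF A]]
    by (simp only: chart_trans_self[OF A chart_at[OF A]] comp_id)
  then have "((\<lambda>y. - (?Q \<circ> chart_inv ?k) y) has_derivative (\<lambda>v. - ?T v)) (at (snd ?k x))"
    by (rule has_derivative_minus)
  moreover have "(\<lambda>y. - (?Q \<circ> chart_inv ?k) y) = (\<lambda>y. differential (atlas N) (c y) xb) \<circ> chart_inv ?k"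
    by (simp add: fun_eq_iff neg_D_def cbar_def)
  ultimately have "tangent_map (atlas M) euclidean_atlas (\<lambda>y. differential (atlas N) (c y) xb) x = (\<lambda>v. - ?T v)"
    unfolding tangent_map_euclidean by (simp only: frechet_derivative_at[symmetric])
  then have md: "- mixed_deriv M N c x xb u v = v \<bullet> (matrix ?T *v u)" for u v
    by (simp add: mixed_deriv_def matrix_of_linear_works[OF lin] inner_commute)
  \<comment> \<open>The frame of \<open>M\<close> indexes the rows of \<open>det_mixed\<close> but
    is the argument of the tangent map, hence the transpose.\<close>
  have "det_mixed M N c x xb
      = det (transpose (\<chi> i j. orthonormal_frame N xb i \<bullet> (matrix ?T *v orthonormal_frame M x j)))"
    unfolding det_mixed_def md transpose_of_forms ..
  also have "\<dots> = det (transpose (frame_matrix N xb) ** matrix ?T ** frame_matrix M x)"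
    unfolding det_transpose matrix_of_forms frame_matrix_def[OF M] frame_matrix_def[OF N] ..
  finally have "\<bar>det_mixed M N c x xb\<bar> = \<bar>det (matrix ?T)\<bar> / (metric_density M x * metric_density N xb)"
    by (simp add: det_mul abs_mult det_frame_matrix[OF M] det_frame_matrix[OF N])
  then show ?thesis using metric_density_pos[OF M, of x] metric_density_pos[OF N, of xb] by simp
qed

lemma c_Exp_dual_dom:
  "p \<in> dual_dom M N c x \<Longrightarrow> c_Exp M N c x p = inv_into (- c_cut M N c x) (neg_D M c x) p"
  by (simp add: c_Exp_def)

text \<open>\<open>c_Exp\<close> inverts \<open>neg_D M c x\<close>, so the coordinate determinants
  are reciprocal. Both densities appear as factors because the source of \<open>c_Exp\<close>
  consists of covectors, whose orthonormal frames scale inversely to those of vectors.\<close>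

lemma abs_det_d_c_Exp:
  fixes M :: "('a::{t2_space, second_countable_topology}, 'n::finite) riem"
    and N :: "('b::{t2_space, second_countable_topology}, 'n) riem"
  assumes M: "riemannian_manifold M" and N: "riemannian_manifold N"
    and tw: "twist_half M N c" and xb: "xb \<notin> c_cut M N c x"
  shows "\<bar>det_d_c_Exp M N c x (neg_D M c x xb)\<bar>
      * \<bar>det (matrix (tangent_map (atlas N) euclidean_atlas (neg_D M c x) xb))\<bar>
    = metric_density N xb * metric_density M x"
proof -
  note A = smooth_atlas_riem[OF N]
  let ?U = "- c_cut M N c x" and ?f = "neg_D M c x" and ?k = "chart_at (atlas N) xb"
  let ?T = "tangent_map (atlas N) euclidean_atlas ?f xb"
  define p where "p = ?f xb"
  note emb = twist_half_embedding[OF tw, of x]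
  note sm = embedding_smooth[OF N open_compl_c_cut emb]
  have xU: "xb \<in> ?U" using xb by simp
  have lin: "linear ?T" by (rule linear_tangent_map[OF A sm xU])
  obtain L where L: "linear L" "L \<circ> ?T = id" "?T \<circ> L = id" "((snd ?k \<circ> inv_into ?U ?f) has_derivative L) (at p)"
    unfolding p_def by (rule embedding_inverse_derivative[OF N open_compl_c_cut emb xU])
  have p: "p \<in> dual_dom M N c x" unfolding dual_dom_def p_def using xU by blast
  have op: "open (dual_dom M N c x)"
    unfolding dual_dom_def by (rule embedding_open_image[OF N open_compl_c_cut emb open_compl_c_cut order_refl])
  have "inv_into ?U ?f p = xb"
    unfolding p_def by (rule inv_into_f_f[OF embedding_inj_on[OF N open_compl_c_cut emb] xU])
  then have Ep: "c_Exp M N c x p = xb" by (simp only: c_Exp_dual_dom[OF p])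
  have "((snd ?k \<circ> c_Exp M N c x) has_derivative L) (at p)"
    by (rule has_derivative_transform_within_open[OF L(4) op p]) (simp add: c_Exp_dual_dom)
  then have TL: "tangent_map euclidean_atlas (atlas N) (c_Exp M N c x) p = L"
    unfolding tangent_map_def Ep chart_at_euclidean chart_inv_id by (simp add: frechet_derivative_at[symmetric])
  have "matrix L ** matrix ?T = mat 1"
    using matrix_compose[OF lin L(1)] L(2) by (simp add: matrix_id_mat_1)
  then have dL: "det (matrix L) * det (matrix ?T) = 1" by (metis det_I det_mul)
  \<comment> \<open>The coframe covectors as columns. They are the frame vectors lowered by the
    metric, so the determinant is in absolute value the squared density divided by the
    density.\<close>
  define W :: "real^'n^'n" where "W = (\<chi> a j. orthonormal_coframe M x j $ a)"
  have W: "W = metric_matrix M x ** frame_matrix M x"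
  proof -
    have "gmetric M x (orthonormal_frame M x j) (axis a 1) = (metric_matrix M x *v orthonormal_frame M x j) $ a" for a j
    proof -
      have "gmetric M x (orthonormal_frame M x j) (axis a 1) = gmetric M x (axis a 1) (orthonormal_frame M x j)"
        using M unfolding riemannian_manifold_def by blast
      then show ?thesis by (simp add: gmetric_matrix_form[OF M] inner_axis')
    qed
    then show ?thesis
      by (simp add: W_def orthonormal_coframe_def vec_eq_iff matrix_matrix_mult_def matrix_vector_mult_def frame_matrix_def[OF M])
  qed
  have dW: "\<bar>det W\<bar> = metric_density M x"
  proof -
    have "det (metric_matrix M x) = metric_density M x * metric_density M x"
      using det_metric_matrix_pos[OF M, of x] by (simp add: metric_density_def)
    then show ?thesis
      using W metric_density_pos[OF M, of x] by (simp add: det_mul abs_mult det_frame_matrix[OF M])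
  qed
  have "det_d_c_Exp M N c x p
      = det (\<chi> i j. orthonormal_frame N xb i \<bullet> (metric_matrix N xb *v (L (orthonormal_coframe M x j))))"
    unfolding det_d_c_Exp_def Ep Let_def TL gmetric_matrix_form[OF N] ..
  also have "\<dots> = det (\<chi> i j. orthonormal_frame N xb i \<bullet> ((metric_matrix N xb ** matrix L) *v orthonormal_coframe M x j))"
    by (simp add: matrix_of_linear_works[OF L(1)] flip: matrix_vector_mul_assoc)
  also have "\<dots> = det (transpose (frame_matrix N xb) ** (metric_matrix N xb ** matrix L) ** W)"
    unfolding matrix_of_forms W_def frame_matrix_def[OF N] ..
  finally have "\<bar>det_d_c_Exp M N c x p\<bar> = metric_density N xb * \<bar>det (matrix L)\<bar> * metric_density M x"
  proof -
    have "det (metric_matrix N xb) = metric_density N xb * metric_density N xb"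
      using det_metric_matrix_pos[OF N, of xb] by (simp add: metric_density_def)
    moreover assume "det_d_c_Exp M N c x p = det (transpose (frame_matrix N xb) ** (metric_matrix N xb ** matrix L) ** W)"
    ultimately show ?thesis
      using metric_density_pos[OF N, of xb] by (simp add: det_mul abs_mult det_frame_matrix[OF N] dW)
  qed
  moreover have "\<bar>det (matrix L)\<bar> * \<bar>det (matrix ?T)\<bar> = 1" using dL by (metis abs_mult abs_one)
  ultimately show ?thesis unfolding p_def[symmetric] by (simp add: mult_ac)
qed

text \<open>\<open>c-Exp\<close> maps the closure of the convex set \<open>M\<^sup>*(x)\<close> onto the manifold, so the cut locus is the image
  of a part of the frontier.\<close>

lemma c_cut_null:
  fixes M :: "('a::{t2_space, second_countable_topology}, 'n::finite) riem"
    and N :: "('b::{t2_space, second_countable_topology}, 'n) riem"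
  assumes N: "riemannian_manifold N" and tw: "twist_half M N c"
    and ce: "c_exp_half M N c" and dc: "domain_convexity_half M N c"
  shows "c_cut M N c x \<in> sets borel" "emeasure (riem_measure N) (c_cut M N c x) = 0"
proof -
  let ?C = "c_cut M N c x" and ?D = "dual_dom M N c x" and ?E = "c_Exp M N c x"
  show C: "?C \<in> sets borel" using borel_open[OF open_compl_c_cut[of M N c x]] borel_comp[of "- ?C"] by simp
  have within: "smooth_map_within euclidean_atlas (atlas N) (closure ?D) ?E" and onto: "?E ` closure ?D = UNIV"
    using ce unfolding c_exp_half_def by blast+
  have "convex ?D" using dc unfolding domain_convexity_half_def by blast
  then have "negligible (frontier ?D)" by (rule negligible_convex_frontier)
  then have neg: "negligible (closure ?D - ?D)"
    by (rule negligible_subset) (use interior_subset[of ?D] in \<open>auto simp: frontier_def\<close>)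
  show "emeasure (riem_measure N) ?C = 0"
  proof (rule riem_measure_null[OF N C])
    fix l assume l: "l \<in> atlas N"
    let ?S = "{p \<in> closure ?D - ?D. ?E p \<in> fst l}"
    have "snd l ` (?C \<inter> fst l) \<subseteq> (snd l \<circ> ?E) ` ?S"
    proof
      fix y assume "y \<in> snd l ` (?C \<inter> fst l)"
      then obtain xb where xb: "xb \<in> ?C" "xb \<in> fst l" "y = snd l xb" by blast
      obtain p where p: "p \<in> closure ?D" "?E p = xb" using onto by (metis UNIV_I imageE)
      have "p \<notin> ?D"
      proof
        assume pD: "p \<in> ?D"
        then have "?E p \<in> - ?C"
          unfolding c_Exp_dual_dom[OF pD] using pD unfolding dual_dom_def by (intro inv_into_into) 
        then show False using p xb by simp
      qed
      then have "p \<in> ?S" using p xb by simp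
      then have "(snd l \<circ> ?E) p \<in> (snd l \<circ> ?E) ` ?S" by (rule imageI)
      then show "y \<in> (snd l \<circ> ?E) ` ?S" using p xb by simp
    qed
    \<comment> \<open>Differentiable maps between spaces of equal dimension preserve null sets; near
      each point the smooth extension \<open>F\<close> supplies the derivative within the
      set.\<close>
    moreover have "negligible ((snd l \<circ> ?E) ` ?S)"
    proof (rule negligible_differentiable_image_negligible[OF order_refl])
      show "negligible ?S" by (rule negligible_subset[OF neg]) blast
      show "(snd l \<circ> ?E) differentiable_on ?S"
        unfolding differentiable_on_def
      proof
        fix p assume p: "p \<in> ?S"
        then obtain W F where WF: "open W" "p \<in> W" "smooth_map euclidean_atlas (atlas N) W F" "\<forall>q\<in>closure ?D \<inter> W. F q = ?E q"
          using within unfolding smooth_map_within_def by blast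
        have "smooth_on (id ` (W \<inter> UNIV \<inter> F -` fst l)) (snd l \<circ> F \<circ> chart_inv (UNIV, id))"
          using WF(3) l unfolding smooth_map_def euclidean_atlas_def by force
        moreover have "p \<in> W \<inter> F -` fst l" using p WF by auto
        ultimately have "(snd l \<circ> F) differentiable (at p)"
          by (intro smooth_on_imp_differentiable[of "W \<inter> F -` fst l"]) (simp_all add: chart_inv_id)
        then have 1: "(snd l \<circ> F) differentiable (at p within ?S)" by (rule differentiable_at_withinI)
        obtain d where d: "d > 0" "ball p d \<subseteq> W" using WF(1,2) by (meson openE)
        show "(snd l \<circ> ?E) differentiable (at p within ?S)"
        proof (rule differentiable_transform_within[OF 1 d(1) p])
          fix q assume q: "q \<in> ?S" "dist q p < d"
          then have "q \<in> W" using d(2) by (auto simp: dist_commute subset_iff)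
          then show "(snd l \<circ> F) q = (snd l \<circ> ?E) q" using WF(4) q by simp
        qed
      qed
    qed
    ultimately show "negligible (snd l ` (?C \<inter> fst l))" by (rule negligible_subset[rotated])
  qed
qed

text \<open>Segments between points of \<open>dual_dom\<close> stay inside it by domain convexity.
  There \<open>c_Exp\<close> is the plain inverse of \<open>neg_D\<close>, so (convex DASM) can be
  read off without its extension by limits.\<close>

lemma cost_difference_convex:
  assumes dasm: "convex_DASM_half M N c" and dc: "domain_convexity_half M N c"
    and p: "p \<in> dual_dom M N c x" and q: "q \<in> dual_dom M N c x" and t: "t \<in> {0..1}"
  defines "\<psi> \<equiv> inv_into (- c_cut M N c x) (neg_D M c x)"
  shows "- c y (\<psi> ((1 - t) *\<^sub>R p + t *\<^sub>R q)) + c x (\<psi> ((1 - t) *\<^sub>R p + t *\<^sub>R q))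
    \<le> (1 - t) * (- c y (\<psi> p) + c x (\<psi> p)) + t * (- c y (\<psi> q) + c x (\<psi> q))"
proof -
  let ?\<sigma> = "\<lambda>s. c_Exp M N c x ((1 - s) *\<^sub>R p + s *\<^sub>R q)"
  have "c_segment M N c x ?\<sigma>"
    unfolding c_segment_def using p q closure_subset by blast
  then have "- c y (?\<sigma> t) + c x (?\<sigma> t) \<le> (1 - t) * (- c y (?\<sigma> 0) + c x (?\<sigma> 0)) + t * (- c y (?\<sigma> 1) + c x (?\<sigma> 1))"
    using dasm t unfolding convex_DASM_half_def Let_def by blast
  moreover have "(1 - t) *\<^sub>R p + t *\<^sub>R q \<in> dual_dom M N c x"
    using dc p q t unfolding domain_convexity_half_def by (intro convexD) auto
  ultimately show ?thesis using p q by (simp add: c_Exp_dual_dom \<psi>_def)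
qed

text \<open>The set of \<open>\<eta>\<close> is contained in the image of the polar body under the
  affine map \<open>\<eta>\<^sub>0 + (r *\<^sub>R B) *v p\<close>, where \<open>B\<close> is the
  inverse transpose of \<open>A\<close>. The point \<open>g\<close> is chosen before
  \<open>A\<close>, \<open>\<eta>\<^sub>0\<close> and \<open>r\<close>, because in the application
  \<open>A\<close> is a derivative taken at \<open>g\<close>.\<close>

lemma volume_times_affine_polar_volume_le:
  fixes K :: "(real^'n) set"
  assumes K: "compact K" "convex K" "K \<noteq> {}"
  obtains g where "g \<in> K"
    "\<And>A \<eta>\<^sub>0 r. det A \<noteq> 0 \<Longrightarrow> r > 0 \<Longrightarrow>
      emeasure lborel K * emeasure lborel {\<eta>. \<forall>v\<in>K. (\<eta> - \<eta>\<^sub>0) \<bullet> (A *v (v - g)) \<le> r}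
      \<le> ennreal (r ^ CARD('n) / \<bar>det A\<bar> * (real CARD('n) ^ CARD('n) * (measure lborel (ball (0 :: real^'n) 1))\<^sup>2))"
proof -
  let ?b = "real CARD('n) ^ CARD('n) * (measure lborel (ball (0 :: real^'n) 1))\<^sup>2"
  obtain g where g: "g \<in> K" "emeasure lborel K * emeasure lborel {p. \<forall>v\<in>K. p \<bullet> (v - g) \<le> 1} \<le> ennreal ?b"
    by (rule volume_times_polar_volume_le[OF K])
  let ?P = "{p. \<forall>v\<in>K. p \<bullet> (v - g) \<le> 1}"
  have "closed (\<Inter>v\<in>K. {p. p \<bullet> (v - g) \<le> 1})"
    by (intro closed_INT ballI closed_Collect_le continuous_intros)
  moreover have "(\<Inter>v\<in>K. {p. p \<bullet> (v - g) \<le> 1}) = ?P" by blast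
  ultimately have "closed ?P" by (simp only:)
  then have P: "?P \<in> sets borel" by (rule borel_closed)
  have "emeasure lborel K * emeasure lborel {\<eta>. \<forall>v\<in>K. (\<eta> - \<eta>\<^sub>0) \<bullet> (A *v (v - g)) \<le> r} \<le> ennreal (r ^ CARD('n) / \<bar>det A\<bar> * ?b)"
    if A: "det A \<noteq> 0" and r: "r > 0" for A \<eta>\<^sub>0 r
  proof -
    have "det (transpose A) \<noteq> 0" using A by simp
    then obtain B where B: "transpose A ** B = mat 1" "B ** transpose A = mat 1"
      by (metis invertible_def invertible_det_nz)
    have "det B * det (transpose A) = 1" using B(2) by (metis det_I det_mul)
    then have "det B * det A = 1" by simp
    then have "det B = 1 / det A" using A by (simp add: field_simps)
    then have "\<bar>det (r *\<^sub>R B)\<bar> = r ^ CARD('n) / \<bar>det A\<bar>"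
      using r by (simp add: det_scaleR abs_mult)
    then have dB: "\<bar>det (r *\<^sub>R B)\<bar> = r ^ CARD('n) / \<bar>det A\<bar>" .
    then have dB0: "det (r *\<^sub>R B) \<noteq> 0" using A r by auto
    have im: "(\<lambda>p. \<eta>\<^sub>0 + (r *\<^sub>R B) *v p) ` ?P \<in> sets borel"
      "emeasure lborel ((\<lambda>p. \<eta>\<^sub>0 + (r *\<^sub>R B) *v p) ` ?P) = ennreal (r ^ CARD('n) / \<bar>det A\<bar>) * emeasure lborel ?P"
      using emeasure_affine_image[OF dB0 P, of \<eta>\<^sub>0] unfolding dB by (simp_all only:)
    have "{\<eta>. \<forall>v\<in>K. (\<eta> - \<eta>\<^sub>0) \<bullet> (A *v (v - g)) \<le> r} \<subseteq> (\<lambda>p. \<eta>\<^sub>0 + (r *\<^sub>R B) *v p) ` ?P"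
    proof
      fix \<eta> assume \<eta>: "\<eta> \<in> {\<eta>. \<forall>v\<in>K. (\<eta> - \<eta>\<^sub>0) \<bullet> (A *v (v - g)) \<le> r}"
      define p where "p = (1 / r) *\<^sub>R (transpose A *v (\<eta> - \<eta>\<^sub>0))"
      have "p \<bullet> (v - g) = ((\<eta> - \<eta>\<^sub>0) \<bullet> (A *v (v - g))) / r" for v
        unfolding p_def by (simp add: dot_lmul_matrix)
      then have "p \<in> ?P" using \<eta> r by simp
      moreover have "(r *\<^sub>R B) *v p = B *v (r *\<^sub>R p)"
        by (simp only: scaleR_matrix_vector_assoc[symmetric] matrix_vector_mult_scaleR)
      then have "(r *\<^sub>R B) *v p = B *v (transpose A *v (\<eta> - \<eta>\<^sub>0))" using r by (simp add: p_def)
      then have "(r *\<^sub>R B) *v p = \<eta> - \<eta>\<^sub>0" unfolding matrix_vector_mul_assoc B by simp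
      then have "\<eta> = \<eta>\<^sub>0 + (r *\<^sub>R B) *v p" by simp
      ultimately show "\<eta> \<in> (\<lambda>p. \<eta>\<^sub>0 + (r *\<^sub>R B) *v p) ` ?P" by blast
    qed
    then have "emeasure lborel {\<eta>. \<forall>v\<in>K. (\<eta> - \<eta>\<^sub>0) \<bullet> (A *v (v - g)) \<le> r}
        \<le> ennreal (r ^ CARD('n) / \<bar>det A\<bar>) * emeasure lborel ?P"
      unfolding im(2)[symmetric] by (rule emeasure_mono) (simp only: sets_lborel im(1))
    then have "emeasure lborel K * emeasure lborel {\<eta>. \<forall>v\<in>K. (\<eta> - \<eta>\<^sub>0) \<bullet> (A *v (v - g)) \<le> r}
        \<le> emeasure lborel K * (ennreal (r ^ CARD('n) / \<bar>det A\<bar>) * emeasure lborel ?P)"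
      by (rule mult_left_mono) simp
    also have "\<dots> = ennreal (r ^ CARD('n) / \<bar>det A\<bar>) * (emeasure lborel K * emeasure lborel ?P)"
      by (simp only: mult_ac)
    also have "\<dots> \<le> ennreal (r ^ CARD('n) / \<bar>det A\<bar>) * ennreal ?b" by (rule mult_left_mono[OF g(2)]) simp
    also have "\<dots> = ennreal (r ^ CARD('n) / \<bar>det A\<bar> * ?b)"
      by (rule ennreal_mult[symmetric]) (use r in simp_all)
    finally show ?thesis .
  qed
  then show thesis by (rule that[OF g(1)])
qed

text \<open>The hypothesis bounds the difference quotients from the right by the chord slope, and
  the bound passes to the limit.\<close>

lemma DERIV_le_chord:
  fixes m :: "real \<Rightarrow> real"
  assumes D: "(m has_real_derivative D) (at 0)"
    and le: "\<And>t. t \<in> {0..1} \<Longrightarrow> m t \<le> (1 - t) * m 0 + t * m 1"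
  shows "D \<le> m 1 - m 0"
proof -
  have "((\<lambda>t. (m t - m 0) / (t - 0)) \<longlongrightarrow> D) (at 0)"
    using D by (simp only: has_field_derivative_iff)
  then have lim: "((\<lambda>t. (m t - m 0) / t) \<longlongrightarrow> D) (at_right 0)"
    by (simp add: tendsto_within_subset[OF _ subset_UNIV])
  have "\<forall>\<^sub>F t in at_right (0::real). t \<in> {0<..<1}"
    by (rule eventually_at_right_real) simp
  then have "\<forall>\<^sub>F t in at_right 0. (m t - m 0) / t \<le> m 1 - m 0"
  proof (rule eventually_mono)
    fix t :: real assume t: "t \<in> {0<..<1}"
    then have "m t - m 0 \<le> t * (m 1 - m 0)" using le[of t] by (simp add: algebra_simps)
    then show "(m t - m 0) / t \<le> m 1 - m 0" using t by (simp add: divide_le_eq mult.commute)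
  qed
  then show ?thesis by (rule tendsto_upperbound[OF lim]) simp
qed

text \<open>The supporting inequality at \<open>Q x\<close>, in direction \<open>v - Q x\<close>,
  for the convex function \<open>-c(., xb) + c(., xb0)\<close> read in the coordinates
  \<open>Q\<close>. The chain rule writes its derivative as a difference of covectors at
  \<open>x\<close> composed with the derivative \<open>L\<close> of \<open>\<psi>\<close>.\<close>

lemma neg_D_difference_le:
  fixes M :: "('a::{t2_space, second_countable_topology}, 'n::finite) riem"
    and N :: "('b::{t2_space, second_countable_topology}, 'n) riem"
  assumes M: "riemannian_manifold M" and N: "riemannian_manifold N"
    and tw: "twist_half N M (cbar c)" and dasm: "convex_DASM_half N M (cbar c)"
    and dc: "domain_convexity_half N M (cbar c)"
    and x: "x \<notin> c_cut N M (cbar c) xb0" and xb: "xb \<notin> c_cut M N c x"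
  defines "Q \<equiv> neg_D N (cbar c) xb0"
  defines "\<psi> \<equiv> inv_into (- c_cut N M (cbar c) xb0) Q"
  assumes L: "((snd (chart_at (atlas M) x) \<circ> \<psi>) has_derivative L) (at (Q x))"
    and v: "v \<in> dual_dom N M (cbar c) xb0"
  shows "(neg_D M c x xb - neg_D M c x xb0) \<bullet> L (v - Q x)
    \<le> (- c (\<psi> v) xb + c (\<psi> v) xb0) - (- c x xb + c x xb0)"
proof -
  note A = smooth_atlas_riem[OF M] and B = smooth_atlas_riem[OF N]
  let ?k = "chart_at (atlas M) x" and ?U = "- c_cut N M (cbar c) xb0" and ?g = "Q x"
  let ?\<eta> = "neg_D M c x xb" and ?\<zeta> = "neg_D M c x xb0"
  define \<alpha> where "\<alpha> = (\<lambda>y. - c y xb + c y xb0)"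
  note emb = twist_half_embedding[OF tw, of xb0, folded Q_def]
  have xU: "x \<in> ?U" using x by simp
  have inv: "\<psi> (Q y) = y" if "y \<in> ?U" for y
    unfolding \<psi>_def by (rule inv_into_f_f[OF embedding_inj_on[OF M open_compl_c_cut emb] that])
  have d1: "((\<lambda>y. c y xb) \<circ> chart_inv ?k has_derivative (\<lambda>u. differential (atlas M) (\<lambda>y. c y xb) x \<bullet> u)) (at (snd ?k x))"
    by (rule has_derivative_differential[OF cost_differentiable(1)[OF A B xb]])
  \<comment> \<open>Smoothness near \<open>(x, xb0)\<close> is known through the cut locus of
    \<open>xb0\<close> inside \<open>M\<close>, so the two variables are exchanged here.\<close>
  have "cbar c xb0 = (\<lambda>y. c y xb0)" by (simp add: cbar_def)
  then have d2: "((\<lambda>y. c y xb0) \<circ> chart_inv ?k has_derivative (\<lambda>u. differential (atlas M) (\<lambda>y. c y xb0) x \<bullet> u)) (at (snd ?k x))"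
    using has_derivative_differential[OF cost_differentiable(2)[OF B A x]] by (simp only:)
  have "((\<lambda>z. - ((\<lambda>y. c y xb) \<circ> chart_inv ?k) z + ((\<lambda>y. c y xb0) \<circ> chart_inv ?k) z) has_derivative
      (\<lambda>u. - (differential (atlas M) (\<lambda>y. c y xb) x \<bullet> u) + differential (atlas M) (\<lambda>y. c y xb0) x \<bullet> u)) (at (snd ?k x))"
    by (intro has_derivative_add has_derivative_minus d1 d2)
  moreover have "(\<lambda>z. - ((\<lambda>y. c y xb) \<circ> chart_inv ?k) z + ((\<lambda>y. c y xb0) \<circ> chart_inv ?k) z) = \<alpha> \<circ> chart_inv ?k"
    by (simp add: \<alpha>_def fun_eq_iff)
  moreover have "(\<lambda>u. - (differential (atlas M) (\<lambda>y. c y xb) x \<bullet> u) + differential (atlas M) (\<lambda>y. c y xb0) x \<bullet> u)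
      = (\<lambda>u. (?\<eta> - ?\<zeta>) \<bullet> u)"
    by (simp add: neg_D_def fun_eq_iff inner_diff_left)
  ultimately have "((\<alpha> \<circ> chart_inv ?k) has_derivative (\<lambda>u. (?\<eta> - ?\<zeta>) \<bullet> u)) (at (snd ?k x))" by (simp only:)
  moreover have "(snd ?k \<circ> \<psi>) ?g = snd ?k x" by (simp add: inv[OF xU])
  ultimately have "((\<alpha> \<circ> chart_inv ?k) \<circ> (snd ?k \<circ> \<psi>) has_derivative (\<lambda>u. (?\<eta> - ?\<zeta>) \<bullet> u) \<circ> L) (at ?g)"
    by (intro diff_chain_at[OF L]) (simp only:)
  then have d3: "((\<alpha> \<circ> \<psi>) has_derivative (\<lambda>u. (?\<eta> - ?\<zeta>) \<bullet> u) \<circ> L) (at ?g)"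
  proof (rule has_derivative_transform_within_open)
    have Uk: "open (?U \<inter> fst ?k)"
      by (rule open_Int[OF open_compl_c_cut open_chart_domain[OF A chart_at(1)[OF A]]])
    show "open (Q ` (?U \<inter> fst ?k))"
      by (rule embedding_open_image[OF M open_compl_c_cut emb Uk]) blast
    show "?g \<in> Q ` (?U \<inter> fst ?k)" using xU chart_at(2)[OF A] by blast
    fix q assume "q \<in> Q ` (?U \<inter> fst ?k)"
    then obtain y where y: "y \<in> ?U" "y \<in> fst ?k" "q = Q y" by blast
    show "((\<alpha> \<circ> chart_inv ?k) \<circ> (snd ?k \<circ> \<psi>)) q = (\<alpha> \<circ> \<psi>) q"
      unfolding y(3) o_apply inv[OF y(1)] chart_inv_chart[OF A chart_at(1)[OF A] y(2)] ..
  qed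
  define m where "m t = \<alpha> (\<psi> (?g + t *\<^sub>R (v - ?g)))" for t :: real
  have "((\<lambda>t. ?g + t *\<^sub>R (v - ?g)) has_derivative (\<lambda>t. t *\<^sub>R (v - ?g))) (at 0)"
    by (auto intro!: derivative_eq_intros)
  moreover have "((\<alpha> \<circ> \<psi>) has_derivative (\<lambda>u. (?\<eta> - ?\<zeta>) \<bullet> u) \<circ> L) (at (?g + 0 *\<^sub>R (v - ?g)))"
    using d3 by simp
  ultimately have "((\<alpha> \<circ> \<psi>) \<circ> (\<lambda>t. ?g + t *\<^sub>R (v - ?g)) has_derivative
      ((\<lambda>u. (?\<eta> - ?\<zeta>) \<bullet> u) \<circ> L) \<circ> (\<lambda>t. t *\<^sub>R (v - ?g))) (at 0)"
    by (rule diff_chain_at)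
  moreover have "((\<lambda>u. (?\<eta> - ?\<zeta>) \<bullet> u) \<circ> L) \<circ> (\<lambda>t. t *\<^sub>R (v - ?g)) = (*) ((?\<eta> - ?\<zeta>) \<bullet> L (v - ?g))"
    by (simp add: fun_eq_iff linear_scale[OF has_derivative_linear[OF L]])
  moreover have "(\<alpha> \<circ> \<psi>) \<circ> (\<lambda>t. ?g + t *\<^sub>R (v - ?g)) = m" by (simp add: fun_eq_iff m_def)
  ultimately have "(m has_real_derivative (?\<eta> - ?\<zeta>) \<bullet> L (v - ?g)) (at 0)"
    by (simp only: has_field_derivative_def)
  then have "(?\<eta> - ?\<zeta>) \<bullet> L (v - ?g) \<le> m 1 - m 0"
  proof (rule DERIV_le_chord)
    fix t :: real assume t: "t \<in> {0..1}"
    have gd: "?g \<in> dual_dom N M (cbar c) xb0" unfolding dual_dom_def Q_def using xU by blast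
    have "?g + t *\<^sub>R (v - ?g) = (1 - t) *\<^sub>R ?g + t *\<^sub>R v" by (simp add: algebra_simps)
    then show "m t \<le> (1 - t) * m 0 + t * m 1"
      using cost_difference_convex[OF dasm dc gd v t, of xb, folded Q_def, folded \<psi>_def]
      by (simp add: m_def \<alpha>_def cbar_def)
  qed
  then show ?thesis by (simp add: m_def \<alpha>_def inv[OF xU])
qed

section \<open>Sections of c-convex functions\<close>

lemma vol_eq_emeasure:
  assumes "riemannian_manifold M" "S \<in> sets borel"
  shows "vol M S = emeasure (riem_measure M) S"
  using assms by (simp add: vol_def sets_riem_measure)

text \<open>Tailored to images under the c-subdifferential. For a nonmeasurable \<open>S\<close> the
  left side is 0 by the convention of \<open>emeasure\<close>; measurability is asked of the
  covering set.\<close>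

lemma vol_le_emeasure:
  assumes M: "riemannian_manifold M" and S: "S \<subseteq> T" "T \<in> sets borel"
  shows "vol M S \<le> emeasure (riem_measure M) T"
proof -
  have T: "T \<in> sets (riem_measure M)" using S(2) by (simp only: sets_riem_measure[OF M])
  have "vol M S \<le> emeasure (completion (riem_measure M)) T"
    unfolding vol_def by (rule emeasure_mono[OF S(1)]) (rule sets_completionI_sets[OF T])
  also have "\<dots> = emeasure (riem_measure M) T"
    using vol_eq_emeasure[OF M S(2)] by (simp only: vol_def)
  finally show ?thesis .
qed

lemma borel_continuous_preimage:
  assumes "open V" "continuous_on V f" "closed P"
  shows "V \<inter> f -` P \<in> sets borel"
proof -
  have "closedin (top_of_set V) (V \<inter> f -` P)" by (rule continuous_closedin_preimage[OF assms(2,3)])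
  then obtain T where "closed T" "V \<inter> f -` P = V \<inter> T" unfolding closedin_closed by blast
  then show ?thesis using borel_open[OF assms(1)] borel_closed[of T] by (simp only: sets.Int)
qed

text \<open>By duality \<open>\<phi> + c(., xb0)\<close> is the supremum over \<open>xb\<close> of
  the functions \<open>-c(., xb) + c(., xb0) - \<phi>b xb\<close>. In the coordinates they are
  convex, so is the supremum, and \<open>Z\<close> is one of its sublevel sets.\<close>

lemma section_convex:
  fixes M :: "('a::{t2_space, second_countable_topology}, 'n::finite) riem"
    and N :: "('b::{t2_space, second_countable_topology}, 'n) riem"
  assumes M: "riemannian_manifold M" and tw: "twist_half N M (cbar c)" and dasm: "convex_DASM_half N M (cbar c)"
    and dc: "domain_convexity_half N M (cbar c)" and cc: "c_convex c \<phi>"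
    and Z: "Z = section_set c \<phi> x0 xb0 h" "Z \<subseteq> - c_cut N M (cbar c) xb0"
  shows "convex (neg_D N (cbar c) xb0 ` Z)"
proof -
  define Q where "Q = neg_D N (cbar c) xb0"
  define \<psi> where "\<psi> = inv_into (- c_cut N M (cbar c) xb0) Q"
  note emb = twist_half_embedding[OF tw, of xb0, folded Q_def]
  have inv: "\<psi> (Q y) = y" if "y \<in> - c_cut N M (cbar c) xb0" for y
    unfolding \<psi>_def by (rule inv_into_f_f[OF embedding_inj_on[OF M open_compl_c_cut emb] that])
  obtain \<phi>b where "c_dual c \<phi> \<phi>b" using cc unfolding c_convex_def by blast
  then have sup: "ereal (\<phi> x) = (SUP xb. ereal (- c x xb - \<phi>b xb))" for x
    unfolding c_dual_def by blast
  have ge: "- c x xb - \<phi>b xb \<le> \<phi> x" for x xb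
  proof -
    have "ereal (- c x xb - \<phi>b xb) \<le> ereal (\<phi> x)" unfolding sup by (rule SUP_upper) simp
    then show ?thesis by simp
  qed
  have "convex (Q ` Z)"
    unfolding convex_alt
  proof (intro ballI allI impI)
    fix p q and t :: real
    assume "p \<in> Q ` Z" "q \<in> Q ` Z" and t: "0 \<le> t \<and> t \<le> 1"
    then obtain x1 x2 where x: "x1 \<in> Z" "x2 \<in> Z" "p = Q x1" "q = Q x2" by blast
    have xU: "x1 \<in> - c_cut N M (cbar c) xb0" "x2 \<in> - c_cut N M (cbar c) xb0" using x Z(2) by blast+
    have pq: "p \<in> dual_dom N M (cbar c) xb0" "q \<in> dual_dom N M (cbar c) xb0"
      unfolding dual_dom_def Q_def[symmetric] x(3,4) using xU by blast+
    let ?r = "(1 - t) *\<^sub>R p + t *\<^sub>R q"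
    have r: "?r \<in> dual_dom N M (cbar c) xb0"
      using dc pq t unfolding domain_convexity_half_def by (intro convexD) auto
    then obtain y where y: "y \<in> - c_cut N M (cbar c) xb0" "?r = Q y" unfolding dual_dom_def Q_def by blast
    let ?h = "\<phi> x0 + c x0 xb0 + h"
    have Zx: "\<phi> x1 + c x1 xb0 \<le> ?h" "\<phi> x2 + c x2 xb0 \<le> ?h"
      using x(1,2) unfolding Z(1) section_set_def by auto
    have "- c y xb - \<phi>b xb \<le> ?h - c y xb0" for xb
    proof -
      have "- c y xb + c y xb0 \<le> (1 - t) * (- c x1 xb + c x1 xb0) + t * (- c x2 xb + c x2 xb0)"
        using cost_difference_convex[OF dasm dc pq, of t xb, folded Q_def, folded \<psi>_def] t
        unfolding y(2) unfolding x(3,4) inv[OF y(1)] inv[OF xU(1)] inv[OF xU(2)] cbar_def by simp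
      also have "\<dots> \<le> (1 - t) * (?h + \<phi>b xb) + t * (?h + \<phi>b xb)"
      proof (rule add_mono[OF mult_left_mono mult_left_mono])
        show "- c x1 xb + c x1 xb0 \<le> ?h + \<phi>b xb" "- c x2 xb + c x2 xb0 \<le> ?h + \<phi>b xb"
          using Zx ge[of x1 xb] ge[of x2 xb] by linarith+
      qed (use t in auto)
      also have "\<dots> = ?h + \<phi>b xb" by (simp add: algebra_simps)
      finally show ?thesis by simp
    qed
    then have "ereal (\<phi> y) \<le> ereal (?h - c y xb0)" unfolding sup by (intro SUP_least) simp
    then have "y \<in> Z" unfolding Z(1) section_set_def by simp
    then show "?r \<in> Q ` Z" unfolding y(2) by blast
  qed
  then show ?thesis by (simp only: Q_def)
qed

text \<open>The letters are volumes: \<open>k\<close> of \<open>K\<close>, \<open>p\<close> of the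
  body of covectors, \<open>s\<close> of the set of points mapped into it, \<open>a\<close> and
  \<open>y\<close> of the parts of the section over the half-sized copy and over \<open>K\<close>;
  \<open>\<gamma>\<close> and \<open>\<rho>\<close> are metric densities. By \<open>5\<close> it
  suffices to bound \<open>k\<^sup>2\<close>: one factor passes to \<open>a\<close> by
  \<open>4\<close> and on to \<open>p\<close> by \<open>1\<close> and \<open>2\<close>, and its
  product with the other factor is bounded by \<open>3\<close>.\<close>

lemma volume_chain_arith:
  fixes lam Mx mn \<gamma> \<rho> D h nb a k p s y :: real
  assumes pos: "lam > 0" "mn > 0" "\<gamma> > 0" "\<rho> > 0" "D > 0" "Mx \<ge> 0" "k \<ge> 0" "a \<ge> 0" "y \<ge> 0"
    and 1: "lam * a \<le> s" and 2: "\<rho> / D * s \<le> p"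
    and 3: "k * p \<le> (2 * h) ^ n * (Mx * \<rho> * \<gamma>) * nb"
    and 4: "(1 / 2) ^ n * k \<le> Mx * \<gamma> * a" and 5: "mn * \<gamma> * y \<le> k"
  shows "lam * y\<^sup>2 \<le> 4 ^ n * nb * (Mx / mn)\<^sup>2 * D * h ^ n"
proof -
  have k: "k \<le> 2 ^ n * (Mx * \<gamma> * a)"
    using 4 by (simp add: power_one_over field_simps)
  have s: "s \<le> p * D / \<rho>" using 2 pos by (simp add: field_simps)
  have "lam * (mn * \<gamma> * y)\<^sup>2 \<le> lam * k\<^sup>2"
    using pos 5 by (intro mult_left_mono power_mono) auto
  also have "\<dots> = lam * k * k" by (simp add: power2_eq_square)
  also have "\<dots> \<le> lam * k * (2 ^ n * (Mx * \<gamma> * a))" using pos k by (intro mult_left_mono) auto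
  also have "\<dots> = 2 ^ n * Mx * \<gamma> * k * (lam * a)" by (simp add: mult_ac)
  also have "\<dots> \<le> 2 ^ n * Mx * \<gamma> * k * (p * D / \<rho>)"
    using pos 1 s by (intro mult_left_mono) auto
  also have "\<dots> = 2 ^ n * Mx * \<gamma> * D / \<rho> * (k * p)" by (simp add: mult_ac)
  also have "\<dots> \<le> 2 ^ n * Mx * \<gamma> * D / \<rho> * ((2 * h) ^ n * (Mx * \<rho> * \<gamma>) * nb)"
    using pos 3 by (intro mult_left_mono) auto
  also have "\<dots> = 2 ^ n * (2 ^ n * h ^ n) * (Mx\<^sup>2 * \<gamma>\<^sup>2) * D * nb"
    using pos by (simp add: power_mult_distrib power2_eq_square)
  also have "\<dots> = (mn * \<gamma>)\<^sup>2 * (4 ^ n * nb * (Mx / mn)\<^sup>2 * D * h ^ n)"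
  proof -
    have "(2::real) ^ n * 2 ^ n = 4 ^ n" by (simp flip: power_mult_distrib)
    moreover have "Mx\<^sup>2 * \<gamma>\<^sup>2 = (mn * \<gamma>)\<^sup>2 * (Mx / mn)\<^sup>2" using pos by (simp add: power_mult_distrib power_divide)
    ultimately show ?thesis by (simp only: mult_ac)
  qed
  finally have "(mn * \<gamma>)\<^sup>2 * (lam * y\<^sup>2) \<le> (mn * \<gamma>)\<^sup>2 * (4 ^ n * nb * (Mx / mn)\<^sup>2 * D * h ^ n)"
    by (simp add: power_mult_distrib mult_ac)
  then show ?thesis using pos by (simp add: mult_le_cancel_left_pos)
qed

text \<open>Finiteness spreads from \<open>k\<close>: if \<open>k\<close> is nonzero, then
  \<open>3\<close>, \<open>2\<close> and \<open>1\<close> make \<open>p\<close>, \<open>s\<close>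
  and \<open>a\<close> finite in turn, and \<open>5\<close> makes \<open>y\<close> finite, so the
  computation is one in the reals. If \<open>k = 0\<close>, then \<open>y = 0\<close> by
  \<open>5\<close>.\<close>

lemma volume_chain_arith_ennreal:
  fixes lam Mx mn \<gamma> \<rho> D h nb :: real and a k p s y :: ennreal
  assumes pos: "lam > 0" "mn > 0" "\<gamma> > 0" "\<rho> > 0" "D > 0" "Mx \<ge> 0" "h > 0" "nb \<ge> 0" and kfin: "k \<noteq> \<infinity>"
    and 1: "ennreal lam * a \<le> s" and 2: "ennreal (\<rho> / D) * s \<le> p"
    and 3: "k * p \<le> ennreal ((2 * h) ^ n * (Mx * \<rho> * \<gamma>) * nb)"
    and 4: "ennreal ((1 / 2) ^ n) * k \<le> ennreal (Mx * \<gamma>) * a" and 5: "ennreal (mn * \<gamma>) * y \<le> k"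
  shows "ennreal lam * y\<^sup>2 \<le> ennreal (4 ^ n * nb * (Mx / mn)\<^sup>2 * D * h ^ n)"
proof (cases "k = 0")
  case True
  then have "y = 0" using 5 pos by simp
  then show ?thesis by simp
next
  case False
  obtain k' where k': "k = ennreal k'" "k' \<ge> 0" using kfin by (cases k) auto
  have "p \<noteq> \<infinity>" using 3 False by (auto simp: ennreal_mult_top top_unique)
  then obtain p' where p': "p = ennreal p'" "p' \<ge> 0" by (cases p) auto
  have "s \<noteq> \<infinity>" using 2 pos p' by (auto simp: ennreal_mult_top top_unique)
  then obtain s' where s': "s = ennreal s'" "s' \<ge> 0" by (cases s) auto
  have "a \<noteq> \<infinity>" using 1 pos s' by (auto simp: ennreal_mult_top top_unique)
  then obtain a' where a': "a = ennreal a'" "a' \<ge> 0" by (cases a) auto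
  have "y \<noteq> \<infinity>" using 5 pos k' by (auto simp: ennreal_mult_top top_unique)
  then obtain y' where y': "y = ennreal y'" "y' \<ge> 0" by (cases y) auto
  have "lam * y'\<^sup>2 \<le> 4 ^ n * nb * (Mx / mn)\<^sup>2 * D * h ^ n"
  proof (rule volume_chain_arith[where \<gamma> = \<gamma> and \<rho> = \<rho> and k = k' and p = p' and s = s' and a = a'])
    show "lam * a' \<le> s'" using 1 pos s' a' by (simp add: ennreal_mult[symmetric])
    show "\<rho> / D * s' \<le> p'" using 2 pos s' p' by (simp add: ennreal_mult[symmetric])
    show "k' * p' \<le> (2 * h) ^ n * (Mx * \<rho> * \<gamma>) * nb"
      using 3 unfolding k'(1) p'(1) ennreal_mult[OF k'(2) p'(2), symmetric] using pos by (subst (asm) ennreal_le_iff) auto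
    show "(1 / 2) ^ n * k' \<le> Mx * \<gamma> * a'"
    proof -
      have "0 \<le> (1 / 2 :: real) ^ n" "0 \<le> Mx * \<gamma>" "0 \<le> Mx * \<gamma> * a'" using pos a' by auto
      then show ?thesis
        using 4 unfolding k'(1) a'(1) by (simp only: ennreal_mult[symmetric] k'(2) a'(2) ennreal_le_iff)
    qed
    show "mn * \<gamma> * y' \<le> k'"
      using 5 unfolding k'(1) y'(1) using pos k' y' by (simp add: ennreal_mult[symmetric])
  qed (use pos k' a' y' in auto)
  moreover have "ennreal lam * y\<^sup>2 = ennreal (lam * y'\<^sup>2)"
    unfolding y'(1) using pos y' by (simp add: ennreal_power ennreal_mult)
  ultimately show ?thesis by (simp only: ennreal_leI)
qed

lemma compact_section_estimate:
  fixes M :: "('a::{t2_space, second_countable_topology}, 'n::finite) riem"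
    and N :: "('b::{t2_space, second_countable_topology}, 'n) riem"
  assumes M: "riemannian_manifold M" and N: "riemannian_manifold N"
    and tw: "twist M N c" and ce: "c_exp_half M N c" and dc: "domain_convexity M N c"
    and dasm: "convex_DASM_half N M (cbar c)"
    and lam: "lam > 0"
    and vol: "\<And>\<Omega>. \<Omega> \<in> sets borel \<Longrightarrow> ennreal lam * vol M \<Omega> \<le> vol N (\<Union>x\<in>\<Omega>. c_subdiff c \<phi> x)"
    and xb0: "xb0 \<in> c_subdiff c \<phi> x0" and h: "h > 0"
    and Z: "Z = section_set c \<phi> x0 xb0 h" "Z \<subseteq> - c_cut N M (cbar c) xb0"
    and bounds: "mn > 0" "D > 0" "\<And>x. x \<in> Z \<Longrightarrow> mn \<le> \<bar>det_mixed M N c x xb0\<bar>"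
      "\<And>x. x \<in> Z \<Longrightarrow> \<bar>det_mixed M N c x xb0\<bar> \<le> Mx"
      "\<And>x p. x \<in> Z \<Longrightarrow> p \<in> dual_dom M N c x \<Longrightarrow> \<bar>det_d_c_Exp M N c x p\<bar> \<le> D"
  defines "Q \<equiv> neg_D N (cbar c) xb0"
  defines "\<psi> \<equiv> inv_into (- c_cut N M (cbar c) xb0) Q"
  assumes K: "compact K" "convex K" "K \<subseteq> Q ` Z"
  shows "\<psi> ` K \<in> sets borel"
    and "ennreal lam * (emeasure (riem_measure M) (\<psi> ` K))\<^sup>2
      \<le> ennreal (4 ^ CARD('n) * (real CARD('n) ^ CARD('n) * (measure lborel (ball (0 :: real^'n) 1))\<^sup>2)
          * (Mx / mn)\<^sup>2 * D * h ^ CARD('n))"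
proof -
  let ?U = "- c_cut N M (cbar c) xb0" and ?\<mu> = "riem_measure M" and ?\<nu> = "riem_measure N"
  define nb where "nb = real CARD('n) ^ CARD('n) * (measure lborel (ball (0 :: real^'n) 1))\<^sup>2"
  have tw1: "twist_half M N c" and tw2: "twist_half N M (cbar c)" using tw by (auto simp: twist_def)
  have dc1: "domain_convexity_half M N c" and dc2: "domain_convexity_half N M (cbar c)"
    using dc by (auto simp: domain_convexity_def)
  note emb = twist_half_embedding[OF tw2, of xb0, folded Q_def]
  have inv: "\<psi> (Q y) = y" if "y \<in> ?U" for y
    unfolding \<psi>_def by (rule inv_into_f_f[OF embedding_inj_on[OF M open_compl_c_cut emb] that])
  have \<psi>Z: "\<psi> q \<in> Z" "Q (\<psi> q) = q" if q: "q \<in> Q ` Z" for q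
  proof -
    obtain y where y: "y \<in> Z" "q = Q y" using q by blast
    then have "\<psi> q = y" using inv Z(2) by blast
    then show "\<psi> q \<in> Z" "Q (\<psi> q) = q" using y by simp_all
  qed
  have QZ: "Q ` Z \<subseteq> Q ` ?U" using Z(2) by blast
  have cont: "continuous_on (Q ` ?U) \<psi>"
    unfolding \<psi>_def by (rule homeomorphism_cont2[OF embedding_inv_into_homeomorphism[OF emb]])
  have pre: "\<psi> ` K' \<in> sets borel" "\<psi> ` K' \<subseteq> ?U" "Q ` \<psi> ` K' = K'"
    if K': "compact K'" "K' \<subseteq> Q ` Z" for K'
  proof -
    have "compact (\<psi> ` K')"
      by (rule compact_continuous_image[OF continuous_on_subset[OF cont] K'(1)]) (use K'(2) QZ in blast)
    then show "\<psi> ` K' \<in> sets borel" by (rule borel_compact)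
    show "\<psi> ` K' \<subseteq> ?U" using \<psi>Z(1) K'(2) Z(2) by blast
    have "Q (\<psi> q) = q" if "q \<in> K'" for q using \<psi>Z(2) K'(2) that by blast
    then show "Q ` \<psi> ` K' = K'" unfolding image_image by simp
  qed
  show "\<psi> ` K \<in> sets borel" by (rule pre(1)[OF K(1,3)])
  show "ennreal lam * (emeasure ?\<mu> (\<psi> ` K))\<^sup>2 \<le> ennreal (4 ^ CARD('n) * (real CARD('n) ^ CARD('n) * (measure lborel (ball (0 :: real^'n) 1))\<^sup>2) * (Mx / mn)\<^sup>2 * D * h ^ CARD('n))"
  proof (cases "K = {}")
    case True
    then show ?thesis by simp
  next
    case False
    obtain g where g: "g \<in> K" and polar: "\<And>A \<eta>\<^sub>0 r. det A \<noteq> 0 \<Longrightarrow> r > 0 \<Longrightarrow>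
      emeasure lborel K * emeasure lborel {\<eta>. \<forall>v\<in>K. (\<eta> - \<eta>\<^sub>0) \<bullet> (A *v (v - g)) \<le> r}
      \<le> ennreal (r ^ CARD('n) / \<bar>det A\<bar> * nb)"
      unfolding nb_def
    proof (rule volume_times_affine_polar_volume_le[OF K(1,2) False], goal_cases)
      case (1 g)
      show ?case by (rule 1(1)[OF 1(2,3)])
    qed
    define xc where "xc = \<psi> g"
    have gZ: "g \<in> Q ` Z" using g K(3) by blast
    have xc: "xc \<in> Z" "xc \<in> ?U" "Q xc = g" using \<psi>Z[OF gZ] Z(2) by (auto simp: xc_def)
    have xc': "xc \<notin> c_cut N M (cbar c) xb0" using xc(2) by simp
    define \<gamma> where "\<gamma> = metric_density N xb0"
    define \<rho> where "\<rho> = metric_density M xc"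
    have pos: "\<gamma> > 0" "\<rho> > 0" using metric_density_pos[OF N] metric_density_pos[OF M] by (simp_all add: \<gamma>_def \<rho>_def)
    have Mx: "Mx > 0" using bounds(1) bounds(3,4)[OF xc(1)] by linarith
    let ?T = "tangent_map (atlas M) euclidean_atlas Q"
    have det_T: "\<bar>det (matrix (?T x))\<bar> = \<bar>det_mixed M N c x xb0\<bar> * metric_density M x * \<gamma>" if "x \<in> Z" for x
      unfolding Q_def \<gamma>_def using that Z(2) by (intro abs_det_mixed[OF M N tw2]) auto
    obtain L where L: "linear L" "L \<circ> ?T xc = id" "?T xc \<circ> L = id"
      "((snd (chart_at (atlas M) xc) \<circ> \<psi>) has_derivative L) (at (Q xc))"
      unfolding \<psi>_def by (rule embedding_inverse_derivative[OF M open_compl_c_cut emb xc(2)])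
    \<comment> \<open>\<open>A\<close> carries displacements \<open>v - g\<close> in the coordinates
      to tangent vectors at \<open>xc\<close>, on which covectors act. Its reciprocal determinant is
      the mixed determinant at \<open>xc\<close> up to densities.\<close>
    define A where "A = matrix L"
    have LA: "L u = A *v u" for u unfolding A_def by (rule matrix_of_linear_works[OF L(1), symmetric])
    have "A ** matrix (?T xc) = mat 1"
      using matrix_compose[OF linear_tangent_map[OF smooth_atlas_riem[OF M] embedding_smooth[OF M open_compl_c_cut emb] xc(2)] L(1)] L(2)
      by (simp add: A_def matrix_id_mat_1)
    then have dA: "det A * det (matrix (?T xc)) = 1" by (metis det_I det_mul)
    then have dA0: "det A \<noteq> 0" by auto
    have "\<bar>det A\<bar> * \<bar>det (matrix (?T xc))\<bar> = 1" using dA by (metis abs_mult abs_one)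
    then have "1 / \<bar>det A\<bar> = \<bar>det (matrix (?T xc))\<bar>" using dA0 by (simp add: field_simps)
    also have "\<dots> \<le> Mx * \<rho> * \<gamma>"
      unfolding det_T[OF xc(1)] \<rho>_def[symmetric] using bounds(4)[OF xc(1)] pos by (intro mult_right_mono) auto
    finally have invA: "1 / \<bar>det A\<bar> \<le> Mx * \<rho> * \<gamma>" .
    let ?f = "neg_D M c xc" and ?V = "- c_cut M N c xc"
    note emb1 = twist_half_embedding[OF tw1, of xc]
    \<comment> \<open>Of the \<open>2 * h\<close>, one \<open>h\<close> is the height of the section
      and the other comes from comparing the midpoint with \<open>xc\<close>.\<close>
    define P where "P = {\<eta>. \<forall>v\<in>K. (\<eta> - ?f xb0) \<bullet> (A *v (v - g)) \<le> 2 * h}"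
    have "closed (\<Inter>v\<in>K. {\<eta>. (\<eta> - ?f xb0) \<bullet> (A *v (v - g)) \<le> 2 * h})"
      by (intro closed_INT ballI closed_Collect_le continuous_intros)
    moreover have "(\<Inter>v\<in>K. {\<eta>. (\<eta> - ?f xb0) \<bullet> (A *v (v - g)) \<le> 2 * h}) = P" unfolding P_def by blast
    ultimately have P: "closed P" by (simp only:)
    define S where "S = ?V \<inter> ?f -` P"
    have S: "S \<in> sets borel"
      unfolding S_def
      by (rule borel_continuous_preimage[OF open_compl_c_cut smooth_map_euclideanD(1)[OF embedding_smooth[OF N open_compl_c_cut emb1]] P])
    \<comment> \<open>The scaled identity matrix is written out so that
      \<open>emeasure_affine_image\<close> gives the volume.\<close>
    define Kh where "Kh = (\<lambda>w. (1 / 2) *\<^sub>R g + ((1 / 2) *\<^sub>R mat 1 :: real^'n^'n) *v w) ` K"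
    have half: "((1 / 2) *\<^sub>R mat 1 :: real^'n^'n) *v w = (1 / 2) *\<^sub>R w" for w
      by (simp add: scaleR_matrix_vector_assoc[symmetric])
    have Kh_sub: "Kh \<subseteq> K"
      unfolding Kh_def half using convexD[OF K(2) g, of _ "1 / 2" "1 / 2"] by auto
    have KhZ: "Kh \<subseteq> Q ` Z" using Kh_sub K(3) by blast
    have Kh: "compact Kh" unfolding Kh_def half by (intro compact_continuous_image continuous_intros K(1))
    have vol_Kh: "emeasure lborel Kh = ennreal ((1 / 2) ^ CARD('n)) * emeasure lborel K"
    proof -
      have "det ((1 / 2) *\<^sub>R mat 1 :: real^'n^'n) = (1 / 2) ^ CARD('n)" by (simp add: det_scaleR)
      then show ?thesis
        unfolding Kh_def
        using emeasure_affine_image(2)[of "(1 / 2) *\<^sub>R mat 1 :: real^'n^'n" K "(1 / 2) *\<^sub>R g"] borel_compact[OF K(1)] by simp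
    qed
    have sub: "(\<Union>x\<in>\<psi> ` Kh. c_subdiff c \<phi> x) \<subseteq> S \<union> c_cut M N c xc"
    proof
      fix xb assume "xb \<in> (\<Union>x\<in>\<psi> ` Kh. c_subdiff c \<phi> x)"
      then obtain w where w: "w \<in> K" and xb: "xb \<in> c_subdiff c \<phi> (\<psi> ((1 / 2) *\<^sub>R g + (1 / 2) *\<^sub>R w))"
        unfolding Kh_def half by blast
      \<comment> \<open>The covector of \<open>xb\<close> is to be tested at \<open>xc\<close>,
        while \<open>xb\<close> is a c-subgradient at \<open>?x\<close>; the difference of costs
        \<open>?m\<close> links the two points.\<close>
      let ?x = "\<psi> ((1 / 2) *\<^sub>R g + (1 / 2) *\<^sub>R w)"
      let ?m = "\<lambda>x. - c x xb + c x xb0"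
      \<comment> \<open>Membership of \<open>y\<close> in the section bounds \<open>\<phi> y\<close>
        from above, the subgradient at \<open>?x\<close> bounds it from below, and the subgradient
        at \<open>x0\<close> bounds \<open>\<phi> ?x\<close> from below; all values of
        \<open>\<phi>\<close> cancel.\<close>
      have m_le: "?m y \<le> ?m ?x + h" if "y \<in> Z" for y
      proof -
        have "\<phi> y - \<phi> x0 \<le> - c y xb0 + c x0 xb0 + h" using that unfolding Z(1) section_set_def by blast
        moreover have "\<phi> y - \<phi> ?x \<ge> - c y xb + c ?x xb" using xb unfolding c_subdiff_def by blast
        moreover have "\<phi> ?x - \<phi> x0 \<ge> - c ?x xb0 + c x0 xb0" using xb0 unfolding c_subdiff_def by blast
        ultimately show ?thesis by linarith
      qed
      have dd: "q \<in> dual_dom N M (cbar c) xb0" if "q \<in> K" for q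
        unfolding dual_dom_def Q_def[symmetric] using that K(3) QZ by blast
      \<comment> \<open>Convexity at the midpoint and \<open>m_le\<close> at the far end
        \<open>w\<close> give \<open>m(x) \<le> (m(xc) + m(x) + h) / 2\<close>; absorbing
        \<open>m(x)\<close> yields the bound at \<open>xc\<close>.\<close>
      have "?m ?x \<le> (1 / 2) * ?m xc + (1 / 2) * ?m (\<psi> w)"
        using cost_difference_convex[OF dasm dc2 dd[OF g] dd[OF w], of "1 / 2" xb, folded Q_def, folded \<psi>_def]
        by (simp add: cbar_def xc_def)
      moreover have "?m (\<psi> w) \<le> ?m ?x + h" using w K(3) \<psi>Z(1) by (intro m_le) blast
      moreover have "a \<le> b + h" if "a \<le> (1 / 2) * b + (1 / 2) * d" "d \<le> a + h" for a b d :: real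
        using that by (simp add: field_simps)
      ultimately have xxc: "?m ?x \<le> ?m xc + h" by blast
      show "xb \<in> S \<union> c_cut M N c xc"
      proof (cases "xb \<in> c_cut M N c xc")
        case False
        have "(?f xb - ?f xb0) \<bullet> (A *v (v - g)) \<le> 2 * h" if v: "v \<in> K" for v
        proof -
          have "(?f xb - ?f xb0) \<bullet> L (v - Q xc) \<le> ?m (\<psi> v) - ?m xc"
            using neg_D_difference_le[OF M N tw2 dasm dc2 xc' False L(4)[unfolded \<psi>_def Q_def] dd[OF v]]
            unfolding \<psi>_def Q_def .
          moreover have "?m (\<psi> v) \<le> ?m ?x + h" using v K(3) \<psi>Z(1) by (intro m_le) blast
          ultimately show ?thesis using xxc by (simp only: LA xc(3)) 
        qed
        then have "xb \<in> S" unfolding S_def P_def using False by blast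
        then show ?thesis by blast
      qed blast
    qed
    have 1: "ennreal lam * emeasure ?\<mu> (\<psi> ` Kh) \<le> emeasure ?\<nu> S"
    proof -
      have "ennreal lam * emeasure ?\<mu> (\<psi> ` Kh) = ennreal lam * vol M (\<psi> ` Kh)"
        by (simp only: vol_eq_emeasure[OF M pre(1)[OF Kh KhZ]])
      also have "\<dots> \<le> vol N (\<Union>x\<in>\<psi> ` Kh. c_subdiff c \<phi> x)" by (rule vol[OF pre(1)[OF Kh KhZ]])
      also have "\<dots> \<le> emeasure ?\<nu> (S \<union> c_cut M N c xc)"
        by (rule vol_le_emeasure[OF N sub sets.Un[OF S c_cut_null(1)[OF N tw1 ce dc1]]])
      also have "\<dots> \<le> emeasure ?\<nu> S + emeasure ?\<nu> (c_cut M N c xc)"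
        by (rule emeasure_subadditive) (simp_all only: sets_riem_measure[OF N] S c_cut_null(1)[OF N tw1 ce dc1])
      finally show ?thesis by (simp only: c_cut_null(2)[OF N tw1 ce dc1] add_0_right)
    qed
    \<comment> \<open>Where the Jacobian of \<open>c_Exp\<close> is at most \<open>D\<close>, its
      inverse \<open>?f\<close> enlarges volume by at least \<open>1 / D\<close>; the factor
      \<open>\<rho>\<close> converts covectors at \<open>xc\<close> from orthonormal to preferred
      coordinates.\<close>
    have 2: "ennreal (\<rho> / D) * emeasure ?\<nu> S \<le> emeasure lborel P"
    proof -
      have "ennreal (\<rho> / D) * emeasure ?\<nu> S \<le> emeasure lborel (?f ` S)"
      proof (rule emeasure_embedding_ge[OF N open_compl_c_cut emb1 S])
        show "S \<subseteq> ?V" unfolding S_def by blast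
        show "0 \<le> \<rho> / D" using pos bounds(2) by simp
        fix xb assume "xb \<in> S"
        then have xb: "xb \<notin> c_cut M N c xc" unfolding S_def by blast
        let ?d = "\<bar>det (matrix (tangent_map (atlas N) euclidean_atlas ?f xb))\<bar>"
        have "?f xb \<in> dual_dom M N c xc" unfolding dual_dom_def using xb by blast
        then have "\<bar>det_d_c_Exp M N c xc (?f xb)\<bar> * ?d \<le> D * ?d"
          by (intro mult_right_mono bounds(5)[OF xc(1)]) auto
        then have "metric_density N xb * \<rho> \<le> D * ?d"
          unfolding abs_det_d_c_Exp[OF M N tw1 xb] \<rho>_def .
        then show "\<rho> / D * metric_density N xb \<le> ?d" using bounds(2) by (simp add: field_simps)
      qed
      also have "\<dots> \<le> emeasure lborel P"
        by (rule emeasure_mono) (use borel_closed[OF P] in \<open>auto simp: S_def\<close>)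
      finally show ?thesis .
    qed
    have 3: "emeasure lborel K * emeasure lborel P \<le> ennreal ((2 * h) ^ CARD('n) * (Mx * \<rho> * \<gamma>) * nb)"
    proof -
      have "emeasure lborel K * emeasure lborel P \<le> ennreal ((2 * h) ^ CARD('n) / \<bar>det A\<bar> * nb)"
        unfolding P_def by (rule polar[OF dA0]) (use h in simp)
      also have "\<dots> \<le> ennreal ((2 * h) ^ CARD('n) * (Mx * \<rho> * \<gamma>) * nb)"
      proof (rule ennreal_leI, rule mult_right_mono)
        show "(2 * h) ^ CARD('n) / \<bar>det A\<bar> \<le> (2 * h) ^ CARD('n) * (Mx * \<rho> * \<gamma>)"
          using mult_left_mono[OF invA, of "(2 * h) ^ CARD('n)"] h by simp
      qed (simp add: nb_def)
      finally show ?thesis .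
    qed
    have 4: "ennreal ((1 / 2) ^ CARD('n)) * emeasure lborel K \<le> ennreal (Mx * \<gamma>) * emeasure ?\<mu> (\<psi> ` Kh)"
    proof -
      have "emeasure lborel (Q ` \<psi> ` Kh) \<le> ennreal (Mx * \<gamma>) * emeasure ?\<mu> (\<psi> ` Kh)"
      proof (rule emeasure_embedding_le[OF M open_compl_c_cut emb pre(1,2)[OF Kh KhZ]])
        show "0 \<le> Mx * \<gamma>" using Mx pos by simp
        fix x assume "x \<in> \<psi> ` Kh"
        then have x: "x \<in> Z" using \<psi>Z(1) KhZ by blast
        show "\<bar>det (matrix (?T x))\<bar> \<le> Mx * \<gamma> * metric_density M x"
          unfolding det_T[OF x]
          using mult_right_mono[OF bounds(4)[OF x], of "metric_density M x * \<gamma>"] pos metric_density_pos[OF M, of x]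
          by (simp add: mult_ac)
      qed
      then show ?thesis by (simp only: pre(3)[OF Kh KhZ] vol_Kh)
    qed
    have 5: "ennreal (mn * \<gamma>) * emeasure ?\<mu> (\<psi> ` K) \<le> emeasure lborel K"
    proof -
      have "ennreal (mn * \<gamma>) * emeasure ?\<mu> (\<psi> ` K) \<le> emeasure lborel (Q ` \<psi> ` K)"
      proof (rule emeasure_embedding_ge[OF M open_compl_c_cut emb pre(1,2)[OF K(1,3)]])
        show "0 \<le> mn * \<gamma>" using bounds(1) pos by simp
        fix x assume "x \<in> \<psi> ` K"
        then have x: "x \<in> Z" using \<psi>Z(1) K(3) by blast
        show "mn * \<gamma> * metric_density M x \<le> \<bar>det (matrix (?T x))\<bar>"
          unfolding det_T[OF x]
          using mult_right_mono[OF bounds(3)[OF x], of "metric_density M x * \<gamma>"] pos metric_density_pos[OF M, of x]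
          by (simp add: mult_ac)
      qed
      then show ?thesis by (simp only: pre(3)[OF K(1,3)])
    qed
    have "emeasure lborel K \<noteq> \<infinity>"
      using emeasure_compact_finite[OF K(1)] by (simp add: less_top)
    from volume_chain_arith_ennreal[OF lam bounds(1) pos bounds(2) _ h _ this 1 2 3 4 5] Mx
    show ?thesis by (simp add: nb_def)
  qed
qed

text \<open>Inner parallel sets cut off by growing balls. The centres of open balls of fixed radius
  inside \<open>C\<close> form the complement of a union of open balls about the points outside
  \<open>C\<close>, hence a closed set. It is convex because equal displacements \<open>e\<close> of
  two centres combine to the displacement \<open>e\<close> of any point between them.\<close>

lemma convex_interior_compact_exhaustion:
  fixes C :: "'a::euclidean_space set"
  assumes C: "convex C"
  obtains K :: "nat \<Rightarrow> 'a set" where "\<And>j. compact (K j)" "\<And>j. convex (K j)" "\<And>j. K j \<subseteq> C"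
    "incseq K" "(\<Union>j. K j) = interior C"
proof -
  define I where "I r = {q. ball q r \<subseteq> C}" for r
  define K where "K j = I (1 / real (Suc j)) \<inter> cball 0 (real j)" for j
  have I_closed: "closed (I r)" for r
  proof -
    have "I r = - (\<Union>y\<in>-C. ball y r)" unfolding I_def by (auto simp: dist_commute subset_iff)
    moreover have "closed (- (\<Union>y\<in>-C. ball y r))" by (intro closed_Compl open_UN ballI open_ball)
    ultimately show ?thesis by (simp only:)
  qed
  have I_convex: "convex (I r)" for r
    unfolding convex_alt
  proof (intro ballI allI impI)
    fix p q and t :: real assume p: "p \<in> I r" and q: "q \<in> I r" and t: "0 \<le> t \<and> t \<le> 1"
    have "z \<in> C" if z: "z \<in> ball ((1 - t) *\<^sub>R p + t *\<^sub>R q) r" for z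
    proof -
      define e where "e = z - ((1 - t) *\<^sub>R p + t *\<^sub>R q)"
      have "norm e < r" using z by (simp add: e_def dist_norm norm_minus_commute)
      then have "p + e \<in> ball p r" "q + e \<in> ball q r" by (simp_all add: dist_norm)
      then have "p + e \<in> C" "q + e \<in> C" using p q unfolding I_def by blast+
      then have "(1 - t) *\<^sub>R (p + e) + t *\<^sub>R (q + e) \<in> C" using C t by (intro convexD) auto
      also have "(1 - t) *\<^sub>R (p + e) + t *\<^sub>R (q + e) = z" by (simp add: e_def algebra_simps)
      finally show ?thesis .
    qed
    then show "(1 - t) *\<^sub>R p + t *\<^sub>R q \<in> I r" unfolding I_def by blast
  qed
  show thesis
  proof (rule that[of K])
    show "compact (K j)" for j unfolding K_def by (intro closed_Int_compact I_closed compact_cball)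
    show "convex (K j)" for j unfolding K_def by (intro convex_Int I_convex convex_cball)
    show "K j \<subseteq> C" for j
    proof
      fix q assume "q \<in> K j"
      then have "ball q (1 / real (Suc j)) \<subseteq> C" unfolding K_def I_def by blast
      then show "q \<in> C" by (rule subsetD) simp
    qed
    show "incseq K"
    proof (rule incseq_SucI)
      fix j
      have "ball q (1 / real (Suc (Suc j))) \<subseteq> ball q (1 / real (Suc j))" for q :: 'a
        by (rule subset_ball) (simp add: frac_le)
      moreover have "cball 0 (real j) \<subseteq> cball (0 :: 'a) (real (Suc j))" by (rule subset_cball) simp
      ultimately show "K j \<subseteq> K (Suc j)" unfolding K_def I_def by blast
    qed
    show "(\<Union>j. K j) = interior C"
    proof (intro set_eqI iffI)
      fix q assume "q \<in> (\<Union>j. K j)"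
      then obtain j where "ball q (1 / real (Suc j)) \<subseteq> C" unfolding K_def I_def by blast
      then show "q \<in> interior C" unfolding mem_interior by (intro exI[of _ "1 / real (Suc j)"]) simp
    next
      fix q assume "q \<in> interior C"
      then obtain e where e: "e > 0" "ball q e \<subseteq> C" unfolding mem_interior by blast
      obtain i :: nat where i: "1 / real (Suc i) < e" using nat_approx_posE[OF e(1)] by blast
      obtain k :: nat where k: "norm q \<le> real k" using real_arch_simple by blast
      let ?j = "max i k"
      have "1 / real (Suc ?j) \<le> 1 / real (Suc i)" by (rule frac_le) auto
      then have "ball q (1 / real (Suc ?j)) \<subseteq> C" using e(2) i by (intro order.trans[OF subset_ball e(2)]) simp
      moreover have "q \<in> cball 0 (real ?j)" using k by simp
      ultimately have "q \<in> K ?j" unfolding K_def I_def by blast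
      then show "q \<in> (\<Union>j. K j)" by blast
    qed
  qed
qed

text \<open>Compact sets exhaust only the interior of the convex image. The rest of the section lies
  over its frontier, which is null, and \<open>emeasure_embedding_null\<close> carries this back to
  the manifold.\<close>

lemma section_estimate:
  fixes M :: "('a::{t2_space, second_countable_topology}, 'n::finite) riem"
    and N :: "('b::{t2_space, second_countable_topology}, 'n) riem"
  assumes M: "riemannian_manifold M" and N: "riemannian_manifold N"
    and tw: "twist M N c" and ce: "c_exp_half M N c" and dc: "domain_convexity M N c"
    and dasm: "convex_DASM_half N M (cbar c)" and cc: "c_convex c \<phi>"
    and lam: "lam > 0"
    and vol: "\<And>\<Omega>. \<Omega> \<in> sets borel \<Longrightarrow> ennreal lam * vol M \<Omega> \<le> vol N (\<Union>x\<in>\<Omega>. c_subdiff c \<phi> x)"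
    and xb0: "xb0 \<in> c_subdiff c \<phi> x0" and h: "h > 0"
    and Z: "Z = section_set c \<phi> x0 xb0 h" "Z \<subseteq> - c_cut N M (cbar c) xb0"
    and bounds: "mn > 0" "D > 0" "\<And>x. x \<in> Z \<Longrightarrow> mn \<le> \<bar>det_mixed M N c x xb0\<bar>"
      "\<And>x. x \<in> Z \<Longrightarrow> \<bar>det_mixed M N c x xb0\<bar> \<le> Mx"
      "\<And>x p. x \<in> Z \<Longrightarrow> p \<in> dual_dom M N c x \<Longrightarrow> \<bar>det_d_c_Exp M N c x p\<bar> \<le> D"
  shows "ennreal lam * (vol M Z)\<^sup>2
      \<le> ennreal (4 ^ CARD('n) * (real CARD('n) ^ CARD('n) * (measure lborel (ball (0 :: real^'n) 1))\<^sup>2)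
          * (Mx / mn)\<^sup>2 * D * h ^ CARD('n))" (is "_ \<le> ennreal ?R")
proof -
  let ?\<mu> = "riem_measure M" and ?U = "- c_cut N M (cbar c) xb0"
  define R where "R = ?R"
  define Q where "Q = neg_D N (cbar c) xb0"
  define \<psi> where "\<psi> = inv_into ?U Q"
  have tw2: "twist_half N M (cbar c)" using tw by (simp add: twist_def)
  have dc2: "domain_convexity_half N M (cbar c)" using dc by (simp add: domain_convexity_def)
  note emb = twist_half_embedding[OF tw2, of xb0, folded Q_def]
  have inv: "\<psi> (Q y) = y" if "y \<in> ?U" for y
    unfolding \<psi>_def by (rule inv_into_f_f[OF embedding_inj_on[OF M open_compl_c_cut emb] that])
  have conv: "convex (Q ` Z)" unfolding Q_def by (rule section_convex[OF M tw2 dasm dc2 cc Z])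
  obtain K :: "nat \<Rightarrow> (real^'n) set" where K: "\<And>j. compact (K j)" "\<And>j. convex (K j)" "\<And>j. K j \<subseteq> Q ` Z"
    "incseq K" "(\<Union>j. K j) = interior (Q ` Z)"
  proof (rule convex_interior_compact_exhaustion[OF conv], goal_cases)
    case (1 K)
    show ?case by (rule 1(1)[OF 1(2-6)])
  qed
  have est: "\<psi> ` K' \<in> sets borel" "ennreal lam * (emeasure ?\<mu> (\<psi> ` K'))\<^sup>2 \<le> ennreal R"
    if K': "compact K'" "convex K'" "K' \<subseteq> Q ` Z" for K'
  proof -
    note K'' = K'[unfolded Q_def]
    show "\<psi> ` K' \<in> sets borel"
      unfolding \<psi>_def Q_def
    proof (rule compact_section_estimate(1)[OF M N tw ce dc dasm lam _ xb0 h Z bounds(1,2) _ _ _ K''])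
    qed (fact vol bounds)+
    show "ennreal lam * (emeasure ?\<mu> (\<psi> ` K'))\<^sup>2 \<le> ennreal R"
      unfolding \<psi>_def Q_def R_def
    proof (rule compact_section_estimate(2)[OF M N tw ce dc dasm lam _ xb0 h Z bounds(1,2) _ _ _ K''])
    qed (fact vol bounds)+
  qed
  have R: "R \<ge> 0" unfolding R_def using bounds(2) h by simp
  have X: "\<psi> ` K j \<in> sets ?\<mu>" for j
    unfolding sets_riem_measure[OF M] by (rule est(1)[OF K(1-3)])
  \<comment> \<open>A square root turns the estimate into a bound on the volume itself, uniform in
    \<open>j\<close>, which passes to the increasing union. The volume is finite because
    \<open>lam\<close> times its square is at most the real number \<open>R\<close>.\<close>
  have le: "emeasure ?\<mu> (\<psi> ` K j) \<le> ennreal (sqrt (R / lam))" for j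
  proof -
    let ?y = "emeasure ?\<mu> (\<psi> ` K j)"
    have e: "ennreal lam * ?y\<^sup>2 \<le> ennreal R"
      by (rule est(2)[OF K(1-3)])
    have "?y \<noteq> \<infinity>"
    proof
      assume y: "?y = \<infinity>"
      have "ennreal lam * \<infinity>\<^sup>2 = \<infinity>" using lam by (simp add: ennreal_mult_top power2_eq_square)
      then have "\<infinity> \<le> ennreal R" using e unfolding y by (simp only:)
      then show False by (simp add: top_unique)
    qed
    then obtain y where y: "?y = ennreal y" "y \<ge> 0" by (cases ?y) auto
    have "ennreal (lam * y\<^sup>2) \<le> ennreal R"
    proof -
      have "ennreal (lam * y\<^sup>2) = ennreal lam * ennreal (y\<^sup>2)" by (rule ennreal_mult) (use lam in simp_all)
      also have "ennreal (y\<^sup>2) = (ennreal y)\<^sup>2" by (rule ennreal_power[OF y(2), symmetric])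
      finally show ?thesis using e unfolding y(1) by simp
    qed
    then have "lam * y\<^sup>2 \<le> R" using R by (simp only: ennreal_le_iff)
    then have "y\<^sup>2 \<le> R / lam" using lam by (simp add: pos_le_divide_eq mult.commute)
    then have "y \<le> sqrt (R / lam)" by (rule real_le_rsqrt)
    then show ?thesis unfolding y(1) by (rule ennreal_leI)
  qed
  have "emeasure ?\<mu> (\<Union>j. \<psi> ` K j) = (SUP j. emeasure ?\<mu> (\<psi> ` K j))"
  proof (rule SUP_emeasure_incseq[symmetric])
    show "range (\<lambda>j. \<psi> ` K j) \<subseteq> sets ?\<mu>" using X by blast
    show "incseq (\<lambda>j. \<psi> ` K j)" by (rule incseq_SucI) (rule image_mono[OF incseq_SucD[OF K(4)]])
  qed
  also have "\<dots> \<le> ennreal (sqrt (R / lam))" by (rule SUP_least) (rule le)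
  finally have le': "emeasure ?\<mu> (\<Union>j. \<psi> ` K j) \<le> ennreal (sqrt (R / lam))" .
  define F where "F = ?U \<inter> Q -` frontier (Q ` Z)"
  have F: "F \<in> sets borel"
    unfolding F_def
    by (rule borel_continuous_preimage[OF open_compl_c_cut smooth_map_euclideanD(1)[OF embedding_smooth[OF M open_compl_c_cut emb]] frontier_closed])
  have F0: "emeasure ?\<mu> F = 0"
  proof (rule emeasure_embedding_null[OF M open_compl_c_cut emb F])
    show "F \<subseteq> ?U" unfolding F_def by blast
    show "negligible (Q ` F)"
      by (rule negligible_subset[OF negligible_convex_frontier[OF conv]]) (auto simp: F_def)
  qed
  have "Z \<subseteq> (\<Union>j. \<psi> ` K j) \<union> F"
  proof
    fix x assume x: "x \<in> Z"
    then have xU: "x \<in> ?U" using Z(2) by blast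
    show "x \<in> (\<Union>j. \<psi> ` K j) \<union> F"
    proof (cases "Q x \<in> interior (Q ` Z)")
      case True
      then have "Q x \<in> (\<Union>j. K j)" by (simp only: K(5))
      then obtain j where "Q x \<in> K j" by blast
      then have "\<psi> (Q x) \<in> \<psi> ` K j" by (rule imageI)
      then show ?thesis unfolding inv[OF xU] by blast
    next
      case False
      moreover have "Q x \<in> closure (Q ` Z)" by (rule subsetD[OF closure_subset imageI[OF x]])
      ultimately have "Q x \<in> frontier (Q ` Z)" unfolding frontier_def by (rule DiffI[rotated])
      then show ?thesis using xU unfolding F_def by (intro UnI2 IntI vimageI2)
    qed
  qed
  moreover have U: "(\<Union>j. \<psi> ` K j) \<in> sets ?\<mu>" using X by (intro sets.countable_UN) auto
  have F': "F \<in> sets ?\<mu>" using F by (simp only: sets_riem_measure[OF M])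
  have "(\<Union>j. \<psi> ` K j) \<union> F \<in> sets borel" using sets.Un[OF U F'] by (simp only: sets_riem_measure[OF M])
  ultimately have "vol M Z \<le> emeasure ?\<mu> ((\<Union>j. \<psi> ` K j) \<union> F)"
    by (intro vol_le_emeasure[OF M])
  also have "\<dots> \<le> emeasure ?\<mu> (\<Union>j. \<psi> ` K j) + emeasure ?\<mu> F" by (rule emeasure_subadditive[OF U F'])
  also have "\<dots> \<le> ennreal (sqrt (R / lam))" using le' by (simp only: F0 add_0_right)
  finally have "(vol M Z)\<^sup>2 \<le> (ennreal (sqrt (R / lam)))\<^sup>2" by (rule power_mono) simp
  also have "\<dots> = ennreal ((sqrt (R / lam))\<^sup>2)" by (rule ennreal_power) (use R lam in simp)
  also have "(sqrt (R / lam))\<^sup>2 = R / lam" using R lam by simp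
  finally have "(vol M Z)\<^sup>2 \<le> ennreal (R / lam)" .
  then have "ennreal lam * (vol M Z)\<^sup>2 \<le> ennreal lam * ennreal (R / lam)" by (rule mult_left_mono) simp
  also have "\<dots> = ennreal (lam * (R / lam))" using lam R by (intro ennreal_mult[symmetric]) simp_all
  also have "lam * (R / lam) = R" using lam by simp
  finally show ?thesis by (simp only: R_def)
qed

text \<open>\<open>section_estimate\<close> takes real bounds, whereas the extrema here are formed
  in \<open>ennreal\<close> and may degenerate. In that case the right side must be shown infinite,
  and since \<open>0 * \<infinity> = 0\<close> this calls for all its factors to be nonzero.\<close>

theorem lemma4p1:
  fixes M :: "('a::{t2_space, second_countable_topology}, 'n::finite) riem"
    and N :: "('b::{t2_space, second_countable_topology}, 'n) riem"
    and c :: "'a \<Rightarrow> 'b \<Rightarrow> real"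
    and \<phi> :: "'a \<Rightarrow> real"
    and lam h :: real
    and x0 :: 'a and xb0 :: 'b
    and Z :: "'a set"
  assumes "complete_riemannian_manifold M"
    and "complete_riemannian_manifold N"
    and "semiconcave_cost M N c"
    and "twist M N c"
    and "c_exp M N c"
    and "domain_convexity M N c"
    and "convex_DASM M N c"
    and "c_convex c \<phi>"
    and "lam > 0"
    and "\<And>\<Omega>. \<Omega> \<in> sets borel \<Longrightarrow> ennreal lam * vol M \<Omega> \<le> vol N (\<Union>x\<in>\<Omega>. c_subdiff c \<phi> x)"
    and "xb0 \<in> c_subdiff c \<phi> x0"
    and "h > 0"
    and "Z = section_set c \<phi> x0 xb0 h"
    and "Z \<subseteq> - c_cut N M (cbar c) xb0"
  shows "ennreal lam * (vol M Z)\<^sup>2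
    \<le> ennreal ((4 * real CARD('n)) ^ CARD('n) * (measure lborel (ball (0 :: real^'n) 1))\<^sup>2)
      * ((SUP x\<in>Z. ennreal \<bar>det_mixed M N c x xb0\<bar>) / (INF x\<in>Z. ennreal \<bar>det_mixed M N c x xb0\<bar>))\<^sup>2
      * (SUP x\<in>Z. SUP p\<in>dual_dom M N c x. ennreal \<bar>det_d_c_Exp M N c x p\<bar>)
      * ennreal (h ^ CARD('n))"
proof -
  have M: "riemannian_manifold M" and N: "riemannian_manifold N"
    using assms(1,2) by (simp_all add: complete_riemannian_manifold_def)
  have tw1: "twist_half M N c" and tw2: "twist_half N M (cbar c)" using assms(4) by (simp_all add: twist_def)
  have ce: "c_exp_half M N c" using assms(5) by (simp add: c_exp_def)
  have dasm: "convex_DASM_half N M (cbar c)" using assms(7) by (simp add: convex_DASM_def)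
  note Z = assms(13,14)
  let ?C = "(4 * real CARD('n)) ^ CARD('n) * (measure lborel (ball (0 :: real^'n) 1))\<^sup>2"
  define s where "s = (SUP x\<in>Z. ennreal \<bar>det_mixed M N c x xb0\<bar>)"
  define i where "i = (INF x\<in>Z. ennreal \<bar>det_mixed M N c x xb0\<bar>)"
  define d where "d = (SUP x\<in>Z. SUP p\<in>dual_dom M N c x. ennreal \<bar>det_d_c_Exp M N c x p\<bar>)"
  have "measure lborel (ball (0 :: real^'n) 1) > 0" by (simp add: content_ball_pos)
  then have C: "?C > 0" by simp
  have x0: "x0 \<in> Z" using assms(12) unfolding Z(1) section_set_def by simp
  have s: "ennreal \<bar>det_mixed M N c x xb0\<bar> \<le> s" if "x \<in> Z" for x
    unfolding s_def using that by (rule SUP_upper)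
  have i: "i \<le> ennreal \<bar>det_mixed M N c x xb0\<bar>" if "x \<in> Z" for x
    unfolding i_def using that by (rule INF_lower)
  have d: "ennreal \<bar>det_d_c_Exp M N c x p\<bar> \<le> d" if "x \<in> Z" "p \<in> dual_dom M N c x" for x p
  proof -
    have "ennreal \<bar>det_d_c_Exp M N c x p\<bar> \<le> (SUP p\<in>dual_dom M N c x. ennreal \<bar>det_d_c_Exp M N c x p\<bar>)"
      using that(2) by (rule SUP_upper)
    also have "\<dots> \<le> d" unfolding d_def using that(1) by (rule SUP_upper)
    finally show ?thesis .
  qed
  have x0c: "x0 \<notin> c_cut N M (cbar c) xb0" using x0 Z(2) by blast
  \<comment> \<open>The mixed determinant is a nonzero multiple of the Jacobian of an embedding, so
    the single point \<open>x0\<close> already makes the supremum positive.\<close>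
  have "det_mixed M N c x0 xb0 \<noteq> 0"
  proof
    assume "det_mixed M N c x0 xb0 = 0"
    then have "det (matrix (tangent_map (atlas M) euclidean_atlas (neg_D N (cbar c) xb0) x0)) = 0"
      using abs_det_mixed[OF M N tw2 x0c] by simp
    moreover have "x0 \<in> - c_cut N M (cbar c) xb0" using x0c by simp
    ultimately show False
      using det_embedding_nonzero[OF M open_compl_c_cut twist_half_embedding[OF tw2]] by blast
  qed
  then have s0: "s \<noteq> 0" using s[OF x0] by auto
  have itop: "i \<noteq> \<infinity>" using i[OF x0] by (auto simp: top_unique)
  \<comment> \<open>\<open>c_Exp\<close> maps the closure of \<open>dual_dom M N c x0\<close> onto
    the whole manifold, so the domain is nonempty. At its points the determinant has a product with
    another determinant equal to a product of positive densities.\<close>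
  have d0: "d \<noteq> 0"
  proof -
    have "closure (dual_dom M N c x0) \<noteq> {}" using ce unfolding c_exp_half_def by (metis empty_not_UNIV image_is_empty)
    then obtain p where p: "p \<in> dual_dom M N c x0" by auto
    then obtain xb where xb: "xb \<notin> c_cut M N c x0" "p = neg_D M c x0 xb" unfolding dual_dom_def by blast
    have "det_d_c_Exp M N c x0 p \<noteq> 0"
    proof
      assume "det_d_c_Exp M N c x0 p = 0"
      then have "metric_density N xb * metric_density M x0 = 0"
        using abs_det_d_c_Exp[OF M N tw1 xb(1)] unfolding xb(2) by simp
      then show False using metric_density_pos[OF M, of x0] metric_density_pos[OF N, of xb] by simp
    qed
    then show ?thesis using d[OF x0 p] by auto
  qed
  have "ennreal lam * (vol M Z)\<^sup>2 \<le> ennreal ?C * (s / i)\<^sup>2 * d * ennreal (h ^ CARD('n))"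
  \<comment> \<open>Because \<open>s\<close> is nonzero and \<open>i\<close> finite, both an
    infinite supremum and a vanishing infimum make the quotient \<open>s / i\<close>
    infinite.\<close>
  proof (cases "s = \<infinity> \<or> i = 0 \<or> d = \<infinity>")
    case True
    have h0: "ennreal (h ^ CARD('n)) \<noteq> 0" using assms(12) by simp
    have C0: "ennreal ?C \<noteq> 0" using C by (simp only: ennreal_eq_0_iff not_le)
    have si0: "s / i \<noteq> 0" using s0 itop by (simp add: ennreal_divide_eq_0_iff)
    have "(s / i)\<^sup>2 = \<infinity> \<or> d = \<infinity>"
    proof (cases "d = \<infinity>")
      case False
      then have "s / i = \<infinity>" using True s0 itop by (auto simp: ennreal_divide_eq_top_iff)
      then show ?thesis by (simp add: power2_eq_square)
    qed simp
    moreover have "(s / i)\<^sup>2 \<noteq> 0" using si0 by simp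
    ultimately have "ennreal ?C * (s / i)\<^sup>2 * d * ennreal (h ^ CARD('n)) = \<infinity>"
      using C0 h0 d0 by (auto simp: ennreal_mult_eq_top_iff simp del: ennreal_eq_0_iff)
    then show ?thesis by (simp only: infinity_ennreal_def top_greatest)
  next
    case False
    then obtain s' i' d' where r: "s = ennreal s'" "s' \<ge> 0" "i = ennreal i'" "i' \<ge> 0" "d = ennreal d'" "d' \<ge> 0"
      using itop by (metis ennreal_cases infinity_ennreal_def)
    have pos: "i' > 0" "d' > 0" using False d0 r by (auto simp: less_le)
    have "ennreal lam * (vol M Z)\<^sup>2
      \<le> ennreal (4 ^ CARD('n) * (real CARD('n) ^ CARD('n) * (measure lborel (ball (0 :: real^'n) 1))\<^sup>2)
          * (s' / i')\<^sup>2 * d' * h ^ CARD('n))"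
    proof (rule section_estimate[OF M N assms(4) ce assms(6) dasm assms(8,9,10,11,12) Z pos])
      show "i' \<le> \<bar>det_mixed M N c x xb0\<bar>" if "x \<in> Z" for x
        using i[OF that] unfolding r(3) by (simp only: ennreal_le_iff abs_ge_zero)
      show "\<bar>det_mixed M N c x xb0\<bar> \<le> s'" if "x \<in> Z" for x
        using s[OF that] unfolding r(1) by (simp only: ennreal_le_iff r(2))
      show "\<bar>det_d_c_Exp M N c x p\<bar> \<le> d'" if "x \<in> Z" "p \<in> dual_dom M N c x" for x p
        using d[OF that] unfolding r(5) by (simp only: ennreal_le_iff r(6))
    qed
    also have "\<dots> = ennreal (?C * (s' / i')\<^sup>2 * d' * h ^ CARD('n))"
      by (simp add: power_mult_distrib mult_ac)
    also have "\<dots> = ennreal ?C * (s / i)\<^sup>2 * d * ennreal (h ^ CARD('n))"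
    proof -
      have "s / i = ennreal (s' / i')" unfolding r(1,3) by (rule divide_ennreal[OF r(2) pos(1)])
      then have "(s / i)\<^sup>2 = ennreal ((s' / i')\<^sup>2)" using r pos by (simp add: ennreal_power)
      moreover have "0 \<le> ?C" "0 \<le> (s' / i')\<^sup>2" "0 \<le> ?C * (s' / i')\<^sup>2" "0 \<le> ?C * (s' / i')\<^sup>2 * d'" "0 \<le> h ^ CARD('n)"
        using C pos assms(12) by simp_all
      ultimately show ?thesis unfolding r(5) using r(6) by (simp only: ennreal_mult[symmetric])
    qed
    finally show ?thesis .
  qed
  then show ?thesis unfolding s_def i_def d_def .
qed

end
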